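(* Let $1<p<\infty$, let $u,v$ be measurable functions on the tree $\Gamma$ with $v\in L^p(\Gamma)$ and $u\in L^{p'}(K)$ for every $K\subset\subset\Gamma$, let $a\in\Gamma$ and $T=T_a$. Suppose that there is a constant $B<\infty$ such that $B_{k,i}<B$ for each admissible $k$ and each $i$. Then, for any $q>0$, there exists a constant $c>0$ such that $$\|\{\sigma_{k,i}\}\|_{l^q(\mathbf{Z}\times\mathbf{N})}\le c\,\|\{a_k(T)\}\|_{l^q(\mathbf{N})}.$$
   Context: A tree $\Gamma$ is a connected graph without loops or cycles whose edges are non-degenerate closed line segments with the vertices as end-points; every vertex has finite degree. For $x,y\in\Gamma$, $(x,y)$ denotes the unique polygonal path in $\Gamma$ joining $x$ and $y$; the distance between $x$ and $y$ is the length of this path, $\Gamma$ carries the resulting metric topology and the natural one-dimensional Lebesgue measure. $\int_a^x g(t)\,dt$ denotes the (unsigned) integral of $g$ over the points of the path $(a,x)$. $\partial K$ is the set of boundary points of $K$ in $\Gamma$; $K\subset\subset\Gamma$ means that the closure of $K$ is compact. $p'$ is the conjugate exponent of $p$. $T_af(x)=v(x)\int_a^x f(t)u(t)\,dt$. The $m$-th approximation number ($m\in\mathbf N$) of $T:L^p(\Gamma)\to L^p(\Gamma)$ is $a_m(T)=\inf\|T-F\,|\,L^p(\Gamma)\to L^p(\Gamma)\|$, the infimum over bounded linear $F:L^p(\Gamma)\to L^p(\Gamma)$ of rank less than $m$. $\mu(K)=\int_K|v|^p\,dt$; $U(x)=\int_a^x|u(t)|^{p'}dt$. $Z_k$ is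 the closure of $\{x\in\Gamma:2^{kp'/p}\le U(x)<2^{(k+1)p'/p}\}$, where $k$ may be any integer if $u\in L^{p'}_{loc}(\Gamma)\setminus L^{p'}(\Gamma)$, while if $u\in L^{p'}(\Gamma)$ only $k$ with $2^k\le\|u\|_{p',\Gamma}^p$ are used; these $k$ are called admissible. $Z_{k,i}$, $i=1,\dots,n_k$, are the connected components of $Z_k$. For admissible $k$ and $1\le i\le n_k$: $\sigma_{k,i}^p=2^k\mu(Z_{k,i})$, and $B_{k,i}=\#\partial Z_{k,i}-1$ (the number of boundary points of $Z_{k,i}$ excluding its root, the point nearest $a$). $\sigma_{k,i}=0$ for all other pairs $(k,i)$. *)

theory Defs
  imports "HOL-Analysis.Analysis"
begin

section \<open>Trees as geometric graphs\<close>

text \<open>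
  Each edge is listed once, as a pair \<open>(a, b)\<close> of its end vertices in an arbitrarily chosen order,
  and is a closed line segment of length \<open>glen G (a, b)\<close>. The order only serves to give the points
  of the edge a coordinate (the distance to \<open>a\<close>).
\<close>

record 'v graph =
  verts :: "'v set"
  edges :: "('v \<times> 'v) set"
  glen :: "'v \<times> 'v \<Rightarrow> real"

definition adjacent :: "'v graph \<Rightarrow> 'v \<Rightarrow> 'v \<Rightarrow> bool" where
  "adjacent G a b \<longleftrightarrow> (a, b) \<in> edges G \<or> (b, a) \<in> edges G"

definition is_cycle :: "'v graph \<Rightarrow> 'v list \<Rightarrow> bool" where
  "is_cycle G vs \<longleftrightarrow> 3 \<le> length vs \<and> distinct vs \<and>
     successively (adjacent G) vs \<and> adjacent G (last vs) (hd vs)"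

text \<open>
  The sixth conjunct excludes double edges, i.e. cycles of length two; \<^const>\<open>is_cycle\<close> covers the
  cycles of length at least three. The vertex set may be infinite, and there is no lower bound on
  the edge lengths.
\<close>

definition is_tree :: "'v graph \<Rightarrow> bool" where
  "is_tree G \<longleftrightarrow>
     verts G \<noteq> {} \<and>
     edges G \<subseteq> verts G \<times> verts G \<and>
     (\<forall>e\<in>edges G. 0 < glen G e) \<and>
     (\<forall>a\<in>verts G. finite {b. adjacent G a b}) \<and>
     (\<forall>a. (a, a) \<notin> edges G) \<and>
     (\<forall>a b. (a, b) \<in> edges G \<longrightarrow> (b, a) \<notin> edges G) \<and>
     (\<nexists>vs. is_cycle G vs) \<and>
     (\<forall>a\<in>verts G. \<forall>b\<in>verts G. (adjacent G)\<^sup>*\<^sup>* a b)"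

text \<open>A point is a vertex or a point \<open>Interior e t\<close> with \<open>0 < t < glen G e\<close>.\<close>

datatype 'v tpoint = Vertex 'v | Interior "'v \<times> 'v" real

definition edge_point :: "'v graph \<Rightarrow> 'v \<times> 'v \<Rightarrow> real \<Rightarrow> 'v tpoint" where
  "edge_point G e t =
     (if t = 0 then Vertex (fst e) else if t = glen G e then Vertex (snd e) else Interior e t)"

definition edge_seg :: "'v graph \<Rightarrow> 'v \<times> 'v \<Rightarrow> 'v tpoint set" where
  "edge_seg G e = edge_point G e ` {0..glen G e}"

definition points :: "'v graph \<Rightarrow> 'v tpoint set" where
  "points G = Vertex ` verts G \<union> (\<Union>e\<in>edges G. edge_seg G e)"


subsection \<open>One-dimensional Lebesgue measure\<close>

definition tree_sets :: "'v graph \<Rightarrow> 'v tpoint set set" where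
  "tree_sets G = {A. A \<subseteq> points G \<and>
     (\<forall>e\<in>edges G. {t\<in>{0..glen G e}. edge_point G e t \<in> A} \<in> sets lebesgue)}"

definition tree_measure :: "'v graph \<Rightarrow> 'v tpoint measure" where
  "tree_measure G = measure_of (points G) (tree_sets G)
     (\<lambda>A. \<integral>\<^sup>+e. emeasure lebesgue {t\<in>{0..glen G e}. edge_point G e t \<in> A}
             \<partial>count_space (edges G))"

text \<open>
  \<^const>\<open>measure_of\<close> yields the null measure unless its arguments form a measure space; the
  following facts show that they do.
\<close>

lemma sigma_algebra_tree_sets: "sigma_algebra (points G) (tree_sets G)"
proof -
  have C: "{t\<in>{0..glen G e}. edge_point G e t \<in> points G - A}
        = {0..glen G e} - {t\<in>{0..glen G e}. edge_point G e t \<in> A}" if "e \<in> edges G" for e A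
    using that by (auto simp: points_def edge_seg_def)
  have U: "{t\<in>{0..glen G e}. edge_point G e t \<in> (\<Union>i. A i)}
        = (\<Union>i. {t\<in>{0..glen G e}. edge_point G e t \<in> A i})" for e and A :: "nat \<Rightarrow> _"
    by auto
  show ?thesis
    unfolding sigma_algebra_iff2
  proof (intro conjI ballI allI impI)
    show "tree_sets G \<subseteq> Pow (points G)"
      by (auto simp: tree_sets_def)
    show "{} \<in> tree_sets G"
      by (simp add: tree_sets_def)
    show "points G - s \<in> tree_sets G" if "s \<in> tree_sets G" for s
    proof -
      have "{t\<in>{0..glen G e}. edge_point G e t \<in> points G - s} \<in> sets lebesgue"
        if "e \<in> edges G" for e
        unfolding C[OF that] using that \<open>s \<in> tree_sets G\<close>
        by (intro sets.Diff) (simp, unfold tree_sets_def, blast)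
      then show ?thesis unfolding tree_sets_def by blast
    qed
    show "(\<Union>i. A i) \<in> tree_sets G" if "range A \<subseteq> tree_sets G" for A :: "nat \<Rightarrow> _"
    proof -
      have *: "A i \<in> tree_sets G" for i using that by auto
      then have "(\<Union>i. A i) \<subseteq> points G"
        unfolding tree_sets_def by blast
      moreover have "{t\<in>{0..glen G e}. edge_point G e t \<in> (\<Union>i. A i)} \<in> sets lebesgue"
        if "e \<in> edges G" for e
        unfolding U using * that by (intro sets.countable_UN) (auto simp: tree_sets_def)
      ultimately show ?thesis by (simp add: tree_sets_def)
    qed
  qed
qed

lemma space_tree_measure: "space (tree_measure G) = points G"
  unfolding tree_measure_def
  by (rule space_measure_of) (auto simp: tree_sets_def)

lemma sets_tree_measure: "sets (tree_measure G) = tree_sets G"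
  unfolding tree_measure_def
  by (rule sigma_algebra.sets_measure_of_eq[OF sigma_algebra_tree_sets])

lemma emeasure_tree_measure:
  assumes "A \<in> tree_sets G"
  shows "emeasure (tree_measure G) A =
    (\<integral>\<^sup>+e. emeasure lebesgue {t\<in>{0..glen G e}. edge_point G e t \<in> A} \<partial>count_space (edges G))"
proof (rule emeasure_measure_of_sigma[OF sigma_algebra_tree_sets _ _ assms,
      where \<mu> = "\<lambda>A. \<integral>\<^sup>+e. emeasure lebesgue {t\<in>{0..glen G e}. edge_point G e t \<in> A}
             \<partial>count_space (edges G)", folded tree_measure_def])
  let ?P = "\<lambda>e A. {t\<in>{0..glen G e}. edge_point G e t \<in> A}"
  show "positive (tree_sets G) (\<lambda>A. \<integral>\<^sup>+e. emeasure lebesgue (?P e A) \<partial>count_space (edges G))"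
    by (simp add: positive_def)
  show "countably_additive (tree_sets G)
     (\<lambda>A. \<integral>\<^sup>+e. emeasure lebesgue (?P e A) \<partial>count_space (edges G))"
  proof (rule countably_additiveI)
    fix A :: "nat \<Rightarrow> 'a tpoint set"
    assume A: "range A \<subseteq> tree_sets G" "disjoint_family A"
    have "(\<Sum>i. \<integral>\<^sup>+e. emeasure lebesgue (?P e (A i)) \<partial>count_space (edges G))
        = (\<integral>\<^sup>+e. (\<Sum>i. emeasure lebesgue (?P e (A i))) \<partial>count_space (edges G))"
      by (rule nn_integral_suminf[symmetric]) simp
    also have "\<dots> = (\<integral>\<^sup>+e. emeasure lebesgue (?P e (\<Union>i. A i)) \<partial>count_space (edges G))"
    proof (rule nn_integral_cong)
      fix e assume "e \<in> space (count_space (edges G))"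
      then have e: "e \<in> edges G" by simp
      have "(\<Sum>i. emeasure lebesgue (?P e (A i))) = emeasure lebesgue (\<Union>i. ?P e (A i))"
      proof (rule suminf_emeasure)
        show "range (\<lambda>i. ?P e (A i)) \<subseteq> sets lebesgue"
          using A(1) e by (auto simp: tree_sets_def)
        show "disjoint_family (\<lambda>i. ?P e (A i))"
          using A(2) by (auto simp: disjoint_family_on_def)
      qed
      also have "(\<Union>i. ?P e (A i)) = ?P e (\<Union>i. A i)" by auto
      finally show "(\<Sum>i. emeasure lebesgue (?P e (A i))) = emeasure lebesgue (?P e (\<Union>i. A i))" .
    qed
    finally show "(\<Sum>i. \<integral>\<^sup>+e. emeasure lebesgue (?P e (A i)) \<partial>count_space (edges G))
      = (\<integral>\<^sup>+e. emeasure lebesgue (?P e (\<Union>(range A))) \<partial>count_space (edges G))" .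
  qed
qed


subsection \<open>Paths, distance and topology\<close>

text \<open>
  \<open>segment_between G x y\<close> is the closed line segment joining two points of a common edge; it is
  empty if no edge contains both.
\<close>

definition segment_between :: "'v graph \<Rightarrow> 'v tpoint \<Rightarrow> 'v tpoint \<Rightarrow> 'v tpoint set" where
  "segment_between G x y = {edge_point G e r | e r s t.
     e \<in> edges G \<and> s \<in> {0..glen G e} \<and> t \<in> {0..glen G e} \<and>
     x = edge_point G e s \<and> y = edge_point G e t \<and> r \<in> closed_segment s t}"

text \<open>
  A polygonal path is given by its successive corner points and must not meet itself: two of its
  segments have at most the common end-point of consecutive ones in common. In a tree, the corner
  points joining \<open>x\<close> to \<open>y\<close> are not unique (segments may be subdivided), but the set of points
  traversed is.
\<close>

definition polygonal_path :: "'v graph \<Rightarrow> 'v tpoint list \<Rightarrow> bool" where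
  "polygonal_path G ps \<longleftrightarrow>
     ps \<noteq> [] \<and> set ps \<subseteq> points G \<and> distinct ps \<and>
     successively (\<lambda>x y. \<exists>e\<in>edges G. x \<in> edge_seg G e \<and> y \<in> edge_seg G e) ps \<and>
     (\<forall>i j. i < j \<and> Suc j < length ps \<longrightarrow>
        segment_between G (ps ! i) (ps ! Suc i) \<inter> segment_between G (ps ! j) (ps ! Suc j)
          \<subseteq> (if j = Suc i then {ps ! j} else {}))"

definition path_points :: "'v graph \<Rightarrow> 'v tpoint list \<Rightarrow> 'v tpoint set" where
  "path_points G ps =
     set ps \<union> (\<Union>i\<in>{i. Suc i < length ps}. segment_between G (ps ! i) (ps ! Suc i))"

definition tree_path :: "'v graph \<Rightarrow> 'v tpoint \<Rightarrow> 'v tpoint \<Rightarrow> 'v tpoint set" where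
  "tree_path G x y =
     (THE S. \<exists>ps. polygonal_path G ps \<and> hd ps = x \<and> last ps = y \<and> S = path_points G ps)"

definition tree_dist :: "'v graph \<Rightarrow> 'v tpoint \<Rightarrow> 'v tpoint \<Rightarrow> real" where
  "tree_dist G x y = measure (tree_measure G) (tree_path G x y)"

definition tree_topology :: "'v graph \<Rightarrow> 'v tpoint topology" where
  "tree_topology G = Metric_space.mtopology (points G) (tree_dist G)"

definition relatively_compact :: "'v graph \<Rightarrow> 'v tpoint set \<Rightarrow> bool" where
  "relatively_compact G K \<longleftrightarrow>
     K \<subseteq> points G \<and> compactin (tree_topology G) (tree_topology G closure_of K)"


section \<open>\<open>L\<^sup>p\<close> spaces, approximation numbers and \<open>l\<^sup>q\<close> norms\<close>

text \<open>Powers of extended nonnegative reals, used for positive exponents only.\<close>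

definition enn_powr :: "ennreal \<Rightarrow> real \<Rightarrow> ennreal" where
  "enn_powr x r = (if x = top then top else ennreal (enn2real x powr r))"

definition conj_exp :: "real \<Rightarrow> real" where
  "conj_exp p = p / (p - 1)"

definition Lp_norm :: "'a measure \<Rightarrow> real \<Rightarrow> ('a \<Rightarrow> real) \<Rightarrow> ennreal" where
  "Lp_norm M p f = enn_powr (\<integral>\<^sup>+x. ennreal (\<bar>f x\<bar> powr p) \<partial>M) (1 / p)"

definition Lp_space :: "'a measure \<Rightarrow> real \<Rightarrow> ('a \<Rightarrow> real) set" where
  "Lp_space M p = {f \<in> borel_measurable M. Lp_norm M p f < top}"

text \<open>
  Operators act on functions, and elements of \<open>L\<^sup>p\<close> are identified when they agree almost everywhere.
  The norm bound (with linearity) makes \<open>F\<close> compatible with this identification.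
\<close>

definition bounded_linear_Lp :: "'a measure \<Rightarrow> real \<Rightarrow> (('a \<Rightarrow> real) \<Rightarrow> 'a \<Rightarrow> real) \<Rightarrow> bool" where
  "bounded_linear_Lp M p F \<longleftrightarrow>
     (\<forall>f\<in>Lp_space M p. F f \<in> Lp_space M p) \<and>
     (\<forall>f\<in>Lp_space M p. \<forall>g\<in>Lp_space M p. AE x in M. F (\<lambda>y. f y + g y) x = F f x + F g x) \<and>
     (\<forall>c. \<forall>f\<in>Lp_space M p. AE x in M. F (\<lambda>y. c * f y) x = c * F f x) \<and>
     (\<exists>C::real. \<forall>f\<in>Lp_space M p. Lp_norm M p (F f) \<le> ennreal C * Lp_norm M p f)"

text \<open>
  The dimension of the range in \<open>L\<^sup>p\<close> (so up to null functions): the least number of functions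
  spanning it, infinite if there is no finite spanning family.
\<close>

definition rank_Lp :: "'a measure \<Rightarrow> real \<Rightarrow> (('a \<Rightarrow> real) \<Rightarrow> 'a \<Rightarrow> real) \<Rightarrow> enat" where
  "rank_Lp M p F = (INF n\<in>{n. \<exists>g. (\<forall>i<n. g i \<in> Lp_space M p) \<and>
     (\<forall>f\<in>Lp_space M p. \<exists>c::nat \<Rightarrow> real. AE x in M. F f x = (\<Sum>i<n. c i * g i x))}. enat n)"

definition op_norm_Lp :: "'a measure \<Rightarrow> real \<Rightarrow> (('a \<Rightarrow> real) \<Rightarrow> 'a \<Rightarrow> real) \<Rightarrow> ennreal" where
  "op_norm_Lp M p T = (SUP f\<in>{f \<in> Lp_space M p. Lp_norm M p f \<le> 1}. Lp_norm M p (T f))"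

text \<open>If \<open>T\<close> is unbounded on \<open>L\<^sup>p\<close>, all its approximation numbers are infinite.\<close>

definition approx_number ::
  "'a measure \<Rightarrow> real \<Rightarrow> (('a \<Rightarrow> real) \<Rightarrow> 'a \<Rightarrow> real) \<Rightarrow> nat \<Rightarrow> ennreal" where
  "approx_number M p T m =
     (INF F\<in>{F. bounded_linear_Lp M p F \<and> rank_Lp M p F < enat m}.
        op_norm_Lp M p (\<lambda>f x. T f x - F f x))"

definition lq_norm :: "real \<Rightarrow> 'i set \<Rightarrow> ('i \<Rightarrow> ennreal) \<Rightarrow> ennreal" where
  "lq_norm q I s = enn_powr (\<Sum>\<^sub>\<infinity>i\<in>I. enn_powr (s i) q) (1 / q)"


section \<open>The Hardy-type operator and the sets \<open>Z\<^sub>k\<close>\<close>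

definition hardy_op ::
  "'v graph \<Rightarrow> ('v tpoint \<Rightarrow> real) \<Rightarrow> ('v tpoint \<Rightarrow> real) \<Rightarrow> 'v tpoint \<Rightarrow>
   ('v tpoint \<Rightarrow> real) \<Rightarrow> 'v tpoint \<Rightarrow> real" where
  "hardy_op G u v a f x = v x * (LINT t:tree_path G a x|tree_measure G. f t * u t)"

definition Lp_loc :: "'v graph \<Rightarrow> real \<Rightarrow> ('v tpoint \<Rightarrow> real) set" where
  "Lp_loc G p = {u \<in> borel_measurable (tree_measure G).
     \<forall>K\<in>sets (tree_measure G). relatively_compact G K \<longrightarrow>
       (\<integral>\<^sup>+t\<in>K. ennreal (\<bar>u t\<bar> powr p) \<partial>tree_measure G) < top}"

definition mu :: "'v graph \<Rightarrow> real \<Rightarrow> ('v tpoint \<Rightarrow> real) \<Rightarrow> 'v tpoint set \<Rightarrow> ennreal" where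
  "mu G p v K = (\<integral>\<^sup>+t\<in>K. ennreal (\<bar>v t\<bar> powr p) \<partial>tree_measure G)"

definition U_fun ::
  "'v graph \<Rightarrow> real \<Rightarrow> ('v tpoint \<Rightarrow> real) \<Rightarrow> 'v tpoint \<Rightarrow> 'v tpoint \<Rightarrow> ennreal" where
  "U_fun G p u a x =
     (\<integral>\<^sup>+t\<in>tree_path G a x. ennreal (\<bar>u t\<bar> powr conj_exp p) \<partial>tree_measure G)"

definition Z_set ::
  "'v graph \<Rightarrow> real \<Rightarrow> ('v tpoint \<Rightarrow> real) \<Rightarrow> 'v tpoint \<Rightarrow> int \<Rightarrow> 'v tpoint set" where
  "Z_set G p u a k = tree_topology G closure_of
     {x \<in> points G. ennreal (2 powr (of_int k * conj_exp p / p)) \<le> U_fun G p u a x \<and>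
                    U_fun G p u a x < ennreal (2 powr (of_int (k + 1) * conj_exp p / p))}"

definition admissible :: "'v graph \<Rightarrow> real \<Rightarrow> ('v tpoint \<Rightarrow> real) \<Rightarrow> int \<Rightarrow> bool" where
  "admissible G p u k \<longleftrightarrow>
     (u \<in> Lp_space (tree_measure G) (conj_exp p) \<longrightarrow>
        ennreal (2 powr of_int k) \<le> enn_powr (Lp_norm (tree_measure G) (conj_exp p) u) p)"

definition Z_components ::
  "'v graph \<Rightarrow> real \<Rightarrow> ('v tpoint \<Rightarrow> real) \<Rightarrow> 'v tpoint \<Rightarrow> int \<Rightarrow> 'v tpoint set set" where
  "Z_components G p u a k =
     connected_components_of (subtopology (tree_topology G) (Z_set G p u a k))"

text \<open>The index set \<open>{1, \<dots>, n}\<close>; it is \<open>{1, 2, \<dots>}\<close> if \<open>n = \<infinity>\<close>.\<close>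

definition upto_enat :: "enat \<Rightarrow> nat set" where
  "upto_enat n = {i. 1 \<le> i \<and> enat i \<le> n}"

text \<open>
  \<open>Z k 1, \<dots>, Z k (n k)\<close> lists the connected components of \<open>Z\<^sub>k\<close> without repetition, for
  every admissible \<open>k\<close>. There are countably many of them, but possibly infinitely many.
\<close>

definition enumerates_components ::
  "'v graph \<Rightarrow> real \<Rightarrow> ('v tpoint \<Rightarrow> real) \<Rightarrow> 'v tpoint \<Rightarrow>
   (int \<Rightarrow> enat) \<Rightarrow> (int \<Rightarrow> nat \<Rightarrow> 'v tpoint set) \<Rightarrow> bool" where
  "enumerates_components G p u a n Z \<longleftrightarrow>
     (\<forall>k. admissible G p u k \<longrightarrow> bij_betw (Z k) (upto_enat (n k)) (Z_components G p u a k))"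

text \<open>The number of boundary points minus one, infinite for an infinite boundary.\<close>

definition boundary_count :: "'v graph \<Rightarrow> 'v tpoint set \<Rightarrow> ereal" where
  "boundary_count G K =
     (let D = tree_topology G frontier_of K in if finite D then ereal (real (card D) - 1) else \<infinity>)"

definition sigma_seq ::
  "'v graph \<Rightarrow> real \<Rightarrow> ('v tpoint \<Rightarrow> real) \<Rightarrow> ('v tpoint \<Rightarrow> real) \<Rightarrow>
   (int \<Rightarrow> enat) \<Rightarrow> (int \<Rightarrow> nat \<Rightarrow> 'v tpoint set) \<Rightarrow> int \<times> nat \<Rightarrow> ennreal" where
  "sigma_seq G p u v n Z = (\<lambda>(k, i).
     if admissible G p u k \<and> i \<in> upto_enat (n k)
     then enn_powr (ennreal (2 powr of_int k) * mu G p v (Z k i)) (1 / p)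
     else 0)"

end

theory Submission
  imports Defs "HOL-Probability.Distribution_Functions"
begin

text \<open>
  Call a component of \<open>Z\<^sub>k\<close> branching if the tree continues beyond its root; the other components
  are null sets.  To a branching component with root \<open>r\<close> we attach a function \<open>f\<close> supported below \<open>r\<close>
  on the levels \<open>k\<close> and \<open>k + 2\<close>: it is \<open>sgn u \<cdot> |u|\<^sup>p\<^sup>'\<^sup>-\<^sup>1\<close> on the paths through level \<open>k\<close> that reach
  the next branching roots, and a negative multiple of it on the paths through level \<open>k + 2\<close>, so that
  \<open>\<integral> f u\<close> is a constant \<open>A\<close> on level \<open>k + 1\<close> below \<open>r\<close> and vanishes beyond level \<open>k + 2\<close>.  By the
  bound on the number of exits only boundedly many paths occur, hence \<open>\<parallel>f\<parallel>\<^sup>p\<close> is comparable to \<open>A\<close> and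
  \<open>\<parallel>T f\<parallel> / \<parallel>f\<parallel>\<close> dominates \<open>\<sigma>\<close> of each child component.  For \<open>k\<close> in a fixed class modulo 3 these
  functions have disjoint supports, and each \<open>T f\<close> vanishes on the level \<open>k + 1\<close> pieces of the others,
  so \<open>a\<^sub>m(T)\<close> is at least the smallest of the quotients of any \<open>m\<close> of them.

  All facts about the tree come from the coordinates \<open>proj e\<close>, the nearest-point projections onto the
  edges: they embed the tree into a product of intervals, paths become coordinate boxes, and the
  distance becomes the \<open>l\<^sup>1\<close> distance.
\<close>

section \<open>Approximation numbers and rearrangements\<close>

text \<open>The profile \<open>sgn u * \<bar>u\<bar> powr (p' - 1)\<close> is extremal in Hoelder's
  inequality: its product with \<open>u\<close> and its \<open>p\<close>-th power are both the
  weight \<open>\<bar>u\<bar> powr p'\<close>. So height and norm of a test function are both read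
  off from values of \<open>U\<close>. A test function sits one level before the components that it
  measures, because on its own level the integral still climbs from 0. It must avoid the side
  branches on which \<open>U\<close> never reaches the next threshold: there may be infinitely many
  of them, and the boundary of a component does not see them. For a similar reason only branching
  roots are counted: a root at which the tree ends can be an interior point of the preceding
  component, so the hypothesis does not bound the number of such roots. The numbers
  \<open>\<sigma>\<close> are never sorted; a bound for every finite family of test functions
  already gives the estimate in the sequence norm.\<close>

lemma enn_powr_ennreal: "0 \<le> x \<Longrightarrow> enn_powr (ennreal x) r = ennreal (x powr r)"
  by (simp add: enn_powr_def)

lemma enn_powr_mono: "0 < r \<Longrightarrow> x \<le> y \<Longrightarrow> enn_powr x r \<le> enn_powr y r"
  by (cases x; cases y) (auto simp: enn_powr_def top_unique intro!: ennreal_leI powr_mono2)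

lemma enn_powr_mult:
  assumes "0 < c"
  shows "enn_powr (ennreal c * x) r = ennreal (c powr r) * enn_powr x r"
proof (cases x)
  case (real y)
  then show ?thesis
    using assms by (simp add: enn_powr_def ennreal_mult[symmetric] powr_mult)
next
  case top
  then show ?thesis using assms by (simp add: enn_powr_def ennreal_mult_top)
qed

lemma enn_powr_less_top: "enn_powr x r < top \<longleftrightarrow> x < top"
  by (auto simp: enn_powr_def less_top)

section \<open>Linear combinations in the Lebesgue space\<close>

lemma Lp_space_iff:
  "f \<in> Lp_space M p \<longleftrightarrow> f \<in> borel_measurable M \<and> (\<integral>\<^sup>+x. ennreal (\<bar>f x\<bar> powr p) \<partial>M) < top"
  by (simp add: Lp_space_def Lp_norm_def enn_powr_less_top)

lemma Lp_space_add:
  assumes p: "0 < p" and f: "f \<in> Lp_space M p" and g: "g \<in> Lp_space M p"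
  shows "(\<lambda>x. f x + g x) \<in> Lp_space M p"
  unfolding Lp_space_iff
proof
  have m: "f \<in> borel_measurable M" "g \<in> borel_measurable M"
    using f g by (auto simp: Lp_space_iff)
  then show "(\<lambda>x. f x + g x) \<in> borel_measurable M" by simp
  have "\<bar>s + t\<bar> powr p \<le> 2 powr p * (\<bar>s\<bar> powr p + \<bar>t\<bar> powr p)" for s t :: real
  proof -
    have "\<bar>s + t\<bar> powr p \<le> (2 * max \<bar>s\<bar> \<bar>t\<bar>) powr p"
      using p by (intro powr_mono2) auto
    also have "\<dots> = 2 powr p * (max \<bar>s\<bar> \<bar>t\<bar>) powr p"
      by (simp add: powr_mult)
    also have "\<dots> \<le> 2 powr p * (\<bar>s\<bar> powr p + \<bar>t\<bar> powr p)"
      by (intro mult_left_mono) (auto simp: max_def)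
    finally show ?thesis .
  qed
  then have "(\<integral>\<^sup>+x. ennreal (\<bar>f x + g x\<bar> powr p) \<partial>M)
      \<le> (\<integral>\<^sup>+x. ennreal (2 powr p) * (ennreal (\<bar>f x\<bar> powr p) + ennreal (\<bar>g x\<bar> powr p)) \<partial>M)"
    by (intro nn_integral_mono) (simp add: ennreal_plus[symmetric] ennreal_mult[symmetric] ennreal_leI del: ennreal_plus)
  also have "\<dots> = ennreal (2 powr p)
      * ((\<integral>\<^sup>+x. ennreal (\<bar>f x\<bar> powr p) \<partial>M) + (\<integral>\<^sup>+x. ennreal (\<bar>g x\<bar> powr p) \<partial>M))"
    using m by (subst nn_integral_cmult) (auto simp: nn_integral_add)
  also have "\<dots> < top"
    using f g by (auto simp: Lp_space_iff ennreal_mult_less_top)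
  finally show "(\<integral>\<^sup>+x. ennreal (\<bar>f x + g x\<bar> powr p) \<partial>M) < top" .
qed

lemma Lp_space_scale:
  assumes f: "f \<in> Lp_space M p"
  shows "(\<lambda>x. c * f x) \<in> Lp_space M p"
  using f unfolding Lp_space_iff
  by (auto simp: abs_mult powr_mult ennreal_mult nn_integral_cmult ennreal_mult_less_top)

lemma Lp_space_zero: "(\<lambda>x. 0) \<in> Lp_space M p"
  by (simp add: Lp_space_iff)

lemma Lp_space_sum:
  assumes "0 < p" "finite J" "\<And>j. j \<in> J \<Longrightarrow> f j \<in> Lp_space M p"
  shows "(\<lambda>x. \<Sum>j\<in>J. c j * f j x) \<in> Lp_space M p"
  using assms(2,3)
proof (induction J)
  case empty
  then show ?case by (simp add: Lp_space_zero)
next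
  case (insert i J)
  then show ?case
    using Lp_space_add[OF assms(1) Lp_space_scale[of "f i" M p "c i"]] by simp
qed

lemma bounded_linear_Lp_sum:
  assumes F: "bounded_linear_Lp M p F" and p: "0 < p" and J: "finite J"
    and f: "\<And>j. j \<in> J \<Longrightarrow> f j \<in> Lp_space M p"
  shows "AE x in M. F (\<lambda>y. \<Sum>j\<in>J. c j * f j y) x = (\<Sum>j\<in>J. c j * F (f j) x)"
  using J f
proof (induction J)
  case empty
  have "\<forall>c. \<forall>f\<in>Lp_space M p. AE x in M. F (\<lambda>y. c * f y) x = c * F f x"
    using F by (simp add: bounded_linear_Lp_def)
  from bspec[OF spec[OF this, of 0] Lp_space_zero] show ?case by simp
next
  case (insert i J)
  have "AE x in M. F (\<lambda>y. c i * f i y + (\<Sum>j\<in>J. c j * f j y)) x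
      = F (\<lambda>y. c i * f i y) x + F (\<lambda>y. \<Sum>j\<in>J. c j * f j y) x"
    using F Lp_space_scale[of "f i" M p "c i"] Lp_space_sum[OF p insert(1), of f M c] insert.prems
    unfolding bounded_linear_Lp_def by simp
  moreover have "AE x in M. F (\<lambda>y. c i * f i y) x = c i * F (f i) x"
    using F insert.prems unfolding bounded_linear_Lp_def by blast
  moreover have "AE x in M. F (\<lambda>y. \<Sum>j\<in>J. c j * f j y) x = (\<Sum>j\<in>J. c j * F (f j) x)"
    using insert by blast
  ultimately show ?case
    by eventually_elim (use insert.hyps in simp)
qed

text \<open>Gaussian elimination, by induction on the number of equations: an unknown that occurs in
  the last equation is eliminated from the others.\<close>

lemma homogeneous_system_solution:
  fixes e :: "'j \<Rightarrow> nat \<Rightarrow> real"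
  assumes "finite J" "n < card J"
  shows "\<exists>c. (\<exists>j\<in>J. c j \<noteq> 0) \<and> (\<forall>i<n. (\<Sum>j\<in>J. c j * e j i) = 0)"
  using assms
proof (induction n arbitrary: J e)
  case 0
  then show ?case by (intro exI[of _ "\<lambda>_. 1"]) (auto simp: card_gt_0_iff)
next
  case (Suc n)
  show ?case
  proof (cases "\<forall>j\<in>J. e j n = 0")
    case True
    obtain c where "\<exists>j\<in>J. c j \<noteq> 0" "\<forall>i<n. (\<Sum>j\<in>J. c j * e j i) = 0"
      using Suc.IH[of J e] Suc.prems by auto
    then show ?thesis using True by (intro exI[of _ c]) (auto simp: less_Suc_eq)
  next
    case False
    then obtain k where k: "k \<in> J" "e k n \<noteq> 0" by blast
    \<comment> \<open>Equation \<open>i\<close> after elimination of the unknown \<open>k\<close>;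
      the value of this unknown is restored in \<open>c'\<close>.\<close>
    define e' where "e' j i = e j i - e j n / e k n * e k i" for j i
    obtain c where c: "\<exists>j\<in>J - {k}. c j \<noteq> 0" "\<And>i. i < n \<Longrightarrow> (\<Sum>j\<in>J - {k}. c j * e' j i) = 0"
    proof -
      have "n < card (J - {k})" using Suc.prems k by (simp add: card_Diff_singleton less_diff_conv)
      then show thesis using Suc.IH[of "J - {k}" e'] Suc.prems that by blast
    qed
    define c' where "c' = c(k := - (\<Sum>j\<in>J - {k}. c j * e j n) / e k n)"
    have "(\<Sum>j\<in>J. c' j * e j i) = (\<Sum>j\<in>J - {k}. c j * e' j i)" for i
    proof -
      have "(\<Sum>j\<in>J. c' j * e j i) = c' k * e k i + (\<Sum>j\<in>J - {k}. c' j * e j i)"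
        using Suc.prems k by (simp add: sum.remove)
      also have "(\<Sum>j\<in>J - {k}. c' j * e j i) = (\<Sum>j\<in>J - {k}. c j * e j i)"
        by (intro sum.cong) (auto simp: c'_def)
      also have "c' k * e k i = - (\<Sum>j\<in>J - {k}. c j * (e j n / e k n * e k i))"
        by (simp add: c'_def sum_distrib_right sum_divide_distrib mult.assoc)
      finally show ?thesis
        by (simp add: e'_def right_diff_distrib sum_subtractf)
    qed
    moreover have "e' j n = 0" for j using k by (simp add: e'_def)
    ultimately have "\<forall>i<Suc n. (\<Sum>j\<in>J. c' j * e j i) = 0"
      using c(2) by (auto simp: less_Suc_eq)
    moreover have "\<exists>j\<in>J. c' j \<noteq> 0" using c(1) by (auto simp: c'_def)
    ultimately show ?thesis by blast
  qed
qed

text \<open>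
  An operator of rank less than \<open>card J\<close> kills a non-trivial combination of the \<open>f j\<close>.
\<close>

lemma approx_number_ge:
  fixes f :: "'j \<Rightarrow> 'a \<Rightarrow> real"
  assumes p: "0 < p" and J: "finite J" and f: "\<And>j. j \<in> J \<Longrightarrow> f j \<in> Lp_space M p"
    and N: "\<And>j. j \<in> J \<Longrightarrow> 0 < N j" and l: "0 \<le> l"
    and up: "\<And>c. (\<integral>\<^sup>+x. ennreal (\<bar>\<Sum>j\<in>J. c j * f j x\<bar> powr p) \<partial>M) \<le> ennreal (\<Sum>j\<in>J. \<bar>c j\<bar> powr p * N j)"
    and low: "\<And>c. ennreal (l powr p * (\<Sum>j\<in>J. \<bar>c j\<bar> powr p * N j))
      \<le> (\<integral>\<^sup>+x. ennreal (\<bar>T (\<lambda>y. \<Sum>j\<in>J. c j * f j y) x\<bar> powr p) \<partial>M)"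
  shows "ennreal l \<le> approx_number M p T (card J)"
  unfolding approx_number_def
proof (rule INF_greatest)
  fix F assume "F \<in> {F. bounded_linear_Lp M p F \<and> rank_Lp M p F < enat (card J)}"
  then have F: "bounded_linear_Lp M p F" and rk: "rank_Lp M p F < enat (card J)" by auto
  obtain n g where n: "n < card J" and span: "\<forall>f\<in>Lp_space M p. \<exists>c::nat \<Rightarrow> real. AE x in M. F f x = (\<Sum>i<n. c i * g i x)"
    using rk unfolding rank_Lp_def INF_less_iff by auto
  have "\<exists>e. \<forall>j\<in>J. AE x in M. F (f j) x = (\<Sum>i<n. e j i * g i x)"
    using span f by (intro bchoice) blast
  then obtain e where e: "\<And>j. j \<in> J \<Longrightarrow> AE x in M. F (f j) x = (\<Sum>i<n. e j i * g i x)" by blast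
  obtain c0 where c0: "\<exists>j\<in>J. c0 j \<noteq> 0" "\<forall>i<n. (\<Sum>j\<in>J. c0 j * e j i) = 0"
    using homogeneous_system_solution[OF J n, of e] by blast
  define S where "S = (\<Sum>j\<in>J. \<bar>c0 j\<bar> powr p * N j)"
  have "0 < S"
  proof -
    obtain j where "j \<in> J" "c0 j \<noteq> 0" using c0 by blast
    then show ?thesis
      unfolding S_def using J N by (intro sum_pos2[of J j]) (auto simp: less_imp_le)
  qed
  \<comment> \<open>With the coefficients scaled so that the weighted sum is 1, \<open>up\<close>
    puts the combination into the unit ball and \<open>low\<close> bounds its image from below by
    \<open>l\<close>.\<close>
  define c where "c j = c0 j / S powr (1 / p)" for j
  have S1: "(\<Sum>j\<in>J. \<bar>c j\<bar> powr p * N j) = 1"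
  proof -
    have "(\<Sum>j\<in>J. \<bar>c j\<bar> powr p * N j) = (\<Sum>j\<in>J. \<bar>c0 j\<bar> powr p * N j / S)"
      using \<open>0 < S\<close> p by (intro sum.cong) (auto simp: c_def powr_divide powr_powr)
    then show ?thesis using \<open>0 < S\<close> by (simp add: sum_divide_distrib[symmetric] S_def[symmetric])
  qed
  define \<phi> where "\<phi> = (\<lambda>y. \<Sum>j\<in>J. c j * f j y)"
  have \<phi>: "\<phi> \<in> Lp_space M p"
    unfolding \<phi>_def by (rule Lp_space_sum[OF p J f])
  have "AE x in M. F \<phi> x = 0"
  proof -
    have "AE x in M. \<forall>j\<in>J. F (f j) x = (\<Sum>i<n. e j i * g i x)"
      using e J by (intro AE_finite_allI) auto
    moreover have "AE x in M. F \<phi> x = (\<Sum>j\<in>J. c j * F (f j) x)"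
      unfolding \<phi>_def by (rule bounded_linear_Lp_sum[OF F p J f])
    ultimately show ?thesis
    proof eventually_elim
      case (elim x)
      have "F \<phi> x = (\<Sum>j\<in>J. \<Sum>i<n. c j * e j i * g i x)"
        using elim by (simp add: sum_distrib_left mult.assoc)
      also have "\<dots> = (\<Sum>i<n. (\<Sum>j\<in>J. c0 j * e j i) * (g i x / S powr (1 / p)))"
        by (subst sum.swap) (simp add: c_def sum_distrib_right sum_divide_distrib)
      also have "\<dots> = 0" using c0(2) by simp
      finally show ?case .
    qed
  qed
  then have "(\<integral>\<^sup>+x. ennreal (\<bar>T \<phi> x\<bar> powr p) \<partial>M) = (\<integral>\<^sup>+x. ennreal (\<bar>T \<phi> x - F \<phi> x\<bar> powr p) \<partial>M)"
    by (intro nn_integral_cong_AE) (auto elim!: eventually_mono)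
  then have "ennreal (l powr p) \<le> (\<integral>\<^sup>+x. ennreal (\<bar>T \<phi> x - F \<phi> x\<bar> powr p) \<partial>M)"
    using low[of c] S1 by (simp add: \<phi>_def)
  then have "enn_powr (ennreal (l powr p)) (1 / p) \<le> Lp_norm M p (\<lambda>x. T \<phi> x - F \<phi> x)"
    unfolding Lp_norm_def using p by (intro enn_powr_mono) auto
  then have "ennreal l \<le> Lp_norm M p (\<lambda>x. T \<phi> x - F \<phi> x)"
    using p l by (simp add: enn_powr_ennreal powr_powr)
  also have "\<dots> \<le> op_norm_Lp M p (\<lambda>f x. T f x - F f x)"
  proof -
    have "Lp_norm M p \<phi> \<le> enn_powr 1 (1 / p)"
      unfolding Lp_norm_def using p up[of c] S1 by (intro enn_powr_mono) (auto simp: \<phi>_def)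
    then have "Lp_norm M p \<phi> \<le> 1"
      using enn_powr_ennreal[of 1 "1 / p"] by simp
    then show ?thesis
      unfolding op_norm_Lp_def using \<phi> by (intro SUP_upper) auto
  qed
  finally show "ennreal l \<le> op_norm_Lp M p (\<lambda>f x. T f x - F f x)" .
qed

text \<open>This replaces sorting: an index with \<open>t j\<close> at most
  \<open>s (card J)\<close> is split off, and the remaining indices are compared with the earlier
  values of \<open>s\<close>.\<close>

lemma sum_le_by_rearrangement:
  fixes t :: "'j \<Rightarrow> ennreal"
  assumes "finite J" "\<And>K. K \<subseteq> J \<Longrightarrow> K \<noteq> {} \<Longrightarrow> \<exists>j\<in>K. t j \<le> s (card K)"
  shows "(\<Sum>j\<in>J. t j) \<le> (\<Sum>m=1..card J. s m)"
  using assms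
proof (induction "card J" arbitrary: J)
  case 0
  then show ?case by simp
next
  case (Suc n)
  then obtain j where j: "j \<in> J" "t j \<le> s (card J)"
    by (metis card.empty nat.distinct(1) subset_refl)
  have card: "card (J - {j}) = n" using Suc j by simp
  have "(\<Sum>j\<in>J - {j}. t j) \<le> (\<Sum>m=1..card (J - {j}). s m)"
    using Suc(1)[of "J - {j}"] Suc.prems card by (metis Diff_subset finite_Diff subset_trans)
  then have "t j + (\<Sum>j\<in>J - {j}. t j) \<le> s (card J) + (\<Sum>m=1..n. s m)"
    using j card by (intro add_mono) auto
  moreover have "(\<Sum>j\<in>J. t j) = t j + (\<Sum>j\<in>J - {j}. t j)"
    using Suc.prems j by (simp add: sum.remove)
  moreover have "(\<Sum>m=1..card J. s m) = s (card J) + (\<Sum>m=1..n. s m)"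
    using Suc(2)[symmetric] by (simp add: add.commute)
  ultimately show ?case by simp
qed

text \<open>Later \<open>g\<close> sends a component to its parent, which up to \<open>b\<close>
  components may share.\<close>

lemma sum_comp_le:
  fixes t :: "'j \<Rightarrow> ennreal"
  assumes "finite F" "\<And>y. y \<in> g ` F \<Longrightarrow> card {x \<in> F. g x = y} \<le> b"
  shows "(\<Sum>x\<in>F. t (g x)) \<le> of_nat b * (\<Sum>y\<in>g ` F. t y)"
proof -
  have "(\<Sum>x\<in>F. t (g x)) = (\<Sum>y\<in>g ` F. \<Sum>x | x \<in> F \<and> g x = y. t (g x))"
    using assms(1) by (rule sum.image_gen)
  also have "\<dots> = (\<Sum>y\<in>g ` F. of_nat (card {x \<in> F. g x = y}) * t y)"
    by (intro sum.cong) auto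
  also have "\<dots> \<le> (\<Sum>y\<in>g ` F. of_nat b * t y)"
    using assms(2) by (intro sum_mono mult_right_mono) auto
  finally show ?thesis by (simp add: sum_distrib_left)
qed

lemma finite_sum_le_infsum_ennreal:
  fixes s :: "'i \<Rightarrow> ennreal"
  assumes "finite F" "F \<subseteq> I"
  shows "sum s F \<le> infsum s I"
  unfolding nonneg_infsum_complete[of I s, OF zero_le]
  using assms by (intro SUP_upper) auto

lemma infsum_le_finite_sums_ennreal:
  fixes s :: "'i \<Rightarrow> ennreal"
  assumes "\<And>F. finite F \<Longrightarrow> F \<subseteq> I \<Longrightarrow> sum s F \<le> B"
  shows "infsum s I \<le> B"
  unfolding nonneg_infsum_complete[of I s, OF zero_le]
  using assms by (intro SUP_least) auto

section \<open>Projections onto edges\<close>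

lemma rtranclp_distinct_path:
  assumes "r\<^sup>*\<^sup>* x y"
  shows "\<exists>vs. vs \<noteq> [] \<and> hd vs = x \<and> last vs = y \<and> distinct vs \<and> successively r vs"
  using assms
proof induction
  case base
  then show ?case by (intro exI[of _ "[x]"]) auto
next
  case (step y z)
  then obtain vs where vs: "vs \<noteq> []" "hd vs = x" "last vs = y" "distinct vs" "successively r vs"
    by auto
  show ?case
  proof (cases "z \<in> set vs")
    case True
    then obtain us ws where "vs = us @ z # ws" by (meson split_list)
    with vs show ?thesis
      by (intro exI[of _ "us @ [z]"])
        (auto simp: successively_append_iff successively_Cons hd_append split: if_splits)
  next
    case False
    with vs step show ?thesis
      by (intro exI[of _ "vs @ [z]"]) (auto simp: successively_append_iff)
  qed
qed

lemma rtranclp_successively: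
  "successively r vs \<Longrightarrow> vs \<noteq> [] \<Longrightarrow> r\<^sup>*\<^sup>* (hd vs) (last vs)"
proof (induction vs)
  case (Cons x vs)
  then show ?case
    by (cases vs) (auto simp: converse_rtranclp_into_rtranclp)
qed simp

locale tree_graph =
  fixes G :: "'v graph"
  assumes tree: "is_tree G"
begin

abbreviation len :: "'v \<times> 'v \<Rightarrow> real" where "len \<equiv> glen G"

lemma edge_verts: "e \<in> edges G \<Longrightarrow> fst e \<in> verts G" "e \<in> edges G \<Longrightarrow> snd e \<in> verts G"
  using tree unfolding is_tree_def by auto

lemma len_pos: "e \<in> edges G \<Longrightarrow> 0 < len e"
  using tree unfolding is_tree_def by auto

lemma edge_ends_neq: "e \<in> edges G \<Longrightarrow> fst e \<noteq> snd e"
  using tree unfolding is_tree_def by (cases e) auto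

lemma edge_antisym: "(x, y) \<in> edges G \<Longrightarrow> (y, x) \<notin> edges G"
  using tree unfolding is_tree_def by blast

lemma finite_adjacent: "x \<in> verts G \<Longrightarrow> finite {y. adjacent G x y}"
  using tree unfolding is_tree_def by blast

lemma no_cycle: "\<not> is_cycle G vs"
  using tree unfolding is_tree_def by blast

lemma verts_connected: "x \<in> verts G \<Longrightarrow> y \<in> verts G \<Longrightarrow> (adjacent G)\<^sup>*\<^sup>* x y"
  using tree unfolding is_tree_def by blast

definition adj_without :: "'v \<times> 'v \<Rightarrow> 'v \<Rightarrow> 'v \<Rightarrow> bool" where
  "adj_without e x y \<longleftrightarrow> (x, y) \<in> edges G - {e} \<or> (y, x) \<in> edges G - {e}"

text \<open>Deleting \<open>e\<close> separates a tree into two parts; this is the part that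
  contains \<open>snd e\<close>.\<close>

definition far :: "'v \<times> 'v \<Rightarrow> 'v set" where
  "far e = {w. (adj_without e)\<^sup>*\<^sup>* (snd e) w}"

text \<open>
  The coordinate on \<open>e\<close> of the point of \<open>e\<close> nearest to the given point.
\<close>

primrec proj :: "'v \<times> 'v \<Rightarrow> 'v tpoint \<Rightarrow> real" where
  "proj e (Vertex w) = (if w \<in> far e then len e else 0)"
| "proj e (Interior g t) = (if g = e then t else if fst g \<in> far e then len e else 0)"

text \<open>For \<open>g \<noteq> e\<close> the whole edge \<open>g\<close> projects to one and the
  same end of \<open>e\<close>, so the image of \<open>fst g\<close> represents it.\<close>

abbreviation foot :: "'v \<times> 'v \<Rightarrow> 'v \<times> 'v \<Rightarrow> real" where
  "foot e g \<equiv> proj e (Vertex (fst g))"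

lemma snd_far: "snd e \<in> far e"
  by (simp add: far_def)

lemma far_step: "w \<in> far e \<Longrightarrow> adj_without e w w' \<Longrightarrow> w' \<in> far e"
  unfolding far_def by (auto intro: rtranclp.rtrancl_into_rtrancl)

lemma adj_without_sym: "adj_without e x y \<Longrightarrow> adj_without e y x"
  by (auto simp: adj_without_def)

lemma far_cong: "adj_without e w w' \<Longrightarrow> w \<in> far e \<longleftrightarrow> w' \<in> far e"
  using far_step adj_without_sym by blast

text \<open>A simple walk from \<open>snd e\<close> back to \<open>fst e\<close> that avoids
  \<open>e\<close> would close up with \<open>e\<close> to a cycle. A walk of only two vertices
  would be a second edge between the ends, which the ban on double edges excludes.\<close>

lemma fst_not_far:
  assumes e: "e \<in> edges G"
  shows "fst e \<notin> far e"
proof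
  assume "fst e \<in> far e"
  then obtain vs where vs: "vs \<noteq> []" "hd vs = snd e" "last vs = fst e" "distinct vs"
      "successively (adj_without e) vs"
    using rtranclp_distinct_path[of "adj_without e" "snd e" "fst e"] by (auto simp: far_def)
  have "successively (adjacent G) vs"
    using vs(5) by (rule successively_mono) (auto simp: adj_without_def adjacent_def)
  moreover have "adjacent G (last vs) (hd vs)"
    using vs e by (cases e) (auto simp: adjacent_def)
  moreover have "3 \<le> length vs"
  proof (rule ccontr)
    assume "\<not> 3 \<le> length vs"
    then consider "length vs = 0" | "length vs = 1" | "length vs = 2" by linarith
    then show False
    proof cases
      case 3
      then obtain x y where "vs = [x, y]"
        by (auto simp: numeral_2_eq_2 length_Suc_conv)
      with vs have "adj_without e (snd e) (fst e)" by auto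
      then show False
        using e edge_antisym[of "fst e" "snd e"] by (auto simp: adj_without_def)
    qed (use vs edge_ends_neq[OF e] in \<open>auto simp: length_Suc_conv\<close>)
  qed
  ultimately have "is_cycle G vs"
    using vs by (simp add: is_cycle_def)
  then show False using no_cycle by blast
qed

lemma edge_adj_without: "g \<in> edges G \<Longrightarrow> g \<noteq> e \<Longrightarrow> adj_without e (fst g) (snd g)"
  by (cases g) (auto simp: adj_without_def)

lemma proj_edge_point_same:
  assumes "e \<in> edges G"
  shows "proj e (edge_point G e t) = t"
  using assms fst_not_far[OF assms] snd_far[of e] len_pos[OF assms] by (auto simp: edge_point_def)

lemma proj_edge_point_other:
  assumes "g \<in> edges G" "g \<noteq> e"
  shows "proj e (edge_point G g t) = foot e g"
  using far_cong[OF edge_adj_without[OF assms]] assms by (auto simp: edge_point_def)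

lemma foot_cases: "foot e g = 0 \<or> foot e g = len e"
  by auto

lemma edge_point_inj:
  assumes "e \<in> edges G" "edge_point G e s = edge_point G e t"
  shows "s = t"
  using arg_cong[OF assms(2), of "proj e"] by (simp add: proj_edge_point_same[OF assms(1)])

lemma points_cases:
  assumes "x \<in> points G"
  obtains (Vertex) w where "w \<in> verts G" "x = Vertex w"
  | (Interior) e t where "e \<in> edges G" "0 < t" "t < len e" "x = Interior e t" "x = edge_point G e t"
proof -
  from assms consider w where "w \<in> verts G" "x = Vertex w"
    | e t where "e \<in> edges G" "t \<in> {0..len e}" "x = edge_point G e t"
    unfolding points_def edge_seg_def by auto
  then show thesis
  proof cases
    case 2
    then show thesis
      using that edge_verts[OF 2(1)] 2
      by (cases "t = 0"; cases "t = len e") (auto simp: edge_point_def)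
  qed (use that in auto)
qed

lemma edge_point_in_points: "e \<in> edges G \<Longrightarrow> 0 \<le> t \<Longrightarrow> t \<le> len e \<Longrightarrow> edge_point G e t \<in> points G"
  by (force simp: points_def edge_seg_def)

lemma edge_seg_points: "e \<in> edges G \<Longrightarrow> edge_seg G e \<subseteq> points G"
  by (auto simp: points_def)

lemma ends_edge_point:
  assumes "e \<in> edges G"
  shows "Vertex (fst e) = edge_point G e 0" "Vertex (snd e) = edge_point G e (len e)"
  using len_pos[OF assms] by (auto simp: edge_point_def)

lemma proj_range:
  assumes "e \<in> edges G" "x \<in> points G"
  shows "0 \<le> proj e x \<and> proj e x \<le> len e"
  using assms(2) by (rule points_cases) (use len_pos[OF assms(1)] in auto)

lemma proj_in_edge:
  assumes "e \<in> edges G" "x \<in> edge_seg G e"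
  shows "x = edge_point G e (proj e x)"
  using assms by (auto simp: edge_seg_def proj_edge_point_same)

lemma interior_proj:
  assumes "e \<in> edges G" "x \<in> points G" "0 < proj e x" "proj e x < len e"
  shows "x = edge_point G e (proj e x)"
  using assms(2) by (rule points_cases) (use assms in \<open>auto split: if_splits simp: edge_point_def\<close>)

text \<open>
  Seen in the coordinates of two edges, the tree lies in the union of two perpendicular segments.
\<close>

lemma foot_or_foot:
  assumes e: "e \<in> edges G" and g: "g \<in> edges G" and "e \<noteq> g" and x: "x \<in> points G"
  shows "proj e x = foot e g \<or> proj g x = foot g e"
proof -
  have ends: "proj e (Vertex (snd g)) = foot e g" "proj g (Vertex (snd e)) = foot g e"
    using proj_edge_point_other[OF g, of e "len g"] proj_edge_point_other[OF e, of g "len e"]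
      ends_edge_point e g \<open>e \<noteq> g\<close> by auto
  have V: "proj e (Vertex w) = foot e g \<or> proj g (Vertex w) = foot g e" if "w \<in> verts G" for w
    using verts_connected[OF edge_verts(1)[OF e] that]
  proof induction
    case base
    then show ?case by blast
  next
    case (step w w')
    then obtain d where d: "d \<in> edges G" "d = (w, w') \<or> d = (w', w)"
      by (auto simp: adjacent_def)
    show ?case
    proof (cases "d = e \<or> d = g")
      case True
      then have "w' \<in> {fst e, snd e, fst g, snd g}"
        using d by auto
      then show ?thesis
        using ends by auto
    next
      case False
      then have "adj_without e w w'" "adj_without g w w'"
        using d step.hyps(2) by (auto simp: adjacent_def adj_without_def)
      then show ?thesis
        using step.IH far_cong[of e w w'] far_cong[of g w w'] by simp
    qed
  qed
  show ?thesis
    using x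
  proof (cases rule: points_cases)
    case (Vertex w)
    then show ?thesis using V by blast
  next
    case (Interior d t)
    then show ?thesis
      using V[OF edge_verts(1)[OF \<open>d \<in> edges G\<close>]] \<open>e \<noteq> g\<close> by (cases "d = e"; cases "d = g") auto
  qed
qed

text \<open>Distinct vertices are separated by the first edge of a simple path between them: the
  rest of the path never returns to its start, hence avoids that edge and stays on its other side. A
  point inside an edge is recovered from its coordinate there.\<close>

lemma proj_inject:
  assumes x: "x \<in> points G" and y: "y \<in> points G"
    and eq: "\<And>e. e \<in> edges G \<Longrightarrow> proj e x = proj e y"
  shows "x = y"
proof -
  have I: "x = y" if "x = edge_point G e t" "e \<in> edges G" "0 < t" "t < len e"
    "y \<in> points G" "\<And>e. e \<in> edges G \<Longrightarrow> proj e x = proj e y" for x y e t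
    using interior_proj[OF that(2) that(5)] that proj_edge_point_same[OF that(2), of t] by metis
  have V: False if w: "w \<in> verts G" "w' \<in> verts G" "w \<noteq> w'"
    and eq': "\<And>e. e \<in> edges G \<Longrightarrow> proj e (Vertex w) = proj e (Vertex w')" for w w'
  proof -
    obtain vs where vs: "vs \<noteq> []" "hd vs = w" "last vs = w'" "distinct vs" "successively (adjacent G) vs"
      using rtranclp_distinct_path[OF verts_connected[OF w(1,2)]] by auto
    from vs \<open>w \<noteq> w'\<close> obtain y ys where ys: "vs = w # y # ys"
      by (metis last_ConsL list.collapse)
    obtain d where d: "d \<in> edges G" "d = (w, y) \<or> d = (y, w)"
      using vs ys by (auto simp: adjacent_def)
    have "successively (adj_without d) (y # ys)"
    proof (rule successively_mono)
      show "successively (adjacent G) (y # ys)"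
        using vs(5) ys by simp
      fix c c'
      assume "c \<in> set (y # ys)" "c' \<in> set (y # ys)" and cc: "adjacent G c c'"
      then have "c \<noteq> w" "c' \<noteq> w"
        using vs(4) ys by auto
      then show "adj_without d c c'"
        using cc d(2) by (auto simp: adj_without_def adjacent_def)
    qed
    then have "(adj_without d)\<^sup>*\<^sup>* y w'"
      using rtranclp_successively[of "adj_without d" "y # ys"] vs ys by simp
    then have "y \<in> far d \<longleftrightarrow> w' \<in> far d"
      by induction (use far_cong in auto)
    then have "w \<in> far d \<longleftrightarrow> y \<in> far d"
      using eq'[OF d(1)] len_pos[OF d(1)] by (auto split: if_splits)
    then show False
      using d fst_not_far[OF d(1)] snd_far[of d] by auto
  qed
  show ?thesis
    using x
  proof (cases rule: points_cases)
    case Interior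
    then show ?thesis using I eq y by blast
  next
    case (Vertex w)
    note xw = this
    from y show ?thesis
    proof (cases rule: points_cases)
      case Interior
      then show ?thesis using I[of y _ _ x] eq x by metis
    next
      case (Vertex w')
      then show ?thesis using xw V[of w w'] eq by auto
    qed
  qed
qed

end

section \<open>Arcs as boxes\<close>

lemma in_closed_segment_real:
  "(x::real) \<in> closed_segment a b \<longleftrightarrow> a \<le> x \<and> x \<le> b \<or> b \<le> x \<and> x \<le> a"
  by (auto simp: closed_segment_eq_real_ivl)

lemma successively_take: "successively R xs \<Longrightarrow> successively R (take n xs)"
  using successively_append_iff[of R "take n xs" "drop n xs"] by simp

lemma successively_drop: "successively R xs \<Longrightarrow> successively R (drop n xs)"
  using successively_append_iff[of R "take n xs" "drop n xs"] by simp

context tree_graph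
begin

definition arc :: "'v tpoint \<Rightarrow> 'v tpoint \<Rightarrow> 'v tpoint set" where
  "arc x y = {z \<in> points G. \<forall>e\<in>edges G. proj e z \<in> closed_segment (proj e x) (proj e y)}"

definition near :: "'v tpoint \<Rightarrow> 'v tpoint \<Rightarrow> bool" where
  "near x y \<longleftrightarrow> (\<exists>e\<in>edges G. x \<in> edge_seg G e \<and> y \<in> edge_seg G e)"

definition diff_edges :: "'v tpoint \<Rightarrow> 'v tpoint \<Rightarrow> ('v \<times> 'v) set" where
  "diff_edges x y = {e \<in> edges G. proj e x \<noteq> proj e y}"

definition gdist :: "'v tpoint \<Rightarrow> 'v tpoint \<Rightarrow> real" where
  "gdist x y = (\<Sum>e\<in>diff_edges x y. \<bar>proj e x - proj e y\<bar>)"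

lemma proj_eq_in_edge:
  assumes "e \<in> edges G" "x \<in> edge_seg G e" "y \<in> edge_seg G e" "g \<noteq> e"
  shows "proj g x = proj g y"
  using assms by (auto simp: edge_seg_def proj_edge_point_other)

text \<open>Two points of an edge agree in every other coordinate, so points that share two edges
  agree in all coordinates.\<close>

lemma common_edge_unique:
  assumes "e \<in> edges G" "x \<in> edge_seg G e" "y \<in> edge_seg G e"
    and "g \<in> edges G" "x \<in> edge_seg G g" "y \<in> edge_seg G g" and "x \<noteq> y"
  shows "e = g"
proof (rule ccontr)
  assume "e \<noteq> g"
  have "x = y"
  proof (rule proj_inject)
    fix d assume "d \<in> edges G"
    show "proj d x = proj d y"
      using \<open>e \<noteq> g\<close> assms proj_eq_in_edge[of e x y d] proj_eq_in_edge[of g x y d] by blast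
  qed (use assms edge_seg_points in blast)+
  then show False using \<open>x \<noteq> y\<close> by simp
qed

lemma near_sym: "near x y \<Longrightarrow> near y x"
  by (auto simp: near_def)

lemma ends_in_edge_seg:
  assumes "e \<in> edges G"
  shows "Vertex (fst e) \<in> edge_seg G e" "Vertex (snd e) \<in> edge_seg G e"
  using len_pos[OF assms] ends_edge_point[OF assms] by (auto simp: edge_seg_def)

lemma near_rtranclp_sym: "near\<^sup>*\<^sup>* x y \<Longrightarrow> near\<^sup>*\<^sup>* y x"
  by (metis near_sym sympI sympD symp_rtranclp)

lemma points_connected:
  assumes "x \<in> points G" "y \<in> points G"
  shows "near\<^sup>*\<^sup>* x y"
proof -
  have V: "near\<^sup>*\<^sup>* (Vertex w) (Vertex w')" if "w \<in> verts G" "w' \<in> verts G" for w w'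
    using verts_connected[OF that]
  proof induction
    case (step w' w'')
    have "near (Vertex w') (Vertex w'')"
      using step(2) ends_in_edge_seg unfolding near_def adjacent_def by fastforce
    with step show ?case by simp
  qed simp
  have "\<exists>w\<in>verts G. near\<^sup>*\<^sup>* z (Vertex w)" if "z \<in> points G" for z
    using that
  proof (cases rule: points_cases)
    case (Interior e t)
    then have "near z (Vertex (fst e))"
      using ends_in_edge_seg(1)[of e] by (force simp: near_def edge_seg_def)
    then show ?thesis using edge_verts(1)[OF Interior(1)] by blast
  qed auto
  then show ?thesis
    using assms V near_rtranclp_sym by (meson rtranclp_trans)
qed

text \<open>Neighbouring points of a chain differ in a single coordinate. So distances are finite
  sums even in an infinite tree.\<close>

lemma finite_diff_edges:
  assumes "x \<in> points G" "y \<in> points G"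
  shows "finite (diff_edges x y)"
  using points_connected[OF assms]
proof induction
  case base
  then show ?case by (simp add: diff_edges_def)
next
  case (step y z)
  then obtain e where e: "e \<in> edges G" "y \<in> edge_seg G e" "z \<in> edge_seg G e"
    by (auto simp: near_def)
  have "diff_edges x z \<subseteq> insert e (diff_edges x y)"
    using proj_eq_in_edge[OF e] by (auto simp: diff_edges_def)
  then show ?case using step finite_subset by blast
qed

lemma arc_points: "arc x y \<subseteq> points G"
  by (auto simp: arc_def)

lemma arc_commute: "arc x y = arc y x"
  by (simp add: arc_def closed_segment_commute)

lemma arc_ends: "x \<in> points G \<Longrightarrow> x \<in> arc x y" "y \<in> points G \<Longrightarrow> y \<in> arc x y"
  by (auto simp: arc_def)

lemma arc_self: "x \<in> points G \<Longrightarrow> arc x x = {x}"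
  using proj_inject[of _ x] by (auto simp: arc_def)

lemma arc_subset: "z \<in> arc x y \<Longrightarrow> arc x z \<subseteq> arc x y"
  unfolding arc_def in_closed_segment_real by (auto; meson order_trans)

lemma arc_subset': "z \<in> arc x y \<Longrightarrow> arc z y \<subseteq> arc x y"
  using arc_subset[of z y x] by (simp add: arc_commute)

lemma arc_between:
  assumes "z \<in> arc x y" "w \<in> arc z y"
  shows "z \<in> arc x w"
  using assms unfolding arc_def in_closed_segment_real by fastforce

text \<open>In the direction from \<open>x\<close> to \<open>y\<close>, a point \<open>w\<close>
  outside both parts is ahead of \<open>z\<close> along some edge \<open>e\<close> and behind it
  along another edge \<open>g\<close>. In these two coordinates all points lie on a cross of two
  perpendicular lines, with \<open>z\<close> and \<open>w\<close> on different ones. Then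
  \<open>x\<close>, which precedes both, or \<open>y\<close>, which follows both, is off the
  cross.\<close>

lemma arc_Un:
  assumes x: "x \<in> points G" and y: "y \<in> points G" and z: "z \<in> arc x y"
  shows "arc x y = arc x z \<union> arc z y"
proof
  show "arc x z \<union> arc z y \<subseteq> arc x y"
    using arc_subset arc_subset' z by blast
  show "arc x y \<subseteq> arc x z \<union> arc z y"
  proof (rule ccontr)
    assume "\<not> ?thesis"
    then obtain w where w: "w \<in> arc x y" "w \<notin> arc x z" "w \<notin> arc z y" by blast
    have zp: "z \<in> points G" and wp: "w \<in> points G"
      using z w(1) arc_points by auto
    obtain e where e: "e \<in> edges G" "proj e w \<notin> closed_segment (proj e x) (proj e z)"
      using w(2) wp by (auto simp: arc_def)
    obtain g where g: "g \<in> edges G" "proj g w \<notin> closed_segment (proj g z) (proj g y)"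
      using w(3) wp by (auto simp: arc_def)
    have b: "proj d z \<in> closed_segment (proj d x) (proj d y)"
      "proj d w \<in> closed_segment (proj d x) (proj d y)" if "d \<in> edges G" for d
      using that z w(1) by (auto simp: arc_def)
    have "e \<noteq> g"
      using e g b[of e] unfolding in_closed_segment_real by auto
    note L = foot_or_foot[OF e(1) g(1) this]
    have r: "0 \<le> proj d p \<and> proj d p \<le> len d" if "d \<in> edges G" "p \<in> points G" for d p
      using proj_range that by blast
    show False
      using L[OF x] L[OF y] L[OF zp] L[OF wp] e(2) g(2) b[OF e(1)] b[OF g(1)]
        r[OF e(1) x] r[OF e(1) y] r[OF e(1) zp] r[OF e(1) wp]
        r[OF g(1) x] r[OF g(1) y] r[OF g(1) zp] r[OF g(1) wp]
        foot_cases[of e g] foot_cases[of g e]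
      unfolding in_closed_segment_real by (smt (verit))
  qed
qed

lemma edge_arc:
  assumes e: "e \<in> edges G" and s: "s \<in> {0..len e}" and t: "t \<in> {0..len e}"
  shows "arc (edge_point G e s) (edge_point G e t) = edge_point G e ` closed_segment s t"
proof (intro equalityI subsetI)
  fix z assume z: "z \<in> arc (edge_point G e s) (edge_point G e t)"
  then have zp: "z \<in> points G" and ze: "proj e z \<in> closed_segment s t"
    using e by (auto simp: arc_def proj_edge_point_same)
  have rng: "proj e z \<in> {0..len e}" using proj_range[OF e zp] by simp
  have "z = edge_point G e (proj e z)"
  proof (rule proj_inject)
    fix g assume g: "g \<in> edges G"
    show "proj g z = proj g (edge_point G e (proj e z))"
    proof (cases "g = e")
      case True
      then show ?thesis using e by (simp add: proj_edge_point_same)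
    next
      case False
      then show ?thesis
        using z g e proj_edge_point_other[of e g] by (auto simp: arc_def)
    qed
  qed (use zp edge_point_in_points[OF e] rng in auto)
  then show "z \<in> edge_point G e ` closed_segment s t" using ze by blast
next
  fix z assume "z \<in> edge_point G e ` closed_segment s t"
  then obtain r where r: "z = edge_point G e r" "r \<in> closed_segment s t" by blast
  then have r': "0 \<le> r" "r \<le> len e"
    using s t by (auto simp: in_closed_segment_real)
  show "z \<in> arc (edge_point G e s) (edge_point G e t)"
    unfolding arc_def
  proof (intro CollectI conjI ballI)
    show "z \<in> points G" using edge_point_in_points[OF e r'] r by simp
    fix g assume "g \<in> edges G"
    then show "proj g z \<in> closed_segment (proj g (edge_point G e s)) (proj g (edge_point G e t))"
      using e r proj_edge_point_same[of e] proj_edge_point_other[of e g] by (cases "g = e") auto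
  qed
qed

lemma segment_between_eq_arc:
  assumes e: "e \<in> edges G" and x: "x \<in> edge_seg G e" and y: "y \<in> edge_seg G e" and "x \<noteq> y"
  shows "segment_between G x y = arc x y"
proof -
  obtain s t where st: "s \<in> {0..len e}" "t \<in> {0..len e}" "x = edge_point G e s" "y = edge_point G e t"
    using x y by (auto simp: edge_seg_def)
  have "segment_between G x y = edge_point G e ` closed_segment s t"
  proof (intro equalityI subsetI)
    fix z assume "z \<in> segment_between G x y"
    then obtain g r s' t' where g: "z = edge_point G g r" "g \<in> edges G" "s' \<in> {0..len g}"
      "t' \<in> {0..len g}" "x = edge_point G g s'" "y = edge_point G g t'" "r \<in> closed_segment s' t'"
      unfolding segment_between_def by blast
    then have "x \<in> edge_seg G g" "y \<in> edge_seg G g" by (auto simp: edge_seg_def)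
    then have "g = e" using common_edge_unique[OF e x y g(2)] \<open>x \<noteq> y\<close> by simp
    then have "s' = s" "t' = t" using edge_point_inj[OF e] st g by metis+
    then show "z \<in> edge_point G e ` closed_segment s t" using g \<open>g = e\<close> by blast
  next
    fix z assume "z \<in> edge_point G e ` closed_segment s t"
    then obtain r where "z = edge_point G e r" "r \<in> closed_segment s t" by blast
    then show "z \<in> segment_between G x y"
      using st e unfolding segment_between_def by blast
  qed
  then show ?thesis using edge_arc[OF e st(1,2)] st by simp
qed

text \<open>
  If \<open>y\<close> were not between \<open>x\<close> and \<open>l\<close>, the two arcs would overlap on a piece of the common edge of
  \<open>x\<close> and \<open>y\<close>.
\<close>

lemma arc_extend:
  assumes e: "e \<in> edges G" and x: "x \<in> edge_seg G e" and y: "y \<in> edge_seg G e"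
    and l: "l \<in> points G" and disj: "arc x y \<inter> arc y l \<subseteq> {y}"
  shows "y \<in> arc x l"
proof -
  obtain s t where st: "s \<in> {0..len e}" "t \<in> {0..len e}" "x = edge_point G e s" "y = edge_point G e t"
    using x y by (auto simp: edge_seg_def)
  define w where "w = proj e l"
  have w: "0 \<le> w" "w \<le> len e" using proj_range[OF e l] by (auto simp: w_def)
  \<comment> \<open>The point nearest to \<open>w\<close> on the segment from \<open>s\<close> to
    \<open>t\<close>. If \<open>t\<close> is not between \<open>s\<close> and \<open>w\<close>, it
    differs from \<open>t\<close> and gives a second common point of the two arcs.\<close>
  define r where "r = (if s < t then max s w else min s w)"
  have "t \<in> closed_segment s w"
  proof (rule ccontr)
    assume n: "t \<notin> closed_segment s w"
    then have r: "r \<in> closed_segment s t" "r \<in> closed_segment t w" "r \<noteq> t" "r \<in> {0..len e}"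
      using st w by (auto simp: in_closed_segment_real r_def)
    have "edge_point G e r \<in> arc x y"
      using edge_arc[OF e st(1,2)] st r by simp
    moreover have "edge_point G e r \<in> arc y l"
      unfolding arc_def
    proof (intro CollectI conjI ballI)
      show "edge_point G e r \<in> points G" using r edge_point_in_points[OF e] by simp
      fix g assume "g \<in> edges G"
      show "proj g (edge_point G e r) \<in> closed_segment (proj g y) (proj g l)"
      proof (cases "g = e")
        case True
        then show ?thesis using r st e by (simp add: proj_edge_point_same w_def[symmetric])
      next
        case False
        then show ?thesis using st e by (simp add: proj_edge_point_other)
      qed
    qed
    ultimately have "edge_point G e r = y" using disj by blast
    then show False using edge_point_inj[OF e] st r by metis
  qed
  show ?thesis
    unfolding arc_def
  proof (intro CollectI conjI ballI)
    show "y \<in> points G" using y edge_seg_points[OF e] by blast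
    fix g assume "g \<in> edges G"
    show "proj g y \<in> closed_segment (proj g x) (proj g l)"
    proof (cases "g = e")
      case True
      then show ?thesis
        using \<open>t \<in> closed_segment s w\<close> st e by (simp add: proj_edge_point_same w_def)
    next
      case False
      then show ?thesis using st e by (simp add: proj_edge_point_other)
    qed
  qed
qed

section \<open>The sum metric in the projection coordinates\<close>

lemma gdist_eq_sum:
  assumes "finite F" "diff_edges x y \<subseteq> F" "F \<subseteq> edges G"
  shows "gdist x y = (\<Sum>e\<in>F. \<bar>proj e x - proj e y\<bar>)"
  unfolding gdist_def using assms
  by (intro sum.mono_neutral_left) (auto simp: diff_edges_def)

lemma gdist_nonneg: "0 \<le> gdist x y"
  by (simp add: gdist_def sum_nonneg)

lemma gdist_commute: "gdist x y = gdist y x"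
  unfolding gdist_def by (rule sum.cong) (auto simp: diff_edges_def)

lemma proj_le_gdist:
  assumes "x \<in> points G" "y \<in> points G" "e \<in> edges G"
  shows "\<bar>proj e x - proj e y\<bar> \<le> gdist x y"
proof -
  have fin: "finite (insert e (diff_edges x y))" using finite_diff_edges[OF assms(1,2)] by simp
  have "gdist x y = (\<Sum>e\<in>insert e (diff_edges x y). \<bar>proj e x - proj e y\<bar>)"
    using fin assms by (intro gdist_eq_sum) (auto simp: diff_edges_def)
  moreover have "\<bar>proj e x - proj e y\<bar> \<le> \<dots>"
    using member_le_sum[of e "insert e (diff_edges x y)" "\<lambda>e. \<bar>proj e x - proj e y\<bar>"] fin by auto
  ultimately show ?thesis by simp
qed

lemma gdist_zero:
  assumes "x \<in> points G" "y \<in> points G"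
  shows "gdist x y = 0 \<longleftrightarrow> x = y"
proof
  assume "gdist x y = 0"
  then show "x = y"
    using proj_le_gdist[OF assms] by (intro proj_inject[OF assms]) force
qed (simp add: gdist_def)

text \<open>With one finite set of coordinates for all three distances, the triangle inequality and
  additivity along arcs reduce to single coordinates.\<close>

lemma gdist_common:
  assumes "x \<in> points G" "y \<in> points G" "z \<in> points G"
  obtains F where "gdist x y = (\<Sum>e\<in>F. \<bar>proj e x - proj e y\<bar>)"
    "gdist y z = (\<Sum>e\<in>F. \<bar>proj e y - proj e z\<bar>)" "gdist x z = (\<Sum>e\<in>F. \<bar>proj e x - proj e z\<bar>)"
    "F \<subseteq> edges G"
proof -
  let ?F = "diff_edges x y \<union> diff_edges y z \<union> diff_edges x z"
  have "finite ?F" "?F \<subseteq> edges G"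
    using finite_diff_edges assms by (auto simp: diff_edges_def)
  then show thesis
    by (intro that[of ?F] gdist_eq_sum) auto
qed

lemma gdist_triangle:
  assumes "x \<in> points G" "y \<in> points G" "z \<in> points G"
  shows "gdist x z \<le> gdist x y + gdist y z"
proof -
  obtain F where F: "gdist x y = (\<Sum>e\<in>F. \<bar>proj e x - proj e y\<bar>)"
    "gdist y z = (\<Sum>e\<in>F. \<bar>proj e y - proj e z\<bar>)" "gdist x z = (\<Sum>e\<in>F. \<bar>proj e x - proj e z\<bar>)"
    using gdist_common[OF assms] by blast
  show ?thesis unfolding F sum.distrib[symmetric] by (rule sum_mono) auto
qed

lemma gdist_add:
  assumes "x \<in> points G" "z \<in> points G" "y \<in> arc x z"
  shows "gdist x z = gdist x y + gdist y z"
proof -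
  have "y \<in> points G" using assms arc_points by blast
  then obtain F where F: "gdist x y = (\<Sum>e\<in>F. \<bar>proj e x - proj e y\<bar>)"
    "gdist y z = (\<Sum>e\<in>F. \<bar>proj e y - proj e z\<bar>)" "gdist x z = (\<Sum>e\<in>F. \<bar>proj e x - proj e z\<bar>)"
    "F \<subseteq> edges G"
    using gdist_common[of x y z] assms by blast
  have "\<bar>proj e x - proj e z\<bar> = \<bar>proj e x - proj e y\<bar> + \<bar>proj e y - proj e z\<bar>" if "e \<in> F" for e
  proof -
    have "proj e y \<in> closed_segment (proj e x) (proj e z)"
      using that F(4) assms(3) by (auto simp: arc_def)
    then show ?thesis by (auto simp: in_closed_segment_real)
  qed
  then show ?thesis unfolding F sum.distrib[symmetric] by (rule sum.cong[OF refl])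
qed

end

section \<open>Polygonal paths\<close>

lemma is_interval_imp_lebesgue: "is_interval (A::real set) \<Longrightarrow> A \<in> sets lebesgue"
  using real_interval_borel_measurable[of A] by simp

context tree_graph
begin

lemma segment_between_ends:
  assumes "near x y"
  shows "x \<in> segment_between G x y" "y \<in> segment_between G x y"
  using assms unfolding near_def edge_seg_def segment_between_def by auto blast+

lemma segment_between_near:
  assumes "near x y" "z \<in> segment_between G x y"
  shows "\<exists>e\<in>edges G. x \<in> edge_seg G e \<and> z \<in> edge_seg G e \<and> y \<in> edge_seg G e"
proof -
  obtain e r s t where e: "z = edge_point G e r" "e \<in> edges G" "s \<in> {0..len e}"
      "t \<in> {0..len e}" "x = edge_point G e s" "y = edge_point G e t" "r \<in> closed_segment s t"
    using assms(2) unfolding segment_between_def by blast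
  then have "r \<in> {0..len e}" by (auto simp: in_closed_segment_real)
  then show ?thesis using e unfolding edge_seg_def by blast
qed

lemma polygonal_path_near:
  "polygonal_path G ps \<Longrightarrow> successively near ps"
  unfolding polygonal_path_def near_def by blast

lemma path_points_Cons2:
  "path_points G (x # y # ps) = {x} \<union> segment_between G x y \<union> path_points G (y # ps)"
proof -
  have "{i. Suc i < length (x # y # ps)} = insert 0 (Suc ` {i. Suc i < length (y # ps)})"
  proof (intro set_eqI iffI)
    fix i assume "i \<in> {i. Suc i < length (x # y # ps)}"
    then show "i \<in> insert 0 (Suc ` {i. Suc i < length (y # ps)})"
      by (cases i) auto
  qed auto
  then show ?thesis
    unfolding path_points_def by auto
qed

lemma polygonal_path_Cons2D:
  assumes "polygonal_path G (x # y # ps)"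
  shows "polygonal_path G (y # ps)" "segment_between G x y \<inter> path_points G (y # ps) \<subseteq> {y}"
proof -
  note D = assms[unfolded polygonal_path_def]
  have meet: "segment_between G ((x # y # ps) ! i) ((x # y # ps) ! Suc i)
      \<inter> segment_between G ((x # y # ps) ! j) ((x # y # ps) ! Suc j)
      \<subseteq> (if j = Suc i then {(x # y # ps) ! j} else {})"
    if "i < j" "Suc j < length (x # y # ps)" for i j
    using D that by blast
  show "polygonal_path G (y # ps)"
    unfolding polygonal_path_def
  proof (intro conjI allI impI)
    fix i j assume ij: "i < j \<and> Suc j < length (y # ps)"
    show "segment_between G ((y # ps) ! i) ((y # ps) ! Suc i)
      \<inter> segment_between G ((y # ps) ! j) ((y # ps) ! Suc j)
      \<subseteq> (if j = Suc i then {(y # ps) ! j} else {})"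
      using meet[of "Suc i" "Suc j", unfolded nth_Cons_Suc[of x] nat.inject] ij by simp
  qed (use D in auto)
  show "segment_between G x y \<inter> path_points G (y # ps) \<subseteq> {y}"
  proof (rule ccontr)
    assume "\<not> ?thesis"
    then obtain z where z: "z \<in> segment_between G x y" "z \<in> path_points G (y # ps)" "z \<noteq> y" by blast
    have nr: "successively near (x # y # ps)"
      using polygonal_path_near[OF assms] .
    \<comment> \<open>A corner of the tail other than \<open>y\<close> is also the end of a segment
      of the tail, so only meetings of segments remain to be excluded.\<close>
    have "\<exists>j. Suc j < length (y # ps) \<and> z \<in> segment_between G ((y # ps) ! j) ((y # ps) ! Suc j)"
    proof (cases "z \<in> set (y # ps)")
      case True
      then obtain m where m: "m < length (y # ps)" "z = (y # ps) ! m"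
        by (metis in_set_conv_nth)
      with z obtain k where "m = Suc k" by (cases m) auto
      moreover have "near ((y # ps) ! k) ((y # ps) ! Suc k)"
        using successively_nth[OF nr, of "Suc k"] m \<open>m = Suc k\<close> by simp
      ultimately show ?thesis
        using segment_between_ends(2) m by blast
    next
      case False
      then show ?thesis using z(2) by (auto simp: path_points_def)
    qed
    then obtain j where j: "Suc j < length (y # ps)"
      "z \<in> segment_between G ((y # ps) ! j) ((y # ps) ! Suc j)" by blast
    show False
      using meet[of 0 "Suc j"] j z by (cases "j = 0") auto
  qed
qed

text \<open>Induction on the corners, gluing the first segment to the box of the rest. It shows that
  the points traversed do not depend on the chosen corners, which \<open>tree_path\<close>
  needs.\<close>

lemma path_points_arc:
  assumes "polygonal_path G ps"
  shows "path_points G ps = arc (hd ps) (last ps)"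
  using assms
proof (induction ps)
  case Nil
  then show ?case by (simp add: polygonal_path_def)
next
  case (Cons x ps)
  show ?case
  proof (cases ps)
    case Nil
    then show ?thesis
      using Cons.prems arc_self by (simp add: path_points_def polygonal_path_def)
  next
    case C: (Cons y qs)
    have pp: "polygonal_path G (y # qs)" "segment_between G x y \<inter> path_points G (y # qs) \<subseteq> {y}"
      using polygonal_path_Cons2D Cons.prems unfolding C by auto
    have "near x y" "x \<noteq> y" and pts: "x \<in> points G" "set (y # qs) \<subseteq> points G"
      using polygonal_path_near[OF Cons.prems] Cons.prems unfolding C polygonal_path_def by auto
    then obtain e where e: "e \<in> edges G" "x \<in> edge_seg G e" "y \<in> edge_seg G e"
      by (auto simp: near_def)
    let ?l = "last (y # qs)"
    have l: "?l \<in> points G" using pts last_in_set[of "y # qs"] by blast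
    have seg: "segment_between G x y = arc x y"
      using segment_between_eq_arc[OF e \<open>x \<noteq> y\<close>] .
    have IH: "path_points G (y # qs) = arc y ?l"
      using Cons.IH pp(1) unfolding C by simp
    have "y \<in> arc x ?l"
      using arc_extend[OF e l] pp(2) seg IH by simp
    then have "arc x ?l = arc x y \<union> arc y ?l"
      using arc_Un[OF pts(1) l] by blast
    then show ?thesis
      unfolding C path_points_Cons2 IH seg using arc_ends(1)[OF pts(1)] by auto
  qed
qed

text \<open>
  A chain of fewest points, consecutive ones on a common edge, cannot meet itself.
\<close>

lemma polygonal_path_exists:
  assumes x: "x \<in> points G" and y: "y \<in> points G"
  shows "\<exists>ps. polygonal_path G ps \<and> hd ps = x \<and> last ps = y"
proof -
  define C where "C = {ps. ps \<noteq> [] \<and> hd ps = x \<and> last ps = y \<and> set ps \<subseteq> points G \<and> successively near ps}"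
  have "\<exists>ps. ps \<in> C"
  proof -
    obtain ps where ps: "ps \<noteq> []" "hd ps = x" "last ps = y" "successively near ps"
      using rtranclp_distinct_path[OF points_connected[OF x y]] by blast
    have "set ps \<subseteq> points G"
    proof
      fix z assume "z \<in> set ps"
      then obtain i where i: "i < length ps" "z = ps ! i" by (metis in_set_conv_nth)
      show "z \<in> points G"
      proof (cases i)
        case 0
        then show ?thesis using i ps x by (simp add: hd_conv_nth)
      next
        case (Suc j)
        then show ?thesis
          using successively_nth[OF ps(4), of j] i edge_seg_points by (auto simp: near_def)
      qed
    qed
    then show ?thesis using ps C_def by blast
  qed
  then obtain ps where ps: "ps \<in> C" and min: "\<And>qs. qs \<in> C \<Longrightarrow> length ps \<le> length qs"
    using ex_has_least_nat[of "\<lambda>ps. ps \<in> C" _ length] by blast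
  have nr: "successively near ps" and pts: "set ps \<subseteq> points G" and ne: "ps \<noteq> []"
    and hl: "hd ps = x" "last ps = y"
    using ps by (auto simp: C_def)
  \<comment> \<open>The \<open>j - i\<close> corners strictly between the positions \<open>i\<close>
    and \<open>Suc j\<close> cannot be replaced by fewer, since the chain has minimal
    length.\<close>
  have splice: False
    if "i < j" "Suc j < length ps" "set ms \<subseteq> points G"
      "successively near (ps ! i # ms @ [ps ! Suc j])" "length ms < j - i" for i j ms
  proof -
    have t: "take (Suc i) ps = take i ps @ [ps ! i]" and d: "drop (Suc j) ps = ps ! Suc j # drop (Suc (Suc j)) ps"
      using that by (auto simp: take_Suc_conv_app_nth Cons_nth_drop_Suc)
    have st: "successively near (take i ps @ [ps ! i])" "successively near (ps ! Suc j # drop (Suc (Suc j)) ps)"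
      using successively_take[OF nr, of "Suc i"] successively_drop[OF nr, of "Suc j"] t d by simp_all
    let ?qs = "take i ps @ [ps ! i] @ ms @ [ps ! Suc j] @ drop (Suc (Suc j)) ps"
    have "successively near ?qs"
      using st that(4)
      by (cases ms) (auto simp: successively_append_iff successively_Cons hd_append split: if_splits)
    moreover have "hd ?qs = x"
      using hl(1) that by (cases i; cases ps) auto
    moreover have "last ?qs = y"
      using hl(2) that ne d by (metis append_assoc append_Cons append_Nil last_appendR last_drop list.discI)
    moreover have "set ?qs \<subseteq> points G"
      using pts that(3) t d set_take_subset[of "Suc i" ps] set_drop_subset[of "Suc j" ps] by auto
    ultimately have "?qs \<in> C" by (simp add: C_def)
    from min[OF this] show False using that by simp
  qed
  have nth_near: "near (ps ! i) (ps ! Suc i)" if "Suc i < length ps" for i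
    using successively_nth[OF nr that] .
  have "polygonal_path G ps"
    unfolding polygonal_path_def
  proof (intro conjI allI impI)
    show "successively (\<lambda>x y. \<exists>e\<in>edges G. x \<in> edge_seg G e \<and> y \<in> edge_seg G e) ps"
      using nr unfolding near_def .
    show "distinct ps"
    proof (rule ccontr)
      assume "\<not> distinct ps"
      then obtain as bs cs z where d: "ps = as @ [z] @ bs @ [z] @ cs"
        using not_distinct_decomp by blast
      have "as @ [z] @ cs \<in> C"
        using nr pts hl unfolding d C_def
        by (cases as; cases cs)
          (auto simp: successively_append_iff successively_Cons hd_append split: if_splits)
      from min[OF this] show False unfolding d by simp
    qed
    fix i j assume ij: "i < j \<and> Suc j < length ps"
    show "segment_between G (ps ! i) (ps ! Suc i) \<inter> segment_between G (ps ! j) (ps ! Suc j)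
          \<subseteq> (if j = Suc i then {ps ! j} else {})"
    proof (rule ccontr)
      assume "\<not> ?thesis"
      then obtain z where z: "z \<in> segment_between G (ps ! i) (ps ! Suc i)"
        "z \<in> segment_between G (ps ! j) (ps ! Suc j)" "j = Suc i \<Longrightarrow> z \<noteq> ps ! j"
        by (auto split: if_splits)
      obtain e where e: "e \<in> edges G" "ps ! i \<in> edge_seg G e" "z \<in> edge_seg G e" "ps ! Suc i \<in> edge_seg G e"
        using segment_between_near[OF nth_near z(1)] ij by auto
      obtain g where g: "g \<in> edges G" "ps ! j \<in> edge_seg G g" "z \<in> edge_seg G g" "ps ! Suc j \<in> edge_seg G g"
        using segment_between_near[OF nth_near z(2)] ij by auto
      show False
      proof (cases "j = Suc i")
        case True
        \<comment> \<open>Both segments contain the distinct points \<open>z\<close> and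
          \<open>ps ! j\<close>, hence lie on one edge, and the corner \<open>ps ! j\<close> could
          be dropped.\<close>
        then have "e = g"
          using common_edge_unique[of e z "ps ! j" g] e g z(3) by blast
        then have "near (ps ! i) (ps ! Suc j)" using e g by (auto simp: near_def)
        then show False using splice[of i j "[]"] ij by simp
      next
        case False
        have "near (ps ! i) z" "near z (ps ! Suc j)" "z \<in> points G"
          using e g edge_seg_points[OF e(1)] by (auto simp: near_def)
        moreover have "Suc 0 < j - i" using ij False by linarith
        ultimately show False using splice[of i j "[z]"] ij by simp
      qed
    qed
  qed (use ne pts in auto)
  then show ?thesis using hl by blast
qed

lemma tree_path_eq_arc:
  assumes "x \<in> points G" "y \<in> points G"
  shows "tree_path G x y = arc x y"
  unfolding tree_path_def
proof (rule the_equality)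
  show "\<exists>ps. polygonal_path G ps \<and> hd ps = x \<and> last ps = y \<and> arc x y = path_points G ps"
    using polygonal_path_exists[OF assms] path_points_arc by metis
qed (use path_points_arc in auto)

text \<open>On any other edge \<open>g\<close>, the points of \<open>e\<close> have the coordinate
  \<open>foot g e\<close>. If \<open>x\<close> and \<open>y\<close> differ on \<open>e\<close>, one
  of them is off \<open>foot e g\<close> and therefore has this same coordinate on \<open>g\<close>;
  so only the coordinate on \<open>e\<close> constrains the points of \<open>e\<close>.\<close>

lemma arc_edge_cases:
  assumes x: "x \<in> points G" and y: "y \<in> points G" and e: "e \<in> edges G"
  shows "{t\<in>{0..len e}. edge_point G e t \<in> arc x y} \<subseteq> closed_segment (proj e x) (proj e y)"
    and "proj e x \<noteq> proj e y \<Longrightarrow>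
      {t\<in>{0..len e}. edge_point G e t \<in> arc x y} = closed_segment (proj e x) (proj e y)"
proof -
  show sub: "{t\<in>{0..len e}. edge_point G e t \<in> arc x y} \<subseteq> closed_segment (proj e x) (proj e y)"
    using e by (auto simp: arc_def proj_edge_point_same)
  assume ne: "proj e x \<noteq> proj e y"
  have "t \<in> {0..len e} \<and> edge_point G e t \<in> arc x y" if t: "t \<in> closed_segment (proj e x) (proj e y)" for t
  proof
    show t': "t \<in> {0..len e}"
      using t proj_range[OF e x] proj_range[OF e y] by (auto simp: in_closed_segment_real)
    show "edge_point G e t \<in> arc x y"
      unfolding arc_def
    proof (intro CollectI conjI ballI)
      show "edge_point G e t \<in> points G" using t' edge_point_in_points[OF e] by simp
      fix g assume g: "g \<in> edges G"
      show "proj g (edge_point G e t) \<in> closed_segment (proj g x) (proj g y)"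
      proof (cases "g = e")
        case True
        then show ?thesis using t e by (simp add: proj_edge_point_same)
      next
        case False
        then have "proj g x = foot g e \<or> proj g y = foot g e"
          using foot_or_foot[OF e g _ x] foot_or_foot[OF e g _ y] ne by metis
        then show ?thesis using False e by (auto simp: proj_edge_point_other)
      qed
    qed
  qed
  then show "{t\<in>{0..len e}. edge_point G e t \<in> arc x y} = closed_segment (proj e x) (proj e y)"
    using sub by blast
qed

section \<open>Length of arcs and distance\<close>

lemma emeasure_arc_edge:
  assumes x: "x \<in> points G" and y: "y \<in> points G" and e: "e \<in> edges G"
  shows "{t\<in>{0..len e}. edge_point G e t \<in> arc x y} \<in> sets lebesgue"
    and "emeasure lebesgue {t\<in>{0..len e}. edge_point G e t \<in> arc x y} = ennreal \<bar>proj e x - proj e y\<bar>"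
proof -
  let ?A = "{t\<in>{0..len e}. edge_point G e t \<in> arc x y}"
  have "?A \<in> sets lebesgue \<and> emeasure lebesgue ?A = ennreal \<bar>proj e x - proj e y\<bar>"
  proof (cases "proj e x = proj e y")
    case True
    \<comment> \<open>The arc may touch \<open>e\<close> in one point or miss it; both traces are
      null.\<close>
    then have "?A \<subseteq> {proj e x}"
      using arc_edge_cases(1)[OF assms] by auto
    then consider "?A = {}" | "?A = {proj e x}" by blast
    then show ?thesis
    proof cases
      case 1
      show ?thesis unfolding 1 using True by simp
    next
      case 2
      show ?thesis unfolding 2 using True by simp
    qed
  next
    case False
    have "emeasure lebesgue (closed_segment s t) = ennreal \<bar>s - t\<bar>" for s t :: real
      by (simp add: closed_segment_eq_real_ivl)
    then show ?thesis
      unfolding arc_edge_cases(2)[OF assms False] by (simp add: closed_segment_eq_real_ivl)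
  qed
  then show "?A \<in> sets lebesgue" "emeasure lebesgue ?A = ennreal \<bar>proj e x - proj e y\<bar>" by auto
qed

lemma arc_sets: "x \<in> points G \<Longrightarrow> y \<in> points G \<Longrightarrow> arc x y \<in> sets (tree_measure G)"
  unfolding sets_tree_measure tree_sets_def using arc_points emeasure_arc_edge(1) by blast

lemma emeasure_arc:
  assumes "x \<in> points G" "y \<in> points G"
  shows "emeasure (tree_measure G) (arc x y) = ennreal (gdist x y)"
proof -
  have "emeasure (tree_measure G) (arc x y)
      = (\<integral>\<^sup>+e. emeasure lebesgue {t\<in>{0..len e}. edge_point G e t \<in> arc x y} \<partial>count_space (edges G))"
    using arc_sets[OF assms] by (intro emeasure_tree_measure) (simp add: sets_tree_measure)
  also have "\<dots> = (\<integral>\<^sup>+e. ennreal \<bar>proj e x - proj e y\<bar> \<partial>count_space (edges G))"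
    by (intro nn_integral_cong emeasure_arc_edge(2)[OF assms]) simp
  also have "\<dots> = (\<Sum>e\<in>diff_edges x y. ennreal \<bar>proj e x - proj e y\<bar>)"
    by (rule nn_integral_count_space'[OF finite_diff_edges[OF assms]]) (auto simp: diff_edges_def)
  also have "\<dots> = ennreal (gdist x y)"
    by (simp add: gdist_def)
  finally show ?thesis .
qed

lemma tree_dist_eq: "x \<in> points G \<Longrightarrow> y \<in> points G \<Longrightarrow> tree_dist G x y = gdist x y"
  by (simp add: tree_dist_def tree_path_eq_arc measure_def emeasure_arc gdist_nonneg)

lemma arc_intermediate:
  assumes "x \<in> points G" "y \<in> points G" "0 \<le> t" "t \<le> gdist x y"
  shows "\<exists>z\<in>arc x y. gdist x z = t"
proof -
  have "\<exists>z\<in>arc (hd ps) (last ps). gdist (hd ps) z = t"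
    if "polygonal_path G ps" "0 \<le> t" "t \<le> gdist (hd ps) (last ps)" for ps t
    using that
  proof (induction ps arbitrary: t)
    case Nil
    then show ?case by (simp add: polygonal_path_def)
  next
    case (Cons x ps)
    have x: "x \<in> points G" using Cons.prems by (auto simp: polygonal_path_def)
    show ?case
    proof (cases ps)
      case Nil
      then show ?thesis using Cons.prems x arc_self gdist_zero[of x x] by auto
    next
      case C: (Cons y qs)
      let ?l = "last (y # qs)"
      have pp: "polygonal_path G (y # qs)"
        using polygonal_path_Cons2D Cons.prems unfolding C by auto
      have "near x y" and pts: "set (y # qs) \<subseteq> points G"
        using polygonal_path_near[OF Cons.prems(1)] Cons.prems(1) unfolding C polygonal_path_def by auto
      then obtain e where e: "e \<in> edges G" "x \<in> edge_seg G e" "y \<in> edge_seg G e"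
        by (auto simp: near_def)
      have l: "?l \<in> points G" and y: "y \<in> points G" using pts last_in_set[of "y # qs"] by auto
      have "y \<in> path_points G (x # y # qs)" by (simp add: path_points_def)
      then have yl: "y \<in> arc x ?l"
        using path_points_arc[OF Cons.prems(1)] unfolding C by simp
      show ?thesis
      proof (cases "t \<le> gdist x y")
        case True
        obtain s r where sr: "s \<in> {0..len e}" "r \<in> {0..len e}" "x = edge_point G e s" "y = edge_point G e r"
          using e by (auto simp: edge_seg_def)
        have E: "gdist (edge_point G e s) (edge_point G e r) = \<bar>s - r\<bar>" for s r
        proof -
          have "diff_edges (edge_point G e s) (edge_point G e r) \<subseteq> {e}"
          proof
            fix g assume "g \<in> diff_edges (edge_point G e s) (edge_point G e r)"
            then have "proj g (edge_point G e s) \<noteq> proj g (edge_point G e r)"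
              by (simp add: diff_edges_def)
            then show "g \<in> {e}"
              using proj_edge_point_other[OF e(1)] by (cases "g = e") auto
          qed
          then show ?thesis
            using e(1) gdist_eq_sum[of "{e}" "edge_point G e s" "edge_point G e r"]
            by (simp add: proj_edge_point_same)
        qed
        define t' where "t' = (if s \<le> r then s + t else s - t)"
        have "t' \<in> closed_segment s r" "\<bar>s - t'\<bar> = t"
          using True Cons.prems(2) E[of s r] sr by (auto simp: t'_def in_closed_segment_real)
        then have "edge_point G e t' \<in> arc x y" "gdist x (edge_point G e t') = t"
          using edge_arc[OF e(1) sr(1,2)] sr E by auto
        then show ?thesis
          using arc_subset[OF yl] unfolding C by (intro bexI[of _ "edge_point G e t'"]) auto
      next
        case False
        then have "\<exists>z\<in>arc y ?l. gdist y z = t - gdist x y"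
          using Cons.IH[of "t - gdist x y"] pp Cons.prems gdist_add[OF x l yl] unfolding C by simp
        then obtain z where z: "z \<in> arc y ?l" "gdist y z = t - gdist x y" by blast
        have "gdist x z = gdist x y + gdist y z"
          using gdist_add[OF x _ arc_between[OF yl z(1)]] z arc_points by blast
        then show ?thesis
          using z arc_subset'[OF yl] unfolding C by (intro bexI[of _ z]) auto
      qed
    qed
  qed
  then show ?thesis
    using polygonal_path_exists[OF assms(1,2)] assms by metis
qed

section \<open>The metric and the local structure of the tree\<close>

lemma Metric_space_tree_dist: "Metric_space (points G) (tree_dist G)"
proof
  fix x y :: "'v tpoint"
  show "0 \<le> tree_dist G x y" by (simp add: tree_dist_def)
  show "tree_dist G x y = tree_dist G y x"
  proof (cases "x \<in> points G \<and> y \<in> points G")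
    case True
    then show ?thesis by (simp add: tree_dist_eq gdist_commute)
  next
    case False
    \<comment> \<open>Symmetry is also required off the tree. There no path exists in either
      direction, and both definite descriptions are taken over the same empty predicate.\<close>
    have no: "\<nexists>ps. polygonal_path G ps \<and> hd ps = x' \<and> last ps = y' \<and> S = path_points G ps"
      if "x' \<notin> points G \<or> y' \<notin> points G" for x' y' S
      using that hd_in_set last_in_set unfolding polygonal_path_def by blast
    have "tree_path G x y = tree_path G y x"
      unfolding tree_path_def
      by (rule arg_cong[where f = The], rule ext) (use no[of x y] no[of y x] False in metis)
    then show ?thesis by (simp add: tree_dist_def)
  qed
next
  fix x y z :: "'v tpoint"
  assume "x \<in> points G" "y \<in> points G"
  then show "tree_dist G x y = 0 \<longleftrightarrow> x = y"
    by (simp add: tree_dist_eq gdist_zero)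
  assume "z \<in> points G"
  then show "tree_dist G x z \<le> tree_dist G x y + tree_dist G y z"
    using \<open>x \<in> points G\<close> \<open>y \<in> points G\<close> by (simp add: tree_dist_eq gdist_triangle)
qed

text \<open>Edge lengths have no common lower bound, so the radius at a vertex comes from the least
  length of its finitely many edges. Without edges even \<open>near x x\<close> fails, hence
  \<open>nt\<close>.\<close>

lemma close_imp_near:
  assumes x: "x \<in> points G" and nt: "edges G \<noteq> {}"
  shows "\<exists>\<delta>>0. \<forall>y\<in>points G. gdist x y < \<delta> \<longrightarrow> near x y"
  using x
proof (cases rule: points_cases)
  case (Interior e t)
  have "near x y" if y: "y \<in> points G" "gdist x y < min t (len e - t)" for y
  proof -
    have "\<bar>t - proj e y\<bar> < min t (len e - t)"
      using proj_le_gdist[OF x y(1) Interior(1)] y(2) Interior proj_edge_point_same by auto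
    then have "0 < proj e y" "proj e y < len e" by auto
    then have "y \<in> edge_seg G e"
      using interior_proj[OF Interior(1) y(1)] unfolding edge_seg_def by force
    moreover have "x \<in> edge_seg G e"
      using Interior unfolding edge_seg_def by force
    ultimately show ?thesis using Interior(1) by (auto simp: near_def)
  qed
  then show ?thesis
    using Interior by (intro exI[of _ "min t (len e - t)"]) auto
next
  case (Vertex w)
  let ?E = "{e \<in> edges G. fst e = w \<or> snd e = w}"
  have "?E \<subseteq> Pair w ` {y. adjacent G w y} \<union> (\<lambda>y. (y, w)) ` {y. adjacent G w y}"
    by (auto simp: adjacent_def)
  then have fin: "finite ?E"
    using finite_adjacent[OF Vertex(1)] finite_subset by blast
  define \<delta> where "\<delta> = Min (insert 1 (len ` ?E))"
  have "0 < \<delta>" unfolding \<delta>_def using fin len_pos by (subst Min_gr_iff) auto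
  have \<delta>: "\<delta> \<le> len e" if "e \<in> ?E" for e
    unfolding \<delta>_def using fin that by (intro Min_le) auto
  have "near x y" if y: "y \<in> points G" "gdist x y < \<delta>" for y
  proof (cases "x = y")
    case True
    obtain e where "e \<in> edges G" "w = fst e \<or> w = snd e"
    proof -
      obtain d where d: "d \<in> edges G" using nt by blast
      show thesis
      proof (cases "w = fst d")
        case True
        then show thesis using that d by blast
      next
        case False
        with verts_connected[OF Vertex(1) edge_verts(1)[OF d]] obtain w' where "adjacent G w w'"
          by (metis converse_rtranclpE)
        then show thesis using that unfolding adjacent_def by (metis fst_conv snd_conv)
      qed
    qed
    then show ?thesis
      using ends_in_edge_seg[of e] True Vertex by (auto simp: near_def)
  next
    case False
    obtain ps where ps: "polygonal_path G ps" "hd ps = x" "last ps = y"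
      using polygonal_path_exists[OF x y(1)] by blast
    then obtain p qs where C: "ps = x # p # qs"
      using False by (metis polygonal_path_def last_ConsL list.collapse)
    have "near x p" "x \<noteq> p"
      using polygonal_path_near[OF ps(1)] ps(1) unfolding C polygonal_path_def by auto
    then obtain e where e: "e \<in> edges G" "x \<in> edge_seg G e" "p \<in> edge_seg G e"
      by (auto simp: near_def)
    have "p \<in> arc x y"
      using path_points_arc[OF ps(1)] ps by (auto simp: C path_points_def)
    then have pe: "proj e p \<in> closed_segment (proj e x) (proj e y)"
      using e(1) by (auto simp: arc_def)
    have "proj e p \<noteq> proj e x"
      using proj_in_edge[OF e(1)] e \<open>x \<noteq> p\<close> by metis
    have xe: "proj e x = 0 \<or> proj e x = len e" using Vertex by auto
    have "e \<in> ?E"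
      using e(1,2) Vertex(2) by (auto simp: edge_seg_def edge_point_def split: if_splits)
    from \<delta>[OF this] have "\<bar>proj e x - proj e y\<bar> < len e"
      using proj_le_gdist[OF x y(1) e(1)] y(2) by linarith
    then have "0 < proj e y" "proj e y < len e"
      using xe pe \<open>proj e p \<noteq> proj e x\<close> proj_range[OF e(1) y(1)]
      by (auto simp: in_closed_segment_real)
    then have "y \<in> edge_seg G e"
      using interior_proj[OF e(1) y(1)] unfolding edge_seg_def by force
    then show ?thesis using e by (auto simp: near_def)
  qed
  then show ?thesis using \<open>0 < \<delta>\<close> by blast
qed

lemma finite_incident:
  assumes x: "x \<in> points G"
  shows "finite {e \<in> edges G. x \<in> edge_seg G e}"
  using x
proof (cases rule: points_cases)
  case (Interior e t)
  have "{e \<in> edges G. x \<in> edge_seg G e} \<subseteq> {e}"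
  proof
    fix g assume "g \<in> {e \<in> edges G. x \<in> edge_seg G e}"
    then obtain s where "g \<in> edges G" "x = edge_point G g s" by (auto simp: edge_seg_def)
    then show "g \<in> {e}"
      using Interior(4) by (auto simp: edge_point_def split: if_splits)
  qed
  then show ?thesis using finite_subset by blast
next
  case (Vertex w)
  have "{e \<in> edges G. x \<in> edge_seg G e} \<subseteq> Pair w ` {y. adjacent G w y} \<union> (\<lambda>y. (y, w)) ` {y. adjacent G w y}"
  proof
    fix g assume "g \<in> {e \<in> edges G. x \<in> edge_seg G e}"
    then obtain s where g: "g \<in> edges G" "x = edge_point G g s" by (auto simp: edge_seg_def)
    then have "w = fst g \<or> w = snd g"
      using Vertex(2) by (auto simp: edge_point_def split: if_splits)
    then show "g \<in> Pair w ` {y. adjacent G w y} \<union> (\<lambda>y. (y, w)) ` {y. adjacent G w y}"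
      using g(1) by (cases g) (auto simp: adjacent_def)
  qed
  then show ?thesis
    using finite_adjacent[OF Vertex(1)] finite_subset by blast
qed

text \<open>
  For \<open>x \<noteq> a\<close> the radius must not reach \<open>a\<close>: beyond \<open>a\<close>, points of the edge of \<open>x\<close> may be incomparable
  with \<open>x\<close>.
\<close>

lemma arc_neighbourhood:
  assumes a: "a \<in> points G" and x: "x \<in> points G"
  shows "\<exists>\<delta>>0. \<exists>E. finite E \<and> E \<subseteq> points G \<and> (\<forall>q\<in>E. x \<in> arc a q) \<and>
    (\<forall>y\<in>points G. gdist x y < \<delta> \<longrightarrow> (\<exists>q\<in>E. y \<in> arc a q))"
proof (cases "edges G = {}")
  case True
  have "y \<in> arc a x" if "y \<in> points G" for y
    using proj_inject[OF that x] True arc_ends(2)[OF x, of a] by simp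
  then show ?thesis
    using x by (intro exI[of _ 1] conjI exI[of _ "{x}"]) auto
next
  case False
  obtain \<delta>0 where \<delta>0: "\<delta>0 > 0" "\<And>y. y \<in> points G \<Longrightarrow> gdist x y < \<delta>0 \<Longrightarrow> near x y"
    using close_imp_near[OF x False] by blast
  define \<delta> where "\<delta> = (if x = a then \<delta>0 else min \<delta>0 (gdist x a))"
  have "\<delta> > 0"
    using \<delta>0(1) gdist_zero[OF x a] gdist_nonneg[of x a] by (auto simp: \<delta>_def)
  let ?I = "{e \<in> edges G. x \<in> edge_seg G e}"
  define E where "E = {q \<in> insert x ((\<lambda>e. edge_point G e 0) ` ?I \<union> (\<lambda>e. edge_point G e (len e)) ` ?I). x \<in> arc a q}"
  have "finite E" unfolding E_def using finite_incident[OF x] by auto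
  moreover have "E \<subseteq> points G"
    unfolding E_def using x edge_point_in_points len_pos by (auto simp: less_imp_le)
  moreover have "\<exists>q\<in>E. y \<in> arc a q" if y: "y \<in> points G" "gdist x y < \<delta>" for y
  proof -
    have "near x y" using y \<delta>0(2)[OF y(1)] by (auto simp: \<delta>_def split: if_splits)
    then obtain e where e: "e \<in> edges G" "x \<in> edge_seg G e" "y \<in> edge_seg G e"
      by (auto simp: near_def)
    define s t where "s = proj e x" and "t = proj e y"
    have st: "x = edge_point G e s" "y = edge_point G e t"
      unfolding s_def t_def using proj_in_edge[OF e(1)] e by auto
    have rng: "0 \<le> s" "s \<le> len e" "0 \<le> t" "t \<le> len e"
      unfolding s_def t_def using proj_range e(1) x y(1) by auto
    have mem: "edge_point G e r \<in> arc a (edge_point G e r')"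
      if "r \<in> closed_segment (proj e a) r'" "0 \<le> r" "r \<le> len e" for r r'
      unfolding arc_def
    proof (intro CollectI conjI ballI)
      show "edge_point G e r \<in> points G" using edge_point_in_points[OF e(1)] that by blast
      fix g assume "g \<in> edges G"
      then show "proj g (edge_point G e r) \<in> closed_segment (proj g a) (proj g (edge_point G e r'))"
        using that(1) e(1) proj_edge_point_same[OF e(1)] proj_edge_point_other[OF e(1), of g]
        by (cases "g = e") auto
    qed
    \<comment> \<open>Either \<open>y\<close> lies on the way from \<open>a\<close> to
      \<open>x\<close>, or \<open>x\<close> on the way from \<open>a\<close> to \<open>y\<close>
      (two directions along \<open>e\<close>), or \<open>a\<close> separates them inside the edge,
      which the radius rules out.\<close>
    consider "t \<in> closed_segment (proj e a) s" | "s \<in> closed_segment (proj e a) (len e)" "s \<le> t"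
      | "s \<in> closed_segment (proj e a) 0" "t \<le> s"
      | "t < proj e a" "proj e a < s" | "s < proj e a" "proj e a < t"
      using rng proj_range[OF e(1) a] unfolding in_closed_segment_real by linarith
    then show ?thesis
    proof cases
      case 1
      then show ?thesis
        using mem[of t s] rng st x arc_ends(2)[OF x] by (auto simp: E_def)
    next
      case 2
      then have "x \<in> arc a (edge_point G e (len e))" "t \<in> closed_segment (proj e a) (len e)"
        using mem[of s "len e"] rng st proj_range[OF e(1) a] by (auto simp: in_closed_segment_real)
      then show ?thesis
        using mem[of t "len e"] rng st e by (intro bexI[of _ "edge_point G e (len e)"]) (auto simp: E_def)
    next
      case 3
      then have "x \<in> arc a (edge_point G e 0)" "t \<in> closed_segment (proj e a) 0"
        using mem[of s 0] rng st proj_range[OF e(1) a] by (auto simp: in_closed_segment_real)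
      then show ?thesis
        using mem[of t 0] rng st e by (intro bexI[of _ "edge_point G e 0"]) (auto simp: E_def)
    next
      case 4
      then have "a = edge_point G e (proj e a)" using interior_proj[OF e(1) a] rng by auto
      then have "a \<in> arc x y"
        using edge_arc[OF e(1), of s t] st rng 4 by (auto simp: in_closed_segment_real)
      moreover have "x \<noteq> a" using 4 s_def by auto
      ultimately show ?thesis
        using y gdist_add[OF x y(1)] gdist_nonneg[of a y] by (auto simp: \<delta>_def split: if_splits)
    next
      case 5
      then have "a = edge_point G e (proj e a)" using interior_proj[OF e(1) a] rng by auto
      then have "a \<in> arc x y"
        using edge_arc[OF e(1), of s t] st rng 5 by (auto simp: in_closed_segment_real)
      moreover have "x \<noteq> a" using 5 s_def by auto
      ultimately show ?thesis
        using y gdist_add[OF x y(1)] gdist_nonneg[of a y] by (auto simp: \<delta>_def split: if_splits)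
    qed
  qed
  ultimately show ?thesis
    using \<open>\<delta> > 0\<close> by (intro exI[of _ \<delta>] conjI exI[of _ E]) (auto simp: E_def)
qed

text \<open>The trace on each edge is star-shaped about the coordinate of \<open>a\<close>, hence an
  interval. Measurability of root paths, levels, trunks and targets is obtained from this lemma and
  complements.\<close>

lemma down_closed_sets:
  assumes a: "a \<in> points G" and A: "A \<subseteq> points G" and down: "\<And>x. x \<in> A \<Longrightarrow> arc a x \<subseteq> A"
  shows "A \<in> sets (tree_measure G)"
  unfolding sets_tree_measure tree_sets_def
proof (intro CollectI conjI ballI A)
  fix e assume e: "e \<in> edges G"
  let ?S = "{t\<in>{0..len e}. edge_point G e t \<in> A}"
  have star: "r \<in> ?S" if t: "t \<in> ?S" "r \<in> closed_segment (proj e a) t" for r t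
  proof -
    have r: "0 \<le> r" "r \<le> len e"
      using t proj_range[OF e a] by (auto simp: in_closed_segment_real)
    have "edge_point G e r \<in> arc a (edge_point G e t)"
      unfolding arc_def
    proof (intro CollectI conjI ballI)
      show "edge_point G e r \<in> points G" using edge_point_in_points[OF e] r by blast
      fix g assume "g \<in> edges G"
      then show "proj g (edge_point G e r) \<in> closed_segment (proj g a) (proj g (edge_point G e t))"
        using t(2) e proj_edge_point_same[OF e] proj_edge_point_other[OF e, of g]
        by (cases "g = e") auto
    qed
    then show ?thesis using t(1) down r by auto
  qed
  have "is_interval ?S"
    unfolding is_interval_1
  proof (intro ballI allI impI)
    fix s t r assume "s \<in> ?S" "t \<in> ?S" "s \<le> r \<and> r \<le> t"
    then show "r \<in> ?S"
      using star[of s r] star[of t r] unfolding in_closed_segment_real by linarith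
  qed
  then show "?S \<in> sets lebesgue" by (rule is_interval_imp_lebesgue)
qed

lemma singleton_null:
  assumes x: "x \<in> points G"
  shows "{x} \<in> null_sets (tree_measure G)"
  using arc_sets[OF x x] emeasure_arc[OF x x] by (auto simp: null_sets_def arc_self[OF x] gdist_def)

end

section \<open>Rooted trees and the function U\<close>

text \<open>\<open>P x\<close> stands for the path from the root to \<open>x\<close>. The study of
  \<open>U\<close> and its levels rests on these properties alone; what remains of the finite degree
  is \<open>P_neighbourhood\<close>, which covers a neighbourhood of \<open>x\<close> by finitely
  many root paths through \<open>x\<close>.\<close>

locale rooted_tree = Metric_space X d for X :: "'a set" and d :: "'a \<Rightarrow> 'a \<Rightarrow> real" +
  fixes a :: 'a and P :: "'a \<Rightarrow> 'a set" and M :: "'a measure"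
  assumes root_in: "a \<in> X"
    and P_subset: "x \<in> X \<Longrightarrow> P x \<subseteq> X"
    and P_refl: "x \<in> X \<Longrightarrow> x \<in> P x"
    and root_P: "x \<in> X \<Longrightarrow> a \<in> P x"
    and P_mono: "x \<in> X \<Longrightarrow> y \<in> P x \<Longrightarrow> P y \<subseteq> P x"
    and P_chain: "x \<in> X \<Longrightarrow> y \<in> P x \<Longrightarrow> z \<in> P x \<Longrightarrow> y \<in> P z \<or> z \<in> P y"
    and P_dist: "x \<in> X \<Longrightarrow> y \<in> P x \<Longrightarrow> d a x = d a y + d y x"
    and P_intermediate: "x \<in> X \<Longrightarrow> 0 \<le> t \<Longrightarrow> t \<le> d a x \<Longrightarrow> \<exists>y\<in>P x. d a y = t"
    and P_neighbourhood: "x \<in> X \<Longrightarrow> \<exists>\<delta>>0. \<exists>E. finite E \<and> E \<subseteq> X \<and> (\<forall>q\<in>E. x \<in> P q) \<and>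
      (\<forall>y\<in>X. d x y < \<delta> \<longrightarrow> (\<exists>q\<in>E. y \<in> P q))"
    and space_M: "space M = X"
    and down_closed_measurable: "A \<subseteq> X \<Longrightarrow> (\<And>x. x \<in> A \<Longrightarrow> P x \<subseteq> A) \<Longrightarrow> A \<in> sets M"
    and point_null: "x \<in> X \<Longrightarrow> {x} \<in> null_sets M"
begin

definition h :: "'a \<Rightarrow> real" where "h x = d a x"

definition D :: "'a \<Rightarrow> 'a set" where "D r = {x \<in> X. r \<in> P x}"

definition pt :: "'a \<Rightarrow> real \<Rightarrow> 'a" where "pt x t = (THE y. y \<in> P x \<and> h y = t)"

lemma P_trans: "x \<in> X \<Longrightarrow> y \<in> P x \<Longrightarrow> z \<in> P y \<Longrightarrow> z \<in> P x"
  using P_mono by blast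

lemma P_in: "x \<in> X \<Longrightarrow> y \<in> P x \<Longrightarrow> y \<in> X"
  using P_subset by blast

lemma h_nonneg: "0 \<le> h x"
  by (simp add: h_def)

lemma h_root: "h a = 0"
  by (simp add: h_def root_in)

lemma h_dist: "x \<in> X \<Longrightarrow> y \<in> P x \<Longrightarrow> d y x = h x - h y"
  using P_dist by (simp add: h_def)

lemma h_mono: "x \<in> X \<Longrightarrow> y \<in> P x \<Longrightarrow> h y \<le> h x"
  using h_dist[of x y] nonneg[of y x] by simp

lemma h_strict_mono: "x \<in> X \<Longrightarrow> y \<in> P x \<Longrightarrow> y \<noteq> x \<Longrightarrow> h y < h x"
  using h_dist[of x y] mdist_pos_less[of y x] P_in by simp

lemma P_antisym: "x \<in> X \<Longrightarrow> y \<in> P x \<Longrightarrow> x \<in> P y \<Longrightarrow> x = y"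
  using h_strict_mono[of x y] h_mono[of y x] P_in by fastforce

lemma P_iff_h: "x \<in> X \<Longrightarrow> y \<in> P x \<Longrightarrow> z \<in> P x \<Longrightarrow> y \<in> P z \<longleftrightarrow> h y \<le> h z"
  using P_chain[of x y z] h_mono[of z y] h_strict_mono[of y z] P_in P_refl[of y] by fastforce

lemma h_inj: "x \<in> X \<Longrightarrow> y \<in> P x \<Longrightarrow> z \<in> P x \<Longrightarrow> h y = h z \<Longrightarrow> y = z"
  using P_iff_h[of x y z] P_iff_h[of x z y] P_antisym[of z y] P_in[of x z] by (metis order_refl)

lemma dist_on_path:
  assumes "x \<in> X" "y \<in> P x" "z \<in> P x"
  shows "d y z = \<bar>h y - h z\<bar>"
proof -
  have "y \<in> X" "z \<in> X" using assms P_in by blast+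
  then show ?thesis
    using P_chain[OF assms] h_dist[of z y] h_dist[of y z] h_mono[of z y] h_mono[of y z]
      commute[of y z] by (metis abs_minus_commute abs_of_nonneg diff_ge_0_iff_ge)
qed

lemma P_root: "P a = {a}"
  using P_refl[OF root_in] P_in[OF root_in] root_P P_antisym[OF root_in] by blast

lemma pt:
  assumes "x \<in> X" "0 \<le> t" "t \<le> h x"
  shows pt_in: "pt x t \<in> P x" and h_pt: "h (pt x t) = t"
proof -
  have "\<exists>!y. y \<in> P x \<and> h y = t"
    using P_intermediate[OF assms[unfolded h_def]] h_inj[OF assms(1)] unfolding h_def by metis
  then have "pt x t \<in> P x \<and> h (pt x t) = t"
    unfolding pt_def by (rule theI')
  then show "pt x t \<in> P x" "h (pt x t) = t" by auto
qed

lemma pt_h: "x \<in> X \<Longrightarrow> y \<in> P x \<Longrightarrow> pt x (h y) = y"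
  using h_inj pt_in h_pt h_nonneg h_mono by meson

lemma P_pt:
  assumes "x \<in> X" "0 \<le> t" "t \<le> h x"
  shows "P (pt x t) = {y \<in> P x. h y \<le> t}"
  using P_iff_h[OF assms(1) _ pt_in[OF assms]] P_mono[OF assms(1) pt_in[OF assms]] h_pt[OF assms]
  by auto

lemma path_image: "x \<in> X \<Longrightarrow> P x = pt x ` {0..h x}"
  using pt_in[of x] pt_h[of x] h_nonneg h_mono[of x] by force

lemma segment_image:
  assumes "x \<in> X" "r \<in> P x"
  shows "P x \<inter> D r = pt x ` {h r..h x}"
proof (intro equalityI subsetI)
  fix y assume y: "y \<in> P x \<inter> D r"
  then have "r \<in> P y" "y \<in> X" by (auto simp: D_def)
  then show "y \<in> pt x ` {h r..h x}"
    using y h_mono assms pt_h[OF assms(1), of y] by (intro image_eqI[of _ _ "h y"]) auto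
next
  fix y assume "y \<in> pt x ` {h r..h x}"
  then obtain t where t: "y = pt x t" "h r \<le> t" "t \<le> h x" by auto
  then have "0 \<le> t" using h_nonneg[of r] by simp
  then have "y \<in> P x" "h y = t" using t pt assms by auto
  then show "y \<in> P x \<inter> D r"
    using P_iff_h[OF assms(1,2), of y] t P_in assms by (auto simp: D_def)
qed

lemma continuous_pt:
  assumes x: "x \<in> X"
  shows "continuous_map (top_of_set {0..h x}) mtopology (pt x)"
  unfolding continuous_map_to_metric
proof (intro ballI allI impI)
  fix t \<epsilon> :: real assume t: "t \<in> topspace (top_of_set {0..h x})" and \<epsilon>: "0 < \<epsilon>"
  have "openin (top_of_set {0..h x}) ({0..h x} \<inter> ball t \<epsilon>)"
    by (intro openin_open_Int) auto
  moreover have "pt x s \<in> mball (pt x t) \<epsilon>" if "s \<in> {0..h x} \<inter> ball t \<epsilon>" for s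
  proof -
    have "d (pt x t) (pt x s) = \<bar>t - s\<bar>"
      using dist_on_path[OF x] pt[OF x] t that by simp
    then show ?thesis
      using that t pt_in[OF x] P_in[OF x] by (auto simp: dist_real_def)
  qed
  ultimately show "\<exists>U. openin (top_of_set {0..h x}) U \<and> t \<in> U \<and> (\<forall>y\<in>U. pt x y \<in> mball (pt x t) \<epsilon>)"
    using t \<epsilon> by (intro exI[of _ "{0..h x} \<inter> ball t \<epsilon>"]) auto
qed

lemma compactin_path: "x \<in> X \<Longrightarrow> compactin mtopology (P x)"
  using image_compactin[OF _ continuous_pt, of _ "{0..h x}"] path_image
  by (simp add: compactin_subtopology)

lemma connectedin_segment:
  assumes "x \<in> X" "r \<in> P x"
  shows "connectedin mtopology (P x \<inter> D r)"
  unfolding segment_image[OF assms]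
  by (rule connectedin_continuous_map_image[OF continuous_pt[OF assms(1)]])
    (use h_nonneg[of r] in \<open>auto simp: connectedin_subtopology\<close>)

lemma path_measurable: "x \<in> X \<Longrightarrow> P x \<in> sets M"
  using down_closed_measurable[of "P x"] P_subset P_mono by blast

lemma D_measurable:
  shows "D r \<in> sets M"
proof -
  have "X - D r \<in> sets M"
  proof (rule down_closed_measurable)
    fix x assume "x \<in> X - D r"
    then show "P x \<subseteq> X - D r"
      unfolding D_def using P_mono[of x] P_subset[of x] by blast
  qed simp
  moreover have "D r = space M - (X - D r)" by (auto simp: D_def space_M)
  ultimately show ?thesis using sets.compl_sets by metis
qed

lemma h_measurable: "h \<in> borel_measurable M"
  unfolding borel_measurable_iff_le space_M
proof
  fix c show "{x \<in> X. h x \<le> c} \<in> sets M"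
    using h_mono P_in by (intro down_closed_measurable) (auto intro: order_trans)
qed

lemma D_refl: "r \<in> X \<Longrightarrow> r \<in> D r"
  using P_refl by (simp add: D_def)

end

locale weighted_tree = rooted_tree X d a P M
  for X :: "'a set" and d a P M +
  fixes w :: "'a \<Rightarrow> real"
  assumes w_measurable: "w \<in> borel_measurable M"
    and w_finite: "x \<in> X \<Longrightarrow> (\<integral>\<^sup>+y\<in>P x. ennreal (w y) \<partial>M) < top"
begin

definition W :: "'a set \<Rightarrow> ennreal" where "W A = (\<integral>\<^sup>+y\<in>A. ennreal (w y) \<partial>M)"

definition U :: "'a \<Rightarrow> real" where "U x = enn2real (W (P x))"

lemma W_P: "x \<in> X \<Longrightarrow> W (P x) = ennreal (U x)"
  using w_finite by (simp add: U_def W_def)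

lemma W_mono: "A \<subseteq> B \<Longrightarrow> W A \<le> W B"
  unfolding W_def by (intro nn_integral_mono) (auto split: split_indicator)

lemma W_null: "A \<in> null_sets M \<Longrightarrow> W A = 0"
  unfolding W_def by (rule nn_integral_null_set)

lemma W_Un: "A \<in> sets M \<Longrightarrow> B \<in> sets M \<Longrightarrow> A \<inter> B = {} \<Longrightarrow> W (A \<union> B) = W A + W B"
  unfolding W_def using w_measurable
  by (subst nn_integral_add[symmetric]) (auto intro!: nn_integral_cong split: split_indicator)

lemma U_nonneg: "0 \<le> U x"
  by (simp add: U_def)

lemma U_mono: "x \<in> X \<Longrightarrow> y \<in> P x \<Longrightarrow> U y \<le> U x"
  using W_mono[OF P_mono] W_P P_in U_nonneg by (metis ennreal_le_iff)

lemma U_root: "U a = 0"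
  using W_null[OF point_null[OF root_in]] by (simp add: U_def P_root)

text \<open>Along the path, \<open>U\<close> is the distribution function of the weight on
  \<open>P x\<close> pushed forward by the height. Each height occurs at most once on the path and
  points are null, so this measure has no atoms.\<close>

lemma continuous_U_pt:
  assumes x: "x \<in> X"
  shows "continuous_on {0..h x} (\<lambda>t. U (pt x t))"
proof -
  let ?f = "\<lambda>y. ennreal (w y) * indicator (P x) y"
  have f: "?f \<in> borel_measurable M"
    using w_measurable path_measurable[OF x] by auto
  define N where "N = distr (density M ?f) borel h"
  have hm: "h \<in> measurable (density M ?f) borel"
    using h_measurable by simp
  have em: "emeasure N A = W (P x \<inter> (h -` A \<inter> X))" if "A \<in> sets borel" for A
  proof -
    have "h -` A \<inter> space (density M ?f) \<in> sets M"
      using measurable_sets[OF h_measurable that] by simp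
    then show ?thesis
      unfolding N_def W_def using that f
      by (simp add: emeasure_distr[OF hm] emeasure_density space_M)
        (auto intro!: nn_integral_cong split: split_indicator)
  qed
  have "emeasure N (space N) \<le> W (P x)"
    using em[of UNIV] by (simp add: N_def W_mono)
  then have fin: "emeasure N (space N) < top"
    using w_finite[OF x] by (auto simp: W_def)
  have "finite_measure N"
    by (rule finite_measureI) (use fin in simp)
  then interpret finite_borel_measure N
    by (intro finite_borel_measure.intro) (simp_all add: finite_borel_measure_axioms_def N_def)
  have val: "cdf N t = U (pt x t)" if "t \<in> {0..h x}" for t
  proof -
    have "P x \<inter> (h -` {..t} \<inter> X) = P (pt x t)"
      using P_pt[OF x] that P_in[OF x] by auto
    then show ?thesis
      by (simp add: cdf_def measure_def em U_def)
  qed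
  have "isCont (cdf N) t" for t
  proof -
    have "P x \<inter> (h -` {t} \<inter> X) \<in> null_sets M"
    proof (cases "\<exists>y\<in>P x. h y = t")
      case True
      then obtain y where y: "y \<in> P x" "h y = t" by blast
      then have "P x \<inter> (h -` {t} \<inter> X) = {y}"
        using h_inj[OF x] P_in[OF x] by auto
      then show ?thesis using point_null P_in[OF x y(1)] by simp
    next
      case False
      then have "P x \<inter> (h -` {t} \<inter> X) = {}" by auto
      then show ?thesis by simp
    qed
    then have "emeasure N {t} = 0" using em[of "{t}"] W_null by simp
    then show ?thesis unfolding isCont_cdf by (simp add: measure_def)
  qed
  then have "continuous_on {0..h x} (cdf N)"
    by (simp add: continuous_at_imp_continuous_on)
  then show ?thesis
    by (rule continuous_on_eq) (use val in auto)
qed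

section \<open>Points where U takes a given value\<close>

lemma level_exists:
  assumes x: "x \<in> X" and c: "0 \<le> c" "c \<le> U x"
  defines "S \<equiv> {t \<in> {0..h x}. U (pt x t) = c}"
  shows "compact S \<and> S \<noteq> {}"
proof
  have "pt x 0 = a" "pt x (h x) = x"
    using pt_h[OF x root_P[OF x]] pt_h[OF x P_refl[OF x]] by (auto simp: h_root)
  then have "\<exists>t\<ge>0. t \<le> h x \<and> U (pt x t) = c"
    using c h_nonneg[of x] by (intro IVT' continuous_U_pt[OF x]) (auto simp: U_root)
  then show "S \<noteq> {}" by (auto simp: S_def)
  have "closed S"
    using continuous_closed_preimage[OF continuous_U_pt[OF x] closed_real_atLeastAtMost closed_singleton[of c]]
    by (simp add: S_def vimage_def Int_def)
  moreover have "bounded S"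
    by (rule bounded_subset[of "{0..h x}"]) (auto simp: S_def)
  ultimately show "compact S" by (simp add: compact_eq_bounded_closed)
qed

text \<open>\<open>U\<close> may be constant on parts of a path; the last clause selects the first
  point with the value \<open>c\<close>, which is unique on each root path.\<close>

definition is_root :: "real \<Rightarrow> 'a \<Rightarrow> bool" where
  "is_root c r \<longleftrightarrow> r \<in> X \<and> U r = c \<and> (\<forall>y\<in>P r. y \<noteq> r \<longrightarrow> U y < c)"

lemma root_exists:
  assumes x: "x \<in> X" and c: "0 < c" "c \<le> U x"
  shows "\<exists>r\<in>P x. is_root c r"
proof -
  let ?S = "{t \<in> {0..h x}. U (pt x t) = c}"
  have S: "compact ?S \<and> ?S \<noteq> {}" using level_exists[OF x] c by simp
  then obtain t where t: "t \<in> ?S" "\<And>s. s \<in> ?S \<Longrightarrow> t \<le> s"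
    using compact_attains_inf[of ?S] by blast
  have pt: "pt x t \<in> P x" "h (pt x t) = t" "pt x t \<in> X" using pt x t(1) P_in by auto
  have "U y < c" if y: "y \<in> P (pt x t)" "y \<noteq> pt x t" for y
  proof -
    have "y \<in> P x" "h y < t"
      using y pt P_mono[OF x pt(1)] h_strict_mono[OF pt(3)] by auto
    then have "h y \<notin> ?S" using t(2) by force
    then have "U y \<noteq> c"
      using \<open>h y < t\<close> pt_h[OF x \<open>y \<in> P x\<close>] t(1) h_nonneg[of y] by auto
    then show ?thesis
      using U_mono[OF pt(3) y(1)] t(1) by simp
  qed
  then show ?thesis
    using pt t(1) by (intro bexI[of _ "pt x t"]) (auto simp: is_root_def)
qed

lemma root_unique:
  assumes "x \<in> X" "r \<in> P x" "r' \<in> P x" "is_root c r" "is_root c r'"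
  shows "r = r'"
  using P_chain[OF assms(1-3)] assms(4,5) unfolding is_root_def by fastforce

lemma root_before:
  assumes x: "x \<in> X" and r: "r \<in> P x" "is_root c r" and y: "y \<in> P x" "c \<le> U y"
  shows "r \<in> P y"
  using P_chain[OF x r(1) y(1)] r(2) y P_refl[of y] P_in[OF x y(1)] unfolding is_root_def by fastforce

text \<open>In contrast to \<open>is_root\<close>, the last point with the value \<open>c\<close> is
  taken, so that its root path contains all points of the path where
  \<open>U \<le> c\<close>.\<close>

lemma sublevel_path:
  assumes x: "x \<in> X" and c: "0 \<le> c" "c \<le> U x"
  shows "\<exists>z\<in>P x. U z = c \<and> P x \<inter> {y. U y \<le> c} = P z"
proof -
  let ?S = "{t \<in> {0..h x}. U (pt x t) = c}"
  have S: "compact ?S \<and> ?S \<noteq> {}" using level_exists[OF x] c by simp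
  then obtain t where t: "t \<in> ?S" "\<And>s. s \<in> ?S \<Longrightarrow> s \<le> t"
    using compact_attains_sup[of ?S] by blast
  have pt: "pt x t \<in> P x" "h (pt x t) = t" "pt x t \<in> X" using pt x t(1) P_in by auto
  have "y \<in> P (pt x t) \<longleftrightarrow> U y \<le> c" if y: "y \<in> P x" for y
  proof
    assume "U y \<le> c"
    show "y \<in> P (pt x t)"
    proof (rule ccontr)
      assume n: "y \<notin> P (pt x t)"
      then have "pt x t \<in> P y" using P_chain[OF x y pt(1)] by blast
      then have "U y = c" using U_mono[of y "pt x t"] P_in[OF x y] t(1) \<open>U y \<le> c\<close> by auto
      then have "h y \<in> ?S" using pt_h[OF x y] h_mono[OF x y] h_nonneg by auto
      then have "h y \<le> t" using t(2) by blast
      then show False using n P_iff_h[OF x y pt(1)] pt(2) by simp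
    qed
  next
    assume "y \<in> P (pt x t)"
    then show "U y \<le> c" using U_mono[OF pt(3)] t(1) by auto
  qed
  then show ?thesis
    using pt t(1) P_mono[OF x pt(1)] by (intro bexI[of _ "pt x t"]) auto
qed

lemma W_sublevel:
  assumes "x \<in> X" "0 \<le> c"
  shows "W (P x \<inter> {y. U y \<le> c}) = ennreal (min (U x) c)"
proof (cases "c \<le> U x")
  case True
  then show ?thesis
    using sublevel_path[OF assms True] W_P P_in[OF assms(1)] by auto
next
  case False
  then have "P x \<inter> {y. U y \<le> c} = P x"
    using U_mono[OF assms(1)] by fastforce
  then show ?thesis using False W_P assms by simp
qed

lemma U_sublevel_measurable: "{x \<in> X. U x \<le> c} \<in> sets M"
  using U_mono P_in by (intro down_closed_measurable) (auto intro: order_trans)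

lemma W_superlevel:
  assumes x: "x \<in> X" and c: "0 \<le> c"
  shows "W (P x \<inter> {y. c < U y}) = ennreal (U x - min (U x) c)"
proof -
  have m: "P x \<inter> {y. U y \<le> c} \<in> sets M"
  proof -
    have "P x \<inter> {y. U y \<le> c} = P x \<inter> {y\<in>X. U y \<le> c}" using P_in[OF x] by auto
    then show ?thesis using path_measurable[OF x] U_sublevel_measurable by auto
  qed
  have eq: "P x \<inter> {y. c < U y} = P x - (P x \<inter> {y. U y \<le> c})" by auto
  have "ennreal (U x) = W (P x)" using W_P[OF x] by simp
  also have "\<dots> = W ((P x \<inter> {y. U y \<le> c}) \<union> (P x \<inter> {y. c < U y}))"
    by (rule arg_cong[of _ _ W]) auto
  also have "\<dots> = W (P x \<inter> {y. U y \<le> c}) + W (P x \<inter> {y. c < U y})"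
    using m path_measurable[OF x] eq by (intro W_Un) auto
  finally have s: "ennreal (U x) = ennreal (min (U x) c) + W (P x \<inter> {y. c < U y})"
    by (simp only: W_sublevel[OF assms])
  then have "W (P x \<inter> {y. c < U y}) = ennreal (U x) - ennreal (min (U x) c)"
    by simp
  also have "\<dots> = ennreal (U x - min (U x) c)"
    using U_nonneg c by (subst ennreal_minus) auto
  finally show ?thesis .
qed

text \<open>Continuity along root paths is enough, because finitely many root paths through
  \<open>x\<close> cover a neighbourhood.\<close>

lemma U_continuous:
  assumes x: "x \<in> X" and e: "0 < \<epsilon>"
  shows "\<exists>\<delta>>0. \<forall>y\<in>X. d x y < \<delta> \<longrightarrow> \<bar>U y - U x\<bar> < \<epsilon>"
proof -
  obtain \<delta>0 E where E: "\<delta>0 > 0" "finite E" "E \<subseteq> X" "\<And>q. q \<in> E \<Longrightarrow> x \<in> P q"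
    "\<And>y. y \<in> X \<Longrightarrow> d x y < \<delta>0 \<Longrightarrow> \<exists>q\<in>E. y \<in> P q"
    using P_neighbourhood[OF x] by blast
  have "\<exists>\<delta>>0. \<forall>y\<in>P q. d x y < \<delta> \<longrightarrow> \<bar>U y - U x\<bar> < \<epsilon>" if q: "q \<in> E" for q
  proof -
    have qX: "q \<in> X" and xq: "x \<in> P q" using q E by auto
    have "\<exists>\<delta>>0. \<forall>t\<in>{0..h q}. dist t (h x) < \<delta> \<longrightarrow> dist (U (pt q t)) (U (pt q (h x))) < \<epsilon>"
      using continuous_U_pt[OF qX] h_nonneg[of x] h_mono[OF qX xq] e
      unfolding continuous_on_iff by (meson atLeastAtMost_iff)
    then obtain \<delta> where \<delta>: "\<delta> > 0"
      "\<And>t. t \<in> {0..h q} \<Longrightarrow> dist t (h x) < \<delta> \<Longrightarrow> dist (U (pt q t)) (U (pt q (h x))) < \<epsilon>" by blast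
    have "\<bar>U y - U x\<bar> < \<epsilon>" if "y \<in> P q" "d x y < \<delta>" for y
      using \<delta>(2)[of "h y"] that dist_on_path[OF qX xq that(1)] pt_h[OF qX] xq h_mono[OF qX] h_nonneg
      by (auto simp: dist_real_def abs_minus_commute)
    then show ?thesis using \<delta>(1) by blast
  qed
  then obtain \<delta> where \<delta>: "\<And>q. q \<in> E \<Longrightarrow> \<delta> q > 0"
    "\<And>q y. q \<in> E \<Longrightarrow> y \<in> P q \<Longrightarrow> d x y < \<delta> q \<Longrightarrow> \<bar>U y - U x\<bar> < \<epsilon>"
    by metis
  let ?\<delta> = "Min (insert \<delta>0 (\<delta> ` E))"
  have "0 < ?\<delta>" using E(1,2) \<delta>(1) by (subst Min_gr_iff) auto
  moreover have "\<bar>U y - U x\<bar> < \<epsilon>" if y: "y \<in> X" "d x y < ?\<delta>" for y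
  proof -
    have le: "d x y < r" if "r \<in> insert \<delta>0 (\<delta> ` E)" for r
      using Min_le[OF _ that] E(2) y(2) by (meson finite.insertI finite_imageI less_le_trans)
    obtain q where "q \<in> E" "y \<in> P q" using E(5)[OF y(1) le] by blast
    then show ?thesis using \<delta>(2) le by blast
  qed
  ultimately show ?thesis by blast
qed

end

section \<open>Components of level sets\<close>

context weighted_tree
begin

definition level_set :: "real \<Rightarrow> real \<Rightarrow> 'a set" where
  "level_set c c' = {x \<in> X. c \<le> U x \<and> U x < c'}"

definition closed_level :: "real \<Rightarrow> real \<Rightarrow> 'a set" where
  "closed_level c c' = mtopology closure_of level_set c c'"

section \<open>Local comparability and the connected components\<close>

lemma comparable_nbhd:
  assumes "x \<in> X"
  shows "\<exists>\<delta>>0. \<forall>y\<in>X. d x y < \<delta> \<longrightarrow> x \<in> P y \<or> y \<in> P x"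
proof -
  obtain \<delta> E where E: "\<delta> > 0" "E \<subseteq> X" "\<And>q. q \<in> E \<Longrightarrow> x \<in> P q"
    "\<And>y. y \<in> X \<Longrightarrow> d x y < \<delta> \<Longrightarrow> \<exists>q\<in>E. y \<in> P q"
    using P_neighbourhood[OF assms] by blast
  have "x \<in> P y \<or> y \<in> P x" if y: "y \<in> X" "d x y < \<delta>" for y
  proof -
    obtain q where "q \<in> E" "y \<in> P q" using E(4)[OF y] by blast
    then show ?thesis using P_chain[of q x y] E by blast
  qed
  then show ?thesis using E(1) by blast
qed

lemma level_set_subset: "level_set c c' \<subseteq> closed_level c c'"
  unfolding closed_level_def by (rule closure_of_subset) (auto simp: level_set_def)

lemma closed_level_iff:
  "x \<in> closed_level c c' \<longleftrightarrow> x \<in> X \<and> (\<forall>r>0. \<exists>y\<in>level_set c c'. d x y < r)"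
  unfolding closed_level_def metric_closure_of by (auto simp: level_set_def)

lemma closed_level_X: "closed_level c c' \<subseteq> X"
  by (auto simp: closed_level_iff)

lemma closed_level_bounds:
  assumes "x \<in> closed_level c c'"
  shows "c \<le> U x" "U x \<le> c'"
proof -
  have x: "x \<in> X" using assms by (simp add: closed_level_iff)
  have near: "\<exists>y. c \<le> U y \<and> U y < c' \<and> \<bar>U y - U x\<bar> < \<epsilon>" if e: "0 < \<epsilon>" for \<epsilon>
  proof -
    obtain \<delta> where \<delta>: "\<delta> > 0" "\<And>y. y \<in> X \<Longrightarrow> d x y < \<delta> \<Longrightarrow> \<bar>U y - U x\<bar> < \<epsilon>"
      using U_continuous[OF x e] by blast
    obtain y where "y \<in> level_set c c'" "d x y < \<delta>"
      using assms \<delta>(1) unfolding closed_level_iff by blast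
    then show ?thesis using \<delta>(2)[of y] by (auto simp: level_set_def)
  qed
  show "c \<le> U x" using near[of "c - U x"] by (rule_tac ccontr) auto
  show "U x \<le> c'" using near[of "U x - c'"] by (rule_tac ccontr) auto
qed

text \<open>A point \<open>y\<close> beyond \<open>r\<close> and comparable with \<open>x\<close>
  would have \<open>r\<close> between \<open>x\<close> and itself, hence lie no closer to
  \<open>x\<close> than \<open>r\<close> does.\<close>

lemma closed_level_D_closed:
  assumes x: "x \<in> X" "x \<notin> D r" and r: "r \<in> X"
  shows "\<exists>\<delta>>0. \<forall>y\<in>X. d x y < \<delta> \<longrightarrow> y \<notin> D r"
proof -
  obtain \<delta> where \<delta>: "\<delta> > 0" "\<And>y. y \<in> X \<Longrightarrow> d x y < \<delta> \<Longrightarrow> x \<in> P y \<or> y \<in> P x"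
    using comparable_nbhd[OF x(1)] by blast
  have "x \<noteq> r" using x D_refl by auto
  then have pos: "0 < d x r" using x r by simp
  have "y \<notin> D r" if y: "y \<in> X" "d x y < min \<delta> (d x r)" for y
  proof
    assume "y \<in> D r"
    then have ry: "r \<in> P y" by (simp add: D_def)
    have "y \<notin> P x" using P_trans[OF x(1) _ ry] x by (auto simp: D_def)
    then have xy: "x \<in> P y" using \<delta>(2)[OF y(1)] y(2) by auto
    have "r \<notin> P x" using x by (simp add: D_def)
    then have "x \<in> P r" using P_chain[OF y(1) xy ry] by blast
    then have "d x r \<le> d x y"
      using h_dist[OF r, of x] h_dist[OF y(1) xy] h_mono[OF y(1) ry] by simp
    then show False using y(2) by simp
  qed
  then show ?thesis using \<delta>(1) pos by (intro exI[of _ "min \<delta> (d x r)"]) auto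
qed

text \<open>The restriction \<open>c \<le> U y\<close> excludes the points just before
  \<open>r\<close>, which are close to \<open>r\<close> but not beyond it.\<close>

lemma closed_level_D_open:
  assumes r: "is_root c r" and x: "x \<in> D r"
  shows "\<exists>\<delta>>0. \<forall>y\<in>X. d x y < \<delta> \<longrightarrow> c \<le> U y \<longrightarrow> y \<in> D r"
proof -
  have xX: "x \<in> X" and rx: "r \<in> P x" using x by (auto simp: D_def)
  obtain \<delta> where \<delta>: "\<delta> > 0" "\<And>y. y \<in> X \<Longrightarrow> d x y < \<delta> \<Longrightarrow> x \<in> P y \<or> y \<in> P x"
    using comparable_nbhd[OF xX] by blast
  have "y \<in> D r" if y: "y \<in> X" "d x y < \<delta>" "c \<le> U y" for y
    using \<delta>(2)[OF y(1,2)]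
  proof
    assume "x \<in> P y"
    then show ?thesis using P_trans[OF y(1) _ rx] y(1) by (simp add: D_def)
  next
    assume "y \<in> P x"
    then show ?thesis using root_before[OF xX rx r _ y(3)] y(1) by (simp add: D_def)
  qed
  then show ?thesis using \<delta>(1) by blast
qed

text \<open>\<open>D r\<close> is closed in the whole space, and it becomes open within the closed
  level because \<open>c \<le> U\<close> holds there.\<close>

lemma D_clopen:
  assumes r: "is_root c r"
  shows "openin (subtopology mtopology (closed_level c c')) (closed_level c c' \<inter> D r)"
    and "closedin (subtopology mtopology (closed_level c c')) (closed_level c c' \<inter> D r)"
proof -
  let ?Z = "closed_level c c'"
  have rX: "r \<in> X" using r by (simp add: is_root_def)
  define O1 where "O1 = \<Union>{mball x \<delta> |x \<delta>. x \<in> D r \<and> (\<forall>y\<in>X. d x y < \<delta> \<longrightarrow> c \<le> U y \<longrightarrow> y \<in> D r)}"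
  define O2 where "O2 = \<Union>{mball x \<delta> |x \<delta>. x \<in> X \<and> (\<forall>y\<in>X. d x y < \<delta> \<longrightarrow> y \<notin> D r)}"
  have "openin mtopology O1" "openin mtopology O2"
    unfolding O1_def O2_def by (rule openin_Union; auto)+
  moreover have "?Z \<inter> D r = ?Z \<inter> O1"
  proof (intro equalityI subsetI)
    fix x assume x: "x \<in> ?Z \<inter> D r"
    obtain \<delta> where "\<delta> > 0" "\<forall>y\<in>X. d x y < \<delta> \<longrightarrow> c \<le> U y \<longrightarrow> y \<in> D r"
      using closed_level_D_open[OF r, of x] x by blast
    moreover have "x \<in> X" using x by (auto simp: D_def)
    ultimately have "x \<in> O1"
      unfolding O1_def using x by (intro UnionI[of "mball x \<delta>"]) auto
    then show "x \<in> ?Z \<inter> O1" using x by blast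
  next
    fix x assume x: "x \<in> ?Z \<inter> O1"
    then show "x \<in> ?Z \<inter> D r"
      using closed_level_bounds(1)[of x c c'] by (auto simp: O1_def)
  qed
  moreover have "?Z - ?Z \<inter> D r = ?Z \<inter> O2"
  proof (intro equalityI subsetI)
    fix x assume x: "x \<in> ?Z - ?Z \<inter> D r"
    then have xX: "x \<in> X" using closed_level_X by blast
    obtain \<delta> where "\<delta> > 0" "\<forall>y\<in>X. d x y < \<delta> \<longrightarrow> y \<notin> D r"
      using closed_level_D_closed[OF xX _ rX] x by blast
    then have "x \<in> O2"
      unfolding O2_def using xX by (intro UnionI[of "mball x \<delta>"]) auto
    then show "x \<in> ?Z \<inter> O2" using x by blast
  next
    fix x assume x: "x \<in> ?Z \<inter> O2"
    then show "x \<in> ?Z - ?Z \<inter> D r" by (auto simp: O2_def)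
  qed
  ultimately show "openin (subtopology mtopology ?Z) (?Z \<inter> D r)"
    and "closedin (subtopology mtopology ?Z) (?Z \<inter> D r)"
    using closed_level_X[of c c'] unfolding closedin_def
    by (auto simp: openin_subtopology_alt topspace_subtopology image_iff inf_absorb2)
qed

text \<open>In the half-open level, each point beyond \<open>r\<close> is joined to \<open>r\<close>
  by a segment that stays in this level. By relative openness of \<open>D r\<close>, passing to the
  closed level adds only limits of such points.\<close>

lemma connectedin_closed_level_D:
  assumes r: "is_root c r"
  shows "connectedin mtopology (closed_level c c' \<inter> D r)"
proof (rule connectedin_intermediate_closure_of)
  let ?S = "level_set c c' \<inter> D r"
  show "?S \<subseteq> closed_level c c' \<inter> D r" using level_set_subset by blast
  have rX: "r \<in> X" and rU: "U r = c" using r by (auto simp: is_root_def)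
  show "connectedin mtopology ?S"
  proof (cases "?S = {}")
    case True
    then show ?thesis by simp
  next
    case False
    have eq: "?S = \<Union>{P x \<inter> D r |x. x \<in> ?S}"
    proof (intro equalityI subsetI)
      fix x assume "x \<in> ?S"
      then show "x \<in> \<Union>{P x \<inter> D r |x. x \<in> ?S}"
        using P_refl by (auto simp: level_set_def)
    next
      fix y assume "y \<in> \<Union>{P x \<inter> D r |x. x \<in> ?S}"
      then obtain x where x: "x \<in> ?S" "y \<in> P x" "y \<in> D r" by blast
      then have "x \<in> X" "y \<in> X" "r \<in> P y" by (auto simp: D_def)
      then show "y \<in> ?S"
        using x U_mono[of x y] U_mono[of y r] rU by (auto simp: level_set_def)
    qed
    have "connectedin mtopology (\<Union>{P x \<inter> D r |x. x \<in> ?S})"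
    proof (rule connectedin_Union)
      show "connectedin mtopology S" if "S \<in> {P x \<inter> D r |x. x \<in> ?S}" for S
        using that connectedin_segment by (auto simp: D_def)
      have "r \<in> S" if "S \<in> {P x \<inter> D r |x. x \<in> ?S}" for S
        using that D_refl[OF rX] by (auto simp: D_def)
      then show "\<Inter>{P x \<inter> D r |x. x \<in> ?S} \<noteq> {}" by blast
    qed
    then show ?thesis using arg_cong[OF eq, of "connectedin mtopology"] by blast
  qed
  show "closed_level c c' \<inter> D r \<subseteq> mtopology closure_of ?S"
  proof
    fix x assume x: "x \<in> closed_level c c' \<inter> D r"
    have xX: "x \<in> X" using x by (auto simp: D_def)
    obtain \<delta> where \<delta>: "\<delta> > 0" "\<And>y. y \<in> X \<Longrightarrow> d x y < \<delta> \<Longrightarrow> c \<le> U y \<Longrightarrow> y \<in> D r"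
      using closed_level_D_open[OF r, of x] x by blast
    have "\<exists>y\<in>?S. d x y < e" if "0 < e" for e
    proof -
      have "0 < min e \<delta>" using that \<delta> by simp
      then obtain y where "y \<in> level_set c c'" "d x y < min e \<delta>"
        using x closed_level_iff[of x c c'] by blast
      then show ?thesis using \<delta>(2)[of y] by (auto simp: level_set_def)
    qed
    then show "x \<in> mtopology closure_of ?S"
      unfolding metric_closure_of using xX by (fastforce simp: D_def)
  qed
qed

lemma component_of_closed_level:
  assumes r: "is_root c r" and x: "x \<in> closed_level c c'" "x \<in> D r"
  shows "connected_component_of_set (subtopology mtopology (closed_level c c')) x = closed_level c c' \<inter> D r"
proof
  let ?Z = "closed_level c c'"
  let ?T = "subtopology mtopology ?Z"
  show "?Z \<inter> D r \<subseteq> connected_component_of_set ?T x"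
    using connectedin_closed_level_D[OF r] x
    by (intro connected_component_of_maximal) (auto simp: connectedin_subtopology)
  show "connected_component_of_set ?T x \<subseteq> ?Z \<inter> D r"
  proof
    fix y assume "y \<in> connected_component_of_set ?T x"
    then obtain T where T: "connectedin ?T T" "x \<in> T" "y \<in> T"
      by (auto simp: connected_component_of_def)
    have "T \<subseteq> ?Z \<inter> D r \<or> disjnt T (?Z \<inter> D r)"
      using connectedin_clopen_cases[OF T(1) D_clopen(2)[OF r] D_clopen(1)[OF r]] by blast
    then show "y \<in> ?Z \<inter> D r" using T x by (auto simp: disjnt_iff)
  qed
qed

lemma components_closed_level:
  assumes c: "0 < c" and K: "K \<in> connected_components_of (subtopology mtopology (closed_level c c'))"
  shows "\<exists>r. is_root c r \<and> K = closed_level c c' \<inter> D r"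
proof -
  obtain x where x: "x \<in> closed_level c c'"
    "K = connected_component_of_set (subtopology mtopology (closed_level c c')) x"
    using K by (auto simp: connected_components_of_def)
  have xX: "x \<in> X" using x closed_level_X by blast
  obtain r where r: "r \<in> P x" "is_root c r"
    using root_exists[OF xX c closed_level_bounds(1)[OF x(1)]] by blast
  then show ?thesis
    using component_of_closed_level[OF r(2) x(1)] x(2) xX by (auto simp: D_def)
qed

lemma root_in_closed_level:
  assumes "is_root c r" "c < c'"
  shows "r \<in> closed_level c c'"
  using assms level_set_subset by (auto simp: is_root_def level_set_def)

lemma component_at_root:
  assumes "is_root c r" "c < c'"
  shows "closed_level c c' \<inter> D r \<in> connected_components_of (subtopology mtopology (closed_level c c'))"
  using component_of_closed_level[OF assms(1) root_in_closed_level[OF assms]] root_in_closed_level[OF assms]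
    D_refl[of r] assms(1) closed_level_X
  by (auto simp: connected_components_of_def is_root_def inf_absorb2 intro!: image_eqI[of _ _ r])

text \<open>
  Beyond such a point \<open>s\<close> one leaves \<open>closed_level c c'\<close> at once, since \<open>U \<ge> c'\<close> there.
\<close>

lemma exit_in_frontier:
  assumes r: "is_root c r" and s: "is_root c' s" and cc: "c < c'" and rs: "s \<in> D r"
    and x: "x \<in> X" "s \<in> P x" "x \<noteq> s"
  shows "s \<in> mtopology frontier_of (closed_level c c' \<inter> D r)"
proof -
  let ?K = "closed_level c c' \<inter> D r"
  have sX: "s \<in> X" and Us: "U s = c'" and Ub: "\<And>y. y \<in> P s \<Longrightarrow> y \<noteq> s \<Longrightarrow> U y < c'"
    using s by (auto simp: is_root_def)
  have rP: "r \<in> P s" using rs by (simp add: D_def)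
  have Ur: "U r = c" using r by (simp add: is_root_def)
  have "r \<noteq> s" using Ur Us cc by auto
  then have hr: "h r < h s" using h_strict_mono[OF sX rP] by simp
  have "\<exists>y\<in>level_set c c'. d s y < e" if e: "0 < e" for e
  proof -
    \<comment> \<open>A height shortly before \<open>s\<close> but not before \<open>r\<close>: the
      point there has a value of \<open>U\<close> in the half-open range.\<close>
    define t where "t = max (h r) (h s - e / 2)"
    have t: "0 \<le> t" "h r \<le> t" "t < h s" "h s - t < e"
      using hr e h_nonneg[of r] by (auto simp: t_def)
    define y where "y = pt s t"
    have y: "y \<in> P s" "h y = t" using pt[OF sX] t by (auto simp: y_def)
    then have "r \<in> P y" "y \<noteq> s" "y \<in> X"
      using P_iff_h[OF sX rP y(1)] t P_in[OF sX] by auto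
    then have "y \<in> level_set c c'"
      using Ub[OF y(1)] U_mono[of y r] Ur by (auto simp: level_set_def)
    moreover have "d s y < e"
      using h_dist[OF sX y(1)] y t commute[of s y] by simp
    ultimately show ?thesis by blast
  qed
  then have "s \<in> closed_level c c'" using sX by (simp add: closed_level_iff)
  then have sK: "s \<in> ?K" using rs by simp
  then have cl: "s \<in> mtopology closure_of ?K"
    using closure_of_subset[of ?K mtopology] closed_level_X by auto
  have "s \<notin> mtopology interior_of ?K"
  proof
    assume "s \<in> mtopology interior_of ?K"
    then obtain e where e: "e > 0" "mball s e \<subseteq> ?K" unfolding metric_interior_of by blast
    have hx: "h s < h x" using h_strict_mono[OF x(1,2)] x(3) by simp
    \<comment> \<open>A height shortly after \<open>s\<close>, on the way to
      \<open>x\<close>.\<close>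
    define t where "t = min (h x) (h s + e / 2)"
    have t: "h s < t" "t \<le> h x" "t - h s < e" "0 \<le> t"
      using hx e h_nonneg[of s] by (auto simp: t_def)
    define y where "y = pt x t"
    have y: "y \<in> P x" "h y = t" using pt[OF x(1)] t by (auto simp: y_def)
    have yX: "y \<in> X" using P_in x(1) y(1) by blast
    have sy: "s \<in> P y" using P_iff_h[OF x(1,2) y(1)] t y by simp
    have "d s y < e" using h_dist[OF yX sy] y t by simp
    then have "y \<in> closed_level c c'" using e sX yX by auto
    obtain \<delta> where \<delta>: "\<delta> > 0" "\<And>z. z \<in> X \<Longrightarrow> d y z < \<delta> \<Longrightarrow> y \<in> P z \<or> z \<in> P y"
      using comparable_nbhd[OF yX] by blast
    \<comment> \<open>\<open>U y = c'\<close> is no contradiction yet, since the level is a closure.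
      But a point \<open>z\<close> of the half-open level that is closer to \<open>y\<close> than
      \<open>s\<close> is lies beyond \<open>s\<close> too, where \<open>U\<close> is at least
      \<open>c'\<close>.\<close>
    have "0 < min \<delta> (h y - h s)" using \<delta> y t by simp
    then obtain z where z: "z \<in> level_set c c'" "d y z < min \<delta> (h y - h s)"
      using \<open>y \<in> closed_level c c'\<close> unfolding closed_level_iff by blast
    have zX: "z \<in> X" and Uz: "U z < c'" using z by (auto simp: level_set_def)
    have "s \<in> P z"
      using \<delta>(2)[OF zX]
    proof (rule disjE)
      show "d y z < \<delta>" using z by simp
      assume "y \<in> P z"
      then show ?thesis using P_trans[OF zX _ sy] by simp
    next
      assume zy: "z \<in> P y"
      then have "h s < h z" using h_dist[OF yX zy] z(2) commute[of y z] by simp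
      then show ?thesis using P_iff_h[OF yX sy zy] by simp
    qed
    then have "c' \<le> U z" using U_mono[OF zX] Us by auto
    then show False using Uz by simp
  qed
  then show ?thesis using cl by (simp add: frontier_of_def)
qed

end

section \<open>Test functions\<close>

locale hardy_tree = weighted_tree X d a P M "\<lambda>x. \<bar>u x\<bar> powr conj_exp p"
  for X :: "'a set" and d a P M and u :: "'a \<Rightarrow> real" and p :: real +
  fixes b :: nat
  assumes p_gt1: "1 < p"
    and u_measurable: "u \<in> borel_measurable M"
    and b_pos: "1 \<le> b"
begin

definition wt :: "'a \<Rightarrow> real" where "wt x = \<bar>u x\<bar> powr conj_exp p"

definition lev :: "int \<Rightarrow> real" where "lev k = 2 powr (of_int k * conj_exp p / p)"

definition branch_roots :: "int \<Rightarrow> 'a set" where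
  "branch_roots k = {r. is_root (lev k) r \<and> (\<exists>x\<in>X. r \<in> P x \<and> x \<noteq> r)}"

definition trunk :: "int \<Rightarrow> 'a set" where
  "trunk j = {x \<in> X. \<exists>y\<in>branch_roots j. x \<in> P y}"

text \<open>\<open>j\<close> is the index of the upper threshold: level \<open>k\<close> corresponds
  to \<open>j = k + 1\<close> and \<open>c = lev k\<close>.\<close>

definition piece :: "'a \<Rightarrow> int \<Rightarrow> real \<Rightarrow> 'a set" where
  "piece r j c = D r \<inter> trunk j \<inter> {x \<in> X. c < U x \<and> U x \<le> lev j}"

text \<open>The ratio \<open>lev k / lev (k + 2)\<close>, the same for all \<open>k\<close>. Scaling
  by it makes the weight crossed on level \<open>k + 2\<close> equal to that crossed on level
  \<open>k\<close>.\<close>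

definition \<theta> :: real where "\<theta> = 2 powr (- (2 * conj_exp p / p))"

text \<open>
  The image of \<open>bump (k, r)\<close> is constant on the level after \<open>k\<close> and, by the negative part, vanishes
  beyond level \<open>k + 3\<close>.  It lives on trunks only, since their weight is controlled by the number
  of branches.
\<close>

definition bump :: "int \<times> 'a \<Rightarrow> 'a \<Rightarrow> real" where
  "bump = (\<lambda>(k, r) x. (indicator (piece r (k + 1) (lev k)) x
      - \<theta> * indicator (piece r (k + 3) (lev (k + 2))) x)
      * (sgn (u x) * \<bar>u x\<bar> powr (conj_exp p - 1)))"

text \<open>The upper bound is not strict because the components to be measured belong to closures.
  The branching root on the path guarantees that the path crosses the positive piece of the bump
  completely.\<close>

definition target :: "int \<times> 'a \<Rightarrow> 'a set" where
  "target = (\<lambda>(k, r). {x \<in> D r. lev (k + 1) \<le> U x \<and> U x \<le> lev (k + 2) \<and>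
      (\<exists>y\<in>branch_roots (k + 1). y \<in> P x)})"

definition integral_to :: "('a \<Rightarrow> real) \<Rightarrow> 'a \<Rightarrow> real" where
  "integral_to f x = (LINT t:P x|M. f t * u t)"

lemma conj_gt1: "1 < conj_exp p"
  using p_gt1 by (simp add: conj_exp_def field_simps)

lemma conj_facts: "(conj_exp p - 1) * p = conj_exp p" "conj_exp p / p * (p - 1) = 1"
  using p_gt1 by (auto simp: conj_exp_def field_simps)

lemma lev_pos: "0 < lev k"
  by (simp add: lev_def)

lemma lev_add: "lev (k + j) = lev k * 2 powr (of_int j * conj_exp p / p)"
  by (simp add: lev_def powr_add[symmetric] distrib_right add_divide_distrib)

lemma lev_mono: "k \<le> k' \<Longrightarrow> lev k \<le> lev k'"
  using p_gt1 conj_gt1 unfolding lev_def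
  by (intro powr_mono divide_right_mono mult_right_mono) auto

lemma lev_less: "k < k' \<Longrightarrow> lev k < lev k'"
  using p_gt1 conj_gt1 unfolding lev_def
  by (intro powr_less_mono divide_strict_right_mono mult_strict_right_mono) auto

lemma theta_pos: "0 < \<theta>" and theta_le: "\<theta> \<le> 1"
  using p_gt1 conj_gt1 powr_mono[of "- (2 * conj_exp p / p)" 0 2] by (auto simp: \<theta>_def)

lemma theta_lev: "\<theta> * lev (k + 2) = lev k"
  unfolding lev_add \<theta>_def by (simp add: powr_minus field_simps)

lemma theta_diff: "\<theta> * (lev (k + 3) - lev (k + 2)) = lev (k + 1) - lev k"
  using theta_lev[of k] theta_lev[of "k + 1"] by (simp add: algebra_simps)

lemma branch_rootsD:
  assumes "r \<in> branch_roots k"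
  shows "is_root (lev k) r" "r \<in> X" "U r = lev k"
  using assms by (auto simp: branch_roots_def is_root_def)

lemma branch_root_exists:
  assumes "x \<in> X" "lev k < U x"
  shows "\<exists>r\<in>branch_roots k. r \<in> P x"
proof -
  obtain r where r: "r \<in> P x" "is_root (lev k) r"
    using root_exists[OF assms(1) lev_pos, of k] assms by auto
  then have "x \<noteq> r" using assms by (auto simp: is_root_def)
  then show ?thesis
    using r assms(1) unfolding branch_roots_def by blast
qed

section \<open>Integrals of the test functions along root paths\<close>

lemma piece_measurable: "piece r j c \<in> sets M"
proof -
  have "trunk j \<in> sets M"
  proof (rule down_closed_measurable)
    show "trunk j \<subseteq> X" by (auto simp: trunk_def)
    fix x assume "x \<in> trunk j"
    then show "P x \<subseteq> trunk j"
      using P_in P_trans branch_rootsD(2) unfolding trunk_def by blast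
  qed
  moreover have "{x \<in> X. c < U x \<and> U x \<le> lev j} = {x \<in> X. U x \<le> lev j} - {x \<in> X. U x \<le> c}"
    by auto
  ultimately show ?thesis
    using U_sublevel_measurable D_measurable unfolding piece_def by simp
qed

lemma target_measurable: "target \<kappa> \<in> sets M"
proof -
  obtain k r where \<kappa>: "\<kappa> = (k, r)" by (cases \<kappa>)
  have less: "{x \<in> X. U x < c} \<in> sets M" for c
  proof (rule down_closed_measurable)
    fix x assume "x \<in> {x \<in> X. U x < c}"
    then show "P x \<subseteq> {x \<in> X. U x < c}"
      using P_in U_mono le_less_trans by blast
  qed simp
  have up: "{x \<in> X. \<exists>y\<in>branch_roots (k + 1). y \<in> P x} \<in> sets M"
  proof -
    have "{x \<in> X. \<forall>y\<in>branch_roots (k + 1). y \<notin> P x} \<in> sets M"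
    proof (rule down_closed_measurable)
      fix x assume "x \<in> {x \<in> X. \<forall>y\<in>branch_roots (k + 1). y \<notin> P x}"
      then have x: "x \<in> X" "\<And>y. y \<in> branch_roots (k + 1) \<Longrightarrow> y \<notin> P x" by auto
      show "P x \<subseteq> {x \<in> X. \<forall>y\<in>branch_roots (k + 1). y \<notin> P x}"
      proof
        fix z assume z: "z \<in> P x"
        show "z \<in> {x \<in> X. \<forall>y\<in>branch_roots (k + 1). y \<notin> P x}"
          using P_in[OF x(1) z] x(2) P_trans[OF x(1) z] by auto
      qed
    qed simp
    moreover have "{x \<in> X. \<exists>y\<in>branch_roots (k + 1). y \<in> P x}
        = space M - {x \<in> X. \<forall>y\<in>branch_roots (k + 1). y \<notin> P x}"
      by (auto simp: space_M)
    ultimately show ?thesis using sets.compl_sets by (simp only:)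
  qed
  have "target \<kappa> = D r \<inter> ({x \<in> X. U x \<le> lev (k + 2)} - {x \<in> X. U x < lev (k + 1)})
      \<inter> {x \<in> X. \<exists>y\<in>branch_roots (k + 1). y \<in> P x}"
    by (auto simp: target_def \<kappa> D_def)
  then show ?thesis
    using less up D_measurable U_sublevel_measurable by simp
qed

text \<open>The path meets the piece exactly in the part of \<open>P q\<close> with
  \<open>c < U\<close>: strictly beyond \<open>q\<close> it cannot belong to the trunk of another
  root of the same threshold, since such roots are unique on a path. So the weight does not depend
  on \<open>x\<close>.\<close>

lemma W_piece:
  assumes x: "x \<in> X" and q: "q \<in> branch_roots j" "q \<in> P x" and r: "r \<in> P x" "U r \<le> c"
    and c: "0 \<le> c" "c \<le> lev j"
  shows "W (P x \<inter> piece r j c) = ennreal (lev j - c)"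
proof -
  note qD = branch_rootsD[OF q(1)]
  have "P x \<inter> piece r j c = P q \<inter> {y. c < U y}"
  proof (intro equalityI subsetI)
    fix y assume "y \<in> P x \<inter> piece r j c"
    then have y: "y \<in> P x" "c < U y" "y \<in> trunk j" by (auto simp: piece_def)
    then obtain z where z: "z \<in> branch_roots j" "y \<in> P z" by (auto simp: trunk_def)
    note zD = branch_rootsD[OF z(1)]
    have "y \<in> P q"
      using P_chain[OF x y(1) q(2)]
    proof
      assume "q \<in> P y"
      then have "q \<in> P z" using P_trans[OF zD(2) z(2)] by simp
      then have "q = z"
        using root_unique[OF zD(2) _ P_refl[OF zD(2)] qD(1) zD(1)] by simp
      then show ?thesis using z by simp
    qed
    then show "y \<in> P q \<inter> {y. c < U y}" using y by simp
  next
    fix y assume y: "y \<in> P q \<inter> {y. c < U y}"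
    then have yx: "y \<in> P x" and yX: "y \<in> X" using P_trans[OF x q(2)] P_in[OF qD(2)] by auto
    have "r \<in> P y"
      using P_chain[OF x r(1) yx] U_mono[of r y] P_in[OF x r(1)] r y by fastforce
    then show "y \<in> P x \<inter> piece r j c"
      using yx yX y q U_mono[OF qD(2), of y] qD(3) by (auto simp: piece_def D_def trunk_def)
  qed
  then show ?thesis
    using W_superlevel[OF qD(2) c(1)] qD(3) c by (simp add: min_absorb2)
qed

lemma W_emeasure: "A \<in> sets M \<Longrightarrow> W A = emeasure (density M (\<lambda>x. ennreal (wt x))) A"
  unfolding W_def wt_def using w_measurable by (subst emeasure_density) auto

text \<open>The product of the profile and \<open>u\<close> is the weight, which is finite on root
  paths; this gives integrability and lets \<open>W\<close> be read as a real number.\<close>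

lemma integral_to_bump:
  assumes x: "x \<in> X"
  shows "set_integrable M (P x) (\<lambda>t. bump (k, r) t * u t)"
    and "integral_to (bump (k, r)) x = enn2real (W (P x \<inter> piece r (k + 1) (lev k)))
      - \<theta> * enn2real (W (P x \<inter> piece r (k + 3) (lev (k + 2))))"
proof -
  have I: "has_bochner_integral M (\<lambda>t. indicator (P x \<inter> A) t * wt t) (enn2real (W (P x \<inter> A)))"
    if A: "A \<in> sets M" for A
  proof (rule has_bochner_integral_nn_integral)
    show "(\<lambda>t. indicator (P x \<inter> A) t * wt t) \<in> borel_measurable M"
      using A path_measurable[OF x] w_measurable unfolding wt_def by auto
    have "W (P x \<inter> A) \<le> W (P x)" by (rule W_mono) simp
    then have "W (P x \<inter> A) < top" using w_finite[OF x] by (simp add: W_def)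
    then have "ennreal (enn2real (W (P x \<inter> A))) = W (P x \<inter> A)" by simp
    also have "\<dots> = (\<integral>\<^sup>+ t. ennreal (indicator (P x \<inter> A) t * wt t) \<partial>M)"
      unfolding W_def wt_def by (intro nn_integral_cong) (auto split: split_indicator)
    finally show "(\<integral>\<^sup>+ t. ennreal (indicator (P x \<inter> A) t * wt t) \<partial>M) = ennreal (enn2real (W (P x \<inter> A)))"
      by simp
  qed (auto simp: wt_def)
  let ?A = "piece r (k + 1) (lev k)" and ?B = "piece r (k + 3) (lev (k + 2))"
  have uu: "sgn (u t) * \<bar>u t\<bar> powr (conj_exp p - 1) * u t = wt t" for t
  proof (cases "u t = 0")
    case False
    have "sgn (u t) * u t = \<bar>u t\<bar>" by (simp add: sgn_if)
    then have "sgn (u t) * \<bar>u t\<bar> powr (conj_exp p - 1) * u t = \<bar>u t\<bar> powr (conj_exp p - 1) * \<bar>u t\<bar> powr 1"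
      using False by (simp add: mult_ac)
    also have "\<dots> = wt t" unfolding powr_add[symmetric] wt_def by simp
    finally show ?thesis .
  qed (simp add: wt_def)
  have eq: "indicator (P x) t *\<^sub>R (bump (k, r) t * u t)
      = indicator (P x \<inter> ?A) t * wt t - \<theta> * (indicator (P x \<inter> ?B) t * wt t)" for t
    unfolding bump_def uu[symmetric] by (auto split: split_indicator simp: algebra_simps)
  have "has_bochner_integral M (\<lambda>t. indicator (P x) t *\<^sub>R (bump (k, r) t * u t))
      (enn2real (W (P x \<inter> ?A)) - \<theta> * enn2real (W (P x \<inter> ?B)))"
    unfolding eq
    by (intro has_bochner_integral_diff has_bochner_integral_mult_right I piece_measurable)
  then show "set_integrable M (P x) (\<lambda>t. bump (k, r) t * u t)"
    and "integral_to (bump (k, r)) x = enn2real (W (P x \<inter> ?A)) - \<theta> * enn2real (W (P x \<inter> ?B))"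
    unfolding set_integrable_def integral_to_def set_lebesgue_integral_def
    by (auto simp: has_bochner_integral_iff)
qed

lemma path_piece_empty:
  assumes "x \<in> X" "U x \<le> c"
  shows "P x \<inter> piece r j c = {}"
  using U_mono[OF assms(1)] assms(2) unfolding piece_def by fastforce

lemma path_D_empty:
  assumes "x \<in> X" "r \<notin> P x"
  shows "P x \<inter> piece r j c = {}"
  using P_trans[OF assms(1)] assms(2) unfolding piece_def D_def by blast

text \<open>The path crosses the positive piece completely and ends before the negative piece
  begins.\<close>

lemma integral_to_bump_target:
  assumes r: "r \<in> branch_roots k" and x: "x \<in> target (k, r)"
  shows "integral_to (bump (k, r)) x = lev (k + 1) - lev k"
proof -
  from x obtain q where q: "q \<in> branch_roots (k + 1)" "q \<in> P x" and xD: "x \<in> X" "r \<in> P x" "U x \<le> lev (k + 2)"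
    by (auto simp: target_def D_def)
  have "W (P x \<inter> piece r (k + 1) (lev k)) = ennreal (lev (k + 1) - lev k)"
    using W_piece[OF xD(1) q xD(2)] branch_rootsD(3)[OF r] lev_pos[of k] lev_mono[of k "k + 1"] by simp
  then show ?thesis
    using integral_to_bump(2)[OF xD(1), of k r] path_piece_empty[OF xD(1,3), of r "k + 3"]
      lev_mono[of k "k + 1"] W_null[of "{}"] by simp
qed

lemma mod3_gap:
  assumes "(k::int) mod 3 = k' mod 3" "k \<noteq> k'"
  shows "k + 3 \<le> k' \<or> k' + 3 \<le> k"
  using assms by presburger

text \<open>On the path to \<open>x\<close>, a bump of the same level has another root and is not
  met, and one of a later level is not yet reached. One of an earlier level is crossed together with
  its negative part, and \<open>theta_diff\<close> gives 0. The spacing by 3 puts \<open>x\<close>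
  strictly past the threshold \<open>lev (k' + 3)\<close>.\<close>

lemma integral_to_bump_other:
  assumes r: "r \<in> branch_roots k" and r': "r' \<in> branch_roots k'" and ne: "(k', r') \<noteq> (k, r)"
    and md: "k' mod 3 = k mod 3" and x: "x \<in> target (k, r)"
  shows "integral_to (bump (k', r')) x = 0"
proof -
  from x have xD: "x \<in> X" "r \<in> P x" "U x \<le> lev (k + 2)" "lev (k + 1) \<le> U x"
    by (auto simp: target_def D_def)
  note B = integral_to_bump(2)[OF xD(1), of k' r']
  consider "k' = k" | "k + 3 \<le> k'" | "k' + 3 \<le> k" using mod3_gap[OF md] by linarith
  then show ?thesis
  proof cases
    case 1
    then have "r' \<notin> P x"
      using root_unique[OF xD(1,2)] branch_rootsD(1) r r' ne by blast
    then show ?thesis using B path_D_empty[OF xD(1)] W_null[of "{}"] by simp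
  next
    case 2
    then have "U x \<le> lev k'" "U x \<le> lev (k' + 2)"
      using xD(3) lev_mono[of "k + 2" k'] lev_mono[of "k + 2" "k' + 2"] by auto
    then show ?thesis using B path_piece_empty[OF xD(1)] W_null[of "{}"] by simp
  next
    case 3
    show ?thesis
    proof (cases "r' \<in> P x")
      case False
      then show ?thesis using B path_D_empty[OF xD(1)] W_null[of "{}"] by simp
    next
      case True
      have big: "lev (k' + 1) < U x" "lev (k' + 3) < U x"
        using 3 xD(4) lev_less[of "k' + 1" "k + 1"] lev_less[of "k' + 3" "k + 1"] by auto
      obtain q1 q3 where q: "q1 \<in> branch_roots (k' + 1)" "q1 \<in> P x" "q3 \<in> branch_roots (k' + 3)" "q3 \<in> P x"
        using branch_root_exists[OF xD(1) big(1)] branch_root_exists[OF xD(1) big(2)] by blast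
      have "W (P x \<inter> piece r' (k' + 1) (lev k')) = ennreal (lev (k' + 1) - lev k')"
        using W_piece[OF xD(1) q(1,2) True] branch_rootsD(3)[OF r'] lev_pos[of k'] lev_mono[of k' "k' + 1"]
        by simp
      moreover have "W (P x \<inter> piece r' (k' + 3) (lev (k' + 2))) = ennreal (lev (k' + 3) - lev (k' + 2))"
        using W_piece[OF xD(1) q(3,4) True] branch_rootsD(3)[OF r'] lev_pos[of "k' + 2"]
          lev_mono[of "k' + 2" "k' + 3"] lev_mono[of k' "k' + 2"]
        by simp
      ultimately show ?thesis
        using B theta_diff[of k'] lev_mono[of k' "k' + 1"] lev_mono[of "k' + 2" "k' + 3"] by simp
    qed
  qed
qed

lemma bump_support:
  assumes "bump (k, r) x \<noteq> 0"
  shows "x \<in> X" "r \<in> P x" "lev k < U x" "U x \<le> lev (k + 3)"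
proof -
  have "x \<in> piece r (k + 1) (lev k) \<or> x \<in> piece r (k + 3) (lev (k + 2))"
    using assms by (auto simp: bump_def split: split_indicator_asm)
  then show "x \<in> X" "r \<in> P x" "lev k < U x" "U x \<le> lev (k + 3)"
    using lev_mono[of k "k + 2"] lev_mono[of "k + 1" "k + 3"] by (auto simp: piece_def D_def)
qed

text \<open>Bumps live where \<open>lev k < U \<le> lev (k + 3)\<close>. These half-open ranges are
  disjoint for levels at distance at least 3, and on one level a path has only one root.\<close>

lemma bump_disjoint:
  assumes r: "r \<in> branch_roots k" and r': "r' \<in> branch_roots k'" and md: "k' mod 3 = k mod 3"
    and nz: "bump (k, r) x \<noteq> 0" "bump (k', r') x \<noteq> 0"
  shows "(k', r') = (k, r)"
proof -
  note S = bump_support[OF nz(1)] bump_support[OF nz(2)]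
  have "\<not> k + 3 \<le> k'" "\<not> k' + 3 \<le> k"
    using S lev_mono[of "k + 3" k'] lev_mono[of "k' + 3" k] by auto
  then have "k' = k" using mod3_gap[OF md] by auto
  moreover from this have "r' = r"
    using root_unique[OF S(1) S(6) S(2)] branch_rootsD(1) r r' by blast
  ultimately show ?thesis by simp
qed

lemma bump_measurable: "bump \<kappa> \<in> borel_measurable M"
proof (cases \<kappa>)
  case (Pair k r)
  then show ?thesis
    unfolding bump_def using u_measurable piece_measurable by auto
qed

end

section \<open>Norms of the test functions under bounded branching\<close>

locale branching_hardy_tree = hardy_tree +
  assumes branching: "\<And>k r. r \<in> branch_roots k \<Longrightarrow>
    finite (branch_roots (k + 1) \<inter> D r) \<and> card (branch_roots (k + 1) \<inter> D r) \<le> b"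
begin

text \<open>A root is reached only through a branching root of the previous threshold, so the count
  grows by a factor of at most \<open>b\<close> per level.\<close>

lemma card_branch_roots:
  assumes r: "r \<in> branch_roots k"
  shows "finite (branch_roots (k + int m) \<inter> D r) \<and> card (branch_roots (k + int m) \<inter> D r) \<le> b ^ m"
proof (induction m)
  case 0
  have "branch_roots k \<inter> D r \<subseteq> {r}"
  proof
    fix y assume "y \<in> branch_roots k \<inter> D r"
    then show "y \<in> {r}"
      using root_unique[of y r y "lev k"] P_refl branch_rootsD r by (auto simp: D_def)
  qed
  then show ?case
    using finite_subset card_mono[of "{r}" "branch_roots k \<inter> D r"] by auto
next
  case (Suc m)
  let ?B = "branch_roots (k + int m) \<inter> D r"
  have sub: "branch_roots (k + int (Suc m)) \<inter> D r \<subseteq> (\<Union>y\<in>?B. branch_roots (k + int m + 1) \<inter> D y)"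
  proof
    fix z assume z: "z \<in> branch_roots (k + int (Suc m)) \<inter> D r"
    then have zX: "z \<in> X" and zU: "U z = lev (k + int (Suc m))" and rz: "r \<in> P z"
      using branch_rootsD by (auto simp: D_def)
    have "lev (k + int m) < U z" using zU lev_less[of "k + int m" "k + int (Suc m)"] by simp
    then obtain y where y: "y \<in> branch_roots (k + int m)" "y \<in> P z"
      using branch_root_exists[OF zX] by blast
    have "r \<in> P y"
      using root_before[OF zX rz branch_rootsD(1)[OF r] y(2)] branch_rootsD(3)[OF y(1)]
        lev_mono[of k "k + int m"] by simp
    then have "y \<in> ?B" using y branch_rootsD(2) by (auto simp: D_def)
    moreover have "z \<in> branch_roots (k + int m + 1) \<inter> D y"
      using z y zX by (auto simp: D_def algebra_simps)
    ultimately show "z \<in> (\<Union>y\<in>?B. branch_roots (k + int m + 1) \<inter> D y)" by blast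
  qed
  have fin: "finite (\<Union>y\<in>?B. branch_roots (k + int m + 1) \<inter> D y)"
    using Suc branching by blast
  have "card (\<Union>y\<in>?B. branch_roots (k + int m + 1) \<inter> D y)
      \<le> (\<Sum>y\<in>?B. card (branch_roots (k + int m + 1) \<inter> D y))"
    using Suc by (intro card_UN_le) auto
  also have "\<dots> \<le> (\<Sum>y\<in>?B. b)" by (intro sum_mono) (use branching in blast)
  also have "\<dots> \<le> b ^ m * b" using Suc by simp
  finally show ?case
    using card_mono[OF fin sub] finite_subset[OF sub fin] by (simp add: mult.commute)
qed

text \<open>The piece is covered by the root paths to at most \<open>b ^ m\<close> branching roots.
  Each path has the weight \<open>lev (k + m)\<close>, counted generously from \<open>a\<close> and
  not from \<open>r\<close>.\<close>

lemma W_piece_le: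
  assumes r: "r \<in> branch_roots k"
  shows "W (piece r (k + int m) c) \<le> ennreal (real (b ^ m) * lev (k + int m))"
proof -
  let ?B = "branch_roots (k + int m) \<inter> D r"
  have fin: "finite ?B" "card ?B \<le> b ^ m" using card_branch_roots[OF r] by auto
  have BX: "?B \<subseteq> X" using branch_rootsD by auto
  have "piece r (k + int m) c \<subseteq> (\<Union>y\<in>?B. P y)"
  proof
    fix x assume "x \<in> piece r (k + int m) c"
    then obtain y where y: "y \<in> branch_roots (k + int m)" "x \<in> P y" "r \<in> P x"
      by (auto simp: piece_def trunk_def D_def)
    then have "y \<in> D r"
      using P_trans branch_rootsD(2) by (auto simp: D_def)
    then show "x \<in> (\<Union>y\<in>?B. P y)" using y by blast
  qed
  then have "W (piece r (k + int m) c) \<le> W (\<Union>y\<in>?B. P y)" by (rule W_mono)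
  also have "\<dots> = emeasure (density M (\<lambda>x. ennreal (wt x))) (\<Union>y\<in>?B. P y)"
    using fin BX path_measurable by (intro W_emeasure sets.finite_UN) auto
  also have "\<dots> \<le> (\<Sum>y\<in>?B. emeasure (density M (\<lambda>x. ennreal (wt x))) (P y))"
    using fin BX path_measurable by (intro emeasure_subadditive_finite) auto
  also have "\<dots> = (\<Sum>y\<in>?B. ennreal (lev (k + int m)))"
  proof (rule sum.cong[OF refl])
    fix y assume "y \<in> ?B"
    then have "y \<in> X" "U y = lev (k + int m)" using branch_rootsD by auto
    then show "emeasure (density M (\<lambda>x. ennreal (wt x))) (P y) = ennreal (lev (k + int m))"
      using W_emeasure[OF path_measurable] W_P by metis
  qed
  also have "\<dots> = ennreal (real (card ?B) * lev (k + int m))"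
    using lev_pos[of "k + int m"] by (simp add: ennreal_mult ennreal_of_nat_eq_real_of_nat)
  also have "\<dots> \<le> ennreal (real (b ^ m) * lev (k + int m))"
    using fin lev_pos[of "k + int m"] by (intro ennreal_leI mult_right_mono) (auto simp: of_nat_le_iff simp del: of_nat_power)
  finally show ?thesis .
qed

text \<open>The first summand bounds the positive piece, one generation of roots away; the second
  bounds the negative piece, three generations away, where
  \<open>lev (k + 3) = lev (k + 1) / \<theta>\<close>.\<close>

definition bump_const :: real where
  "bump_const = real b + real (b ^ 3) / \<theta>"

lemma bump_const_pos: "0 < bump_const"
  using b_pos theta_pos by (auto simp: bump_const_def intro!: add_pos_nonneg)

text \<open>Since \<open>(p' - 1) * p = p'\<close>, the \<open>p\<close>-th power of the profile is
  the weight; the two pieces are disjoint and \<open>\<theta> \<le> 1\<close>.\<close>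

lemma nn_integral_bump:
  assumes r: "r \<in> branch_roots k"
  shows "(\<integral>\<^sup>+x. ennreal (\<bar>bump (k, r) x\<bar> powr p) \<partial>M) \<le> ennreal (bump_const * lev (k + 1))"
proof -
  let ?A = "piece r (k + 1) (lev k)" and ?B = "piece r (k + 3) (lev (k + 2))"
  have pt: "ennreal (\<bar>bump (k, r) x\<bar> powr p) \<le> ennreal (wt x) * indicator ?A x + ennreal (wt x) * indicator ?B x" for x
  proof -
    let ?g = "sgn (u x) * \<bar>u x\<bar> powr (conj_exp p - 1)"
    have g: "\<bar>?g\<bar> powr p \<le> wt x"
    proof (cases "u x = 0")
      case False
      then have "\<bar>?g\<bar> powr p = \<bar>u x\<bar> powr ((conj_exp p - 1) * p)"
        by (simp add: abs_mult powr_powr abs_sgn_eq)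
      then show ?thesis by (simp add: conj_facts wt_def)
    qed (use p_gt1 in \<open>simp add: wt_def\<close>)
    have "x \<notin> ?A \<or> x \<notin> ?B"
      using lev_mono[of "k + 1" "k + 2"] by (auto simp: piece_def)
    then consider "x \<in> ?A" "x \<notin> ?B" | "x \<notin> ?A" "x \<in> ?B" | "x \<notin> ?A" "x \<notin> ?B" by blast
    then show ?thesis
    proof cases
      case 1
      then show ?thesis using g by (simp add: bump_def ennreal_leI)
    next
      case 2
      have "\<bar>\<theta> * ?g\<bar> \<le> \<bar>?g\<bar>"
        unfolding abs_mult using theta_pos theta_le by (intro mult_left_le_one_le) auto
      then have "\<bar>\<theta> * ?g\<bar> powr p \<le> \<bar>?g\<bar> powr p"
        using p_gt1 by (intro powr_mono2) auto
      then show ?thesis using g 2 by (simp add: bump_def ennreal_leI)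
    next
      case 3
      then show ?thesis using p_gt1 by (simp add: bump_def)
    qed
  qed
  have "(\<integral>\<^sup>+x. ennreal (\<bar>bump (k, r) x\<bar> powr p) \<partial>M)
      \<le> (\<integral>\<^sup>+x. ennreal (wt x) * indicator ?A x + ennreal (wt x) * indicator ?B x \<partial>M)"
    by (rule nn_integral_mono) (rule pt)
  also have "\<dots> = W ?A + W ?B"
    unfolding W_def wt_def using w_measurable piece_measurable by (intro nn_integral_add) auto
  also have "\<dots> \<le> ennreal (real b * lev (k + 1)) + ennreal (real (b ^ 3) * lev (k + 3))"
    using W_piece_le[OF r, of 1 "lev k"] W_piece_le[OF r, of 3 "lev (k + 2)"]
    by (intro add_mono) simp_all
  also have "\<dots> = ennreal (bump_const * lev (k + 1))"
  proof -
    have "lev (k + 3) = lev (k + 1) / \<theta>"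
      using theta_lev[of "k + 1"] theta_pos by (simp add: field_simps)
    then show ?thesis
      using lev_pos[of "k + 1"] theta_pos
      by (subst ennreal_plus[symmetric]) (auto simp: bump_const_def algebra_simps)
  qed
  finally show ?thesis .
qed

definition clusters :: "(int \<times> 'a) set" where
  "clusters = {(k, r). r \<in> branch_roots k}"

definition gap :: "int \<times> 'a \<Rightarrow> real" where
  "gap \<kappa> = lev (fst \<kappa> + 1) - lev (fst \<kappa>)"

definition norm_bound :: "int \<times> 'a \<Rightarrow> real" where
  "norm_bound \<kappa> = bump_const * lev (fst \<kappa> + 1)"

lemma gap_pos: "0 < gap \<kappa>"
  using lev_less[of "fst \<kappa>" "fst \<kappa> + 1"] by (simp add: gap_def)

lemma norm_bound_pos: "0 < norm_bound \<kappa>"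
  using bump_const_pos lev_pos by (simp add: norm_bound_def)

section \<open>Lower bounds for the approximation numbers\<close>

lemma integral_to_sum:
  assumes x: "x \<in> X" and J: "finite J"
  shows "integral_to (\<lambda>y. \<Sum>\<kappa>\<in>J. c \<kappa> * bump \<kappa> y) x = (\<Sum>\<kappa>\<in>J. c \<kappa> * integral_to (bump \<kappa>) x)"
proof -
  have I: "integrable M (\<lambda>t. indicator (P x) t *\<^sub>R (bump \<kappa> t * u t))" for \<kappa>
    using integral_to_bump(1)[OF x] by (cases \<kappa>) (simp add: set_integrable_def)
  have "integral_to (\<lambda>y. \<Sum>\<kappa>\<in>J. c \<kappa> * bump \<kappa> y) x
      = (LINT t|M. (\<Sum>\<kappa>\<in>J. c \<kappa> * (indicator (P x) t *\<^sub>R (bump \<kappa> t * u t))))"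
    unfolding integral_to_def set_lebesgue_integral_def
    by (intro Bochner_Integration.integral_cong refl)
      (simp add: sum_distrib_left sum_distrib_right mult_ac)
  also have "\<dots> = (\<Sum>\<kappa>\<in>J. c \<kappa> * integral_to (bump \<kappa>) x)"
    unfolding integral_to_def set_lebesgue_integral_def
    using I by (subst Bochner_Integration.integral_sum) auto
  finally show ?thesis .
qed

text \<open>Disjoint supports of the bumps yield \<open>up\<close>; disjoint targets, on each of
  which only one image survives, yield \<open>low\<close>. \<open>\<tau> \<kappa>\<close> is a lower
  bound for the norm of the image divided by the norm of the bump, and an index with the least
  \<open>\<tau>\<close> is the one found.\<close>

lemma approx_number_clusters:
  fixes v :: "'a \<Rightarrow> real"
  assumes v: "v \<in> Lp_space M p" and K: "finite K" "K \<noteq> {}" "K \<subseteq> clusters"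
    and md: "\<And>\<kappa>. \<kappa> \<in> K \<Longrightarrow> fst \<kappa> mod 3 = i"
  defines "\<tau> \<equiv> \<lambda>\<kappa>. (gap \<kappa> powr p * enn2real (\<integral>\<^sup>+x\<in>target \<kappa>. ennreal (\<bar>v x\<bar> powr p) \<partial>M)
      / norm_bound \<kappa>) powr (1 / p)"
  shows "\<exists>\<kappa>\<in>K. ennreal (\<tau> \<kappa>) \<le> approx_number M p (\<lambda>f x. v x * integral_to f x) (card K)"
proof -
  have p: "0 < p" using p_gt1 by simp
  have vm: "v \<in> borel_measurable M" using v by (simp add: Lp_space_iff)
  define \<nu> where "\<nu> \<kappa> = (\<integral>\<^sup>+x\<in>target \<kappa>. ennreal (\<bar>v x\<bar> powr p) \<partial>M)" for \<kappa>
  have \<nu>_fin: "ennreal (enn2real (\<nu> \<kappa>)) = \<nu> \<kappa>" for \<kappa>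
  proof -
    have "\<nu> \<kappa> \<le> (\<integral>\<^sup>+x. ennreal (\<bar>v x\<bar> powr p) \<partial>M)"
      unfolding \<nu>_def by (intro nn_integral_mono) (auto split: split_indicator)
    then have "\<nu> \<kappa> < top" using v by (auto simp: Lp_space_iff)
    then show ?thesis by simp
  qed
  obtain \<kappa>0 where \<kappa>0: "\<kappa>0 \<in> K" "\<And>\<kappa>. \<kappa> \<in> K \<Longrightarrow> \<tau> \<kappa>0 \<le> \<tau> \<kappa>"
    using ex_min_if_finite[of "\<tau> ` K"] K by (auto simp: not_less)
  have \<tau>0: "0 \<le> \<tau> \<kappa>" for \<kappa> by (simp add: \<tau>_def)
  have \<tau>p: "\<tau> \<kappa> powr p = gap \<kappa> powr p * enn2real (\<nu> \<kappa>) / norm_bound \<kappa>" for \<kappa>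
    using p norm_bound_pos[of \<kappa>] gap_pos[of \<kappa>] by (simp add: \<tau>_def \<nu>_def powr_powr)
  have cl: "\<exists>k r. \<kappa> = (k, r) \<and> r \<in> branch_roots k" if "\<kappa> \<in> K" for \<kappa>
    using K(3) that by (auto simp: clusters_def)
  have supp: "\<kappa> = \<kappa>'" if "\<kappa> \<in> K" "\<kappa>' \<in> K" "bump \<kappa> x \<noteq> 0" "bump \<kappa>' x \<noteq> 0" for \<kappa> \<kappa>' x
    using cl[OF that(1)] cl[OF that(2)] md[OF that(1)] md[OF that(2)] bump_disjoint that by (metis fst_conv)
  have same: "integral_to (bump \<kappa>) x = gap \<kappa>" if "\<kappa> \<in> K" "x \<in> target \<kappa>" for \<kappa> x
    using cl[OF that(1)] integral_to_bump_target that by (auto simp: gap_def)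
  have other: "integral_to (bump \<kappa>') x = 0" if "\<kappa> \<in> K" "\<kappa>' \<in> K" "\<kappa>' \<noteq> \<kappa>" "x \<in> target \<kappa>" for \<kappa> \<kappa>' x
    using cl[OF that(1)] cl[OF that(2)] md[OF that(1)] md[OF that(2)] integral_to_bump_other that
    by (metis fst_conv)
  have tX: "target \<kappa> \<subseteq> X" for \<kappa> by (auto simp: target_def D_def)
  have bump_fin: "(\<integral>\<^sup>+x. ennreal (\<bar>bump \<kappa> x\<bar> powr p) \<partial>M) \<le> ennreal (norm_bound \<kappa>)" if "\<kappa> \<in> K" for \<kappa>
    using cl[OF that] nn_integral_bump by (auto simp: norm_bound_def)
  have "ennreal (\<tau> \<kappa>0) \<le> approx_number M p (\<lambda>f x. v x * integral_to f x) (card K)"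
  proof (rule approx_number_ge[where f = bump and N = norm_bound, OF p K(1)])
    show "bump \<kappa> \<in> Lp_space M p" if "\<kappa> \<in> K" for \<kappa>
      unfolding Lp_space_iff using bump_measurable bump_fin[OF that] le_less_trans[OF _ ennreal_less_top] by blast
    show "0 < norm_bound \<kappa>" for \<kappa> by (rule norm_bound_pos)
    show "0 \<le> \<tau> \<kappa>0" by (rule \<tau>0)
  next
    fix c :: "int \<times> 'a \<Rightarrow> real"
    have "ennreal (\<bar>\<Sum>\<kappa>\<in>K. c \<kappa> * bump \<kappa> x\<bar> powr p)
        \<le> (\<Sum>\<kappa>\<in>K. ennreal (\<bar>c \<kappa>\<bar> powr p) * ennreal (\<bar>bump \<kappa> x\<bar> powr p))" for x
    proof (cases "\<exists>\<kappa>\<in>K. bump \<kappa> x \<noteq> 0")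
      case True
      then obtain \<kappa> where \<kappa>: "\<kappa> \<in> K" "bump \<kappa> x \<noteq> 0" by blast
      have "bump \<kappa>' x = 0" if "\<kappa>' \<in> K" "\<kappa>' \<noteq> \<kappa>" for \<kappa>'
        using supp[OF that(1) \<kappa>(1) _ \<kappa>(2)] that(2) by blast
      then have "(\<Sum>\<kappa>\<in>K. c \<kappa> * bump \<kappa> x) = (\<Sum>\<kappa>\<in>{\<kappa>}. c \<kappa> * bump \<kappa> x)"
        using \<kappa> K(1) by (intro sum.mono_neutral_right) auto
      then have "ennreal (\<bar>\<Sum>\<kappa>\<in>K. c \<kappa> * bump \<kappa> x\<bar> powr p)
          = ennreal (\<bar>c \<kappa>\<bar> powr p) * ennreal (\<bar>bump \<kappa> x\<bar> powr p)"
        by (simp add: abs_mult powr_mult ennreal_mult)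
      also have "\<dots> \<le> (\<Sum>\<kappa>\<in>K. ennreal (\<bar>c \<kappa>\<bar> powr p) * ennreal (\<bar>bump \<kappa> x\<bar> powr p))"
        using \<kappa> K(1) by (intro member_le_sum) auto
      finally show ?thesis .
    next
      case False
      then show ?thesis using p by simp
    qed
    then have "(\<integral>\<^sup>+x. ennreal (\<bar>\<Sum>\<kappa>\<in>K. c \<kappa> * bump \<kappa> x\<bar> powr p) \<partial>M)
        \<le> (\<integral>\<^sup>+x. (\<Sum>\<kappa>\<in>K. ennreal (\<bar>c \<kappa>\<bar> powr p) * ennreal (\<bar>bump \<kappa> x\<bar> powr p)) \<partial>M)"
      by (intro nn_integral_mono)
    also have "\<dots> = (\<Sum>\<kappa>\<in>K. ennreal (\<bar>c \<kappa>\<bar> powr p) * (\<integral>\<^sup>+x. ennreal (\<bar>bump \<kappa> x\<bar> powr p) \<partial>M))"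
      using bump_measurable by (simp add: nn_integral_sum nn_integral_cmult)
    also have "\<dots> \<le> (\<Sum>\<kappa>\<in>K. ennreal (\<bar>c \<kappa>\<bar> powr p) * ennreal (norm_bound \<kappa>))"
      by (intro sum_mono mult_left_mono bump_fin) auto
    also have "\<dots> = ennreal (\<Sum>\<kappa>\<in>K. \<bar>c \<kappa>\<bar> powr p * norm_bound \<kappa>)"
      using norm_bound_pos by (simp add: ennreal_mult[symmetric] less_imp_le)
    finally show "(\<integral>\<^sup>+x. ennreal (\<bar>\<Sum>\<kappa>\<in>K. c \<kappa> * bump \<kappa> x\<bar> powr p) \<partial>M)
        \<le> ennreal (\<Sum>\<kappa>\<in>K. \<bar>c \<kappa>\<bar> powr p * norm_bound \<kappa>)" .
  next
    fix c :: "int \<times> 'a \<Rightarrow> real"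
    let ?f = "\<lambda>y. \<Sum>\<kappa>\<in>K. c \<kappa> * bump \<kappa> y"
    let ?g = "\<lambda>\<kappa> x. ennreal (\<bar>c \<kappa>\<bar> powr p * gap \<kappa> powr p) * (ennreal (\<bar>v x\<bar> powr p) * indicator (target \<kappa>) x)"
    have g: "(\<Sum>\<kappa>\<in>K. ?g \<kappa> x) \<le> ennreal (\<bar>v x * integral_to ?f x\<bar> powr p)" for x
    proof (cases "\<exists>\<kappa>\<in>K. x \<in> target \<kappa>")
      case True
      then obtain \<kappa> where \<kappa>: "\<kappa> \<in> K" "x \<in> target \<kappa>" by blast
      have xX: "x \<in> X" using \<kappa> tX by blast
      \<comment> \<open>Targets are disjoint: at a common point the integral of one bump would be
        both \<open>gap\<close>, which is positive, and 0.\<close>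
      have no: "x \<notin> target \<kappa>'" if "\<kappa>' \<in> K" "\<kappa>' \<noteq> \<kappa>" for \<kappa>'
        using same[of \<kappa>' x] other[OF \<kappa>(1) that \<kappa>(2)] that gap_pos[of \<kappa>'] by auto
      have "integral_to ?f x = (\<Sum>\<kappa>\<in>K. c \<kappa> * integral_to (bump \<kappa>) x)"
        by (rule integral_to_sum[OF xX K(1)])
      also have "\<dots> = (\<Sum>\<kappa>\<in>{\<kappa>}. c \<kappa> * integral_to (bump \<kappa>) x)"
        using \<kappa> K(1) other[OF \<kappa>(1) _ _ \<kappa>(2)] by (intro sum.mono_neutral_right) auto
      also have "\<dots> = c \<kappa> * gap \<kappa>" using same[OF \<kappa>] by simp
      finally have i: "integral_to ?f x = c \<kappa> * gap \<kappa>" .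
      have "(\<Sum>\<kappa>\<in>K. ?g \<kappa> x) = (\<Sum>\<kappa>\<in>{\<kappa>}. ?g \<kappa> x)"
        using \<kappa> K(1) no by (intro sum.mono_neutral_right) auto
      also have "\<dots> = ennreal (\<bar>v x * integral_to ?f x\<bar> powr p)"
        unfolding i using \<kappa>(2) gap_pos[of \<kappa>]
        by (simp add: abs_mult powr_mult ennreal_mult[symmetric] mult_ac)
      finally show ?thesis by simp
    next
      case False
      then show ?thesis by simp
    qed
    have "ennreal (\<tau> \<kappa>0 powr p * (\<Sum>\<kappa>\<in>K. \<bar>c \<kappa>\<bar> powr p * norm_bound \<kappa>))
        \<le> ennreal (\<Sum>\<kappa>\<in>K. \<bar>c \<kappa>\<bar> powr p * (gap \<kappa> powr p * enn2real (\<nu> \<kappa>)))"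
      unfolding sum_distrib_left
    proof (intro ennreal_leI sum_mono)
      fix \<kappa> assume \<kappa>: "\<kappa> \<in> K"
      have "\<tau> \<kappa>0 powr p \<le> \<tau> \<kappa> powr p"
        using p \<tau>0 \<kappa>0(2)[OF \<kappa>] by (intro powr_mono2) auto
      then have "\<tau> \<kappa>0 powr p * norm_bound \<kappa> \<le> gap \<kappa> powr p * enn2real (\<nu> \<kappa>)"
        unfolding \<tau>p[of \<kappa>] using norm_bound_pos[of \<kappa>] by (simp add: pos_le_divide_eq)
      then have "\<bar>c \<kappa>\<bar> powr p * (\<tau> \<kappa>0 powr p * norm_bound \<kappa>)
          \<le> \<bar>c \<kappa>\<bar> powr p * (gap \<kappa> powr p * enn2real (\<nu> \<kappa>))"
        by (intro mult_left_mono) auto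
      then show "\<tau> \<kappa>0 powr p * (\<bar>c \<kappa>\<bar> powr p * norm_bound \<kappa>)
          \<le> \<bar>c \<kappa>\<bar> powr p * (gap \<kappa> powr p * enn2real (\<nu> \<kappa>))"
        by (simp only: mult_ac)
    qed
    also have "\<dots> = (\<Sum>\<kappa>\<in>K. ennreal (\<bar>c \<kappa>\<bar> powr p * gap \<kappa> powr p) * \<nu> \<kappa>)"
    proof -
      have "ennreal (\<bar>c \<kappa>\<bar> powr p * gap \<kappa> powr p) * \<nu> \<kappa>
          = ennreal (\<bar>c \<kappa>\<bar> powr p * (gap \<kappa> powr p * enn2real (\<nu> \<kappa>)))" for \<kappa>
        by (subst \<nu>_fin[symmetric]) (simp add: ennreal_mult[symmetric] mult.assoc)
      then show ?thesis by (simp add: sum_ennreal)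
    qed
    also have "\<dots> = (\<integral>\<^sup>+x. (\<Sum>\<kappa>\<in>K. ?g \<kappa> x) \<partial>M)"
      unfolding \<nu>_def using vm target_measurable
      by (subst nn_integral_sum) (auto simp: nn_integral_cmult)
    also have "\<dots> \<le> (\<integral>\<^sup>+x. ennreal (\<bar>v x * integral_to ?f x\<bar> powr p) \<partial>M)"
      by (intro nn_integral_mono g)
    finally show "ennreal (\<tau> \<kappa>0 powr p * (\<Sum>\<kappa>\<in>K. \<bar>c \<kappa>\<bar> powr p * norm_bound \<kappa>))
        \<le> (\<integral>\<^sup>+x. ennreal (\<bar>v x * integral_to ?f x\<bar> powr p) \<partial>M)" .
  qed
  then show ?thesis using \<kappa>0(1) by blast
qed

text \<open>Each residue class modulo 3 is compared with the whole sequence of approximation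
  numbers, hence the factor 3.\<close>

lemma sum_clusters_le:
  fixes v :: "'a \<Rightarrow> real"
  assumes v: "v \<in> Lp_space M p" and K: "finite K" "K \<subseteq> clusters" and q: "0 < q"
  defines "\<tau> \<equiv> \<lambda>\<kappa>. (gap \<kappa> powr p * enn2real (\<integral>\<^sup>+x\<in>target \<kappa>. ennreal (\<bar>v x\<bar> powr p) \<partial>M)
      / norm_bound \<kappa>) powr (1 / p)"
  shows "(\<Sum>\<kappa>\<in>K. enn_powr (ennreal (\<tau> \<kappa>)) q)
    \<le> 3 * (\<Sum>\<^sub>\<infinity>m\<in>{1..}. enn_powr (approx_number M p (\<lambda>f x. v x * integral_to f x) m) q)"
proof -
  let ?a = "approx_number M p (\<lambda>f x. v x * integral_to f x)"
  define K' where "K' i = {\<kappa> \<in> K. fst \<kappa> mod 3 = i}" for i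
  have part: "(\<Sum>\<kappa>\<in>K' i. enn_powr (ennreal (\<tau> \<kappa>)) q) \<le> (\<Sum>\<^sub>\<infinity>m\<in>{1..}. enn_powr (?a m) q)" for i
  proof -
    have "(\<Sum>\<kappa>\<in>K' i. enn_powr (ennreal (\<tau> \<kappa>)) q) \<le> (\<Sum>m=1..card (K' i). enn_powr (?a m) q)"
    proof (rule sum_le_by_rearrangement)
      show "finite (K' i)" using K by (simp add: K'_def)
      fix L assume L: "L \<subseteq> K' i" "L \<noteq> {}"
      have "finite L" "L \<subseteq> clusters" "\<And>\<kappa>. \<kappa> \<in> L \<Longrightarrow> fst \<kappa> mod 3 = i"
        using L K finite_subset[of L K] by (auto simp: K'_def)
      then obtain \<kappa> where "\<kappa> \<in> L" "ennreal (\<tau> \<kappa>) \<le> ?a (card L)"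
        using approx_number_clusters[OF v, of L i] L unfolding \<tau>_def by blast
      then show "\<exists>\<kappa>\<in>L. enn_powr (ennreal (\<tau> \<kappa>)) q \<le> enn_powr (?a (card L)) q"
        using enn_powr_mono[OF q] by blast
    qed
    also have "\<dots> \<le> (\<Sum>\<^sub>\<infinity>m\<in>{1..}. enn_powr (?a m) q)"
      by (rule finite_sum_le_infsum_ennreal) auto
    finally show ?thesis .
  qed
  have "K = K' 0 \<union> K' 1 \<union> K' 2"
    unfolding K'_def using pos_mod_bound[of 3] pos_mod_sign[of 3] by fastforce
  moreover have "finite (K' i)" for i using K by (simp add: K'_def)
  moreover have "K' 0 \<inter> K' 1 = {}" "(K' 0 \<union> K' 1) \<inter> K' 2 = {}" by (auto simp: K'_def)
  ultimately have "(\<Sum>\<kappa>\<in>K. enn_powr (ennreal (\<tau> \<kappa>)) q)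
      = (\<Sum>\<kappa>\<in>K' 0. enn_powr (ennreal (\<tau> \<kappa>)) q) + (\<Sum>\<kappa>\<in>K' 1. enn_powr (ennreal (\<tau> \<kappa>)) q)
        + (\<Sum>\<kappa>\<in>K' 2. enn_powr (ennreal (\<tau> \<kappa>)) q)"
    by (metis finite_UnI sum.union_disjoint)
  also have "\<dots> \<le> (\<Sum>\<^sub>\<infinity>m\<in>{1..}. enn_powr (?a m) q) + (\<Sum>\<^sub>\<infinity>m\<in>{1..}. enn_powr (?a m) q)
      + (\<Sum>\<^sub>\<infinity>m\<in>{1..}. enn_powr (?a m) q)"
    by (intro add_mono part)
  also have "\<dots> = 3 * (\<Sum>\<^sub>\<infinity>m\<in>{1..}. enn_powr (?a m) q)"
  proof -
    have "(3::ennreal) = 1 + 1 + 1" by simp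
    then show ?thesis by (simp only: distrib_right mult_1)
  qed
  finally show ?thesis .
qed

end

section \<open>The approximation numbers of the Hardy operator\<close>

context tree_graph
begin

lemma rooted_tree_points:
  assumes a: "a \<in> points G"
  shows "rooted_tree (points G) (tree_dist G) a (tree_path G a) (tree_measure G)"
proof -
  interpret Metric_space "points G" "tree_dist G" by (rule Metric_space_tree_dist)
  note path = tree_path_eq_arc[OF a]
  have in_arc: "y \<in> points G" if "x \<in> points G" "y \<in> tree_path G a x" for x y
    using that path arc_points by blast
  show ?thesis
  proof unfold_locales
    show "a \<in> points G" by (rule a)
    fix x assume x: "x \<in> points G"
    show "tree_path G a x \<subseteq> points G" using path[OF x] arc_points by simp
    show "x \<in> tree_path G a x" "a \<in> tree_path G a x" using path[OF x] arc_ends a x by auto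
    show "{x} \<in> null_sets (tree_measure G)" using singleton_null[OF x] .
    show "\<exists>y\<in>tree_path G a x. tree_dist G a y = t" if "0 \<le> t" "t \<le> tree_dist G a x" for t
      using arc_intermediate[OF a x that(1)] that(2) path[OF x] a x tree_dist_eq arc_points by fastforce
    show "\<exists>\<delta>>0. \<exists>E. finite E \<and> E \<subseteq> points G \<and> (\<forall>q\<in>E. x \<in> tree_path G a q) \<and>
        (\<forall>y\<in>points G. tree_dist G x y < \<delta> \<longrightarrow> (\<exists>q\<in>E. y \<in> tree_path G a q))"
    proof -
      obtain \<delta> E where E: "\<delta> > 0" "finite E" "E \<subseteq> points G" "\<forall>q\<in>E. x \<in> arc a q"
        "\<forall>y\<in>points G. gdist x y < \<delta> \<longrightarrow> (\<exists>q\<in>E. y \<in> arc a q)"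
        using arc_neighbourhood[OF a x] by blast
      have "tree_path G a q = arc a q" if "q \<in> E" for q using path E(3) that by blast
      then show ?thesis
        using E tree_dist_eq[OF x] by (intro exI[of _ \<delta>] conjI exI[of _ E]) auto
    qed
    fix y assume y: "y \<in> tree_path G a x"
    have yp: "y \<in> points G" using in_arc[OF x y] .
    have ya: "y \<in> arc a x" using y path[OF x] by simp
    show "tree_path G a y \<subseteq> tree_path G a x"
      using arc_subset[OF ya] path x yp by simp
    show "tree_dist G a x = tree_dist G a y + tree_dist G y x"
      using gdist_add[OF a x ya] tree_dist_eq a x yp by simp
    fix z assume z: "z \<in> tree_path G a x"
    have zp: "z \<in> points G" using in_arc[OF x z] .
    have za: "z \<in> arc a x" using z path[OF x] by simp
    have "y \<in> arc a z \<or> y \<in> arc z x" using arc_Un[OF a x za] ya by blast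
    then show "y \<in> tree_path G a z \<or> z \<in> tree_path G a y"
      using arc_between[OF za] path[OF yp] path[OF zp] by auto
  next
    show "space (tree_measure G) = points G" by (rule space_tree_measure)
    fix A assume "A \<subseteq> points G" "\<And>x. x \<in> A \<Longrightarrow> tree_path G a x \<subseteq> A"
    then show "A \<in> sets (tree_measure G)"
      using path by (intro down_closed_sets[OF a]) blast+
  qed
qed

text \<open>Root paths are compact, so the local integrability of \<open>u\<close> makes
  \<open>U\<close> finite.\<close>

lemma hardy_tree_points:
  assumes a: "a \<in> points G" and p: "1 < p" and u: "u \<in> Lp_loc G (conj_exp p)" and b: "1 \<le> b"
  shows "hardy_tree (points G) (tree_dist G) a (tree_path G a) (tree_measure G) u p b"
proof -
  interpret rooted_tree "points G" "tree_dist G" a "tree_path G a" "tree_measure G"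
    by (rule rooted_tree_points[OF a])
  have um: "u \<in> borel_measurable (tree_measure G)" using u by (simp add: Lp_loc_def)
  show ?thesis
  proof unfold_locales
    show "(\<lambda>x. \<bar>u x\<bar> powr conj_exp p) \<in> borel_measurable (tree_measure G)" using um by simp
    show "u \<in> borel_measurable (tree_measure G)" by (rule um)
    fix x assume x: "x \<in> points G"
    have "closedin mtopology (tree_path G a x)"
      using compactin_imp_closedin[OF Hausdorff_space_mtopology compactin_path[OF x]] .
    then have "mtopology closure_of tree_path G a x = tree_path G a x"
      by (rule closure_of_closedin)
    then have "relatively_compact G (tree_path G a x)"
      using compactin_path[OF x] P_subset[OF x] by (simp add: relatively_compact_def tree_topology_def)
    then show "(\<integral>\<^sup>+y\<in>tree_path G a x. ennreal (\<bar>u y\<bar> powr conj_exp p) \<partial>tree_measure G) < top"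
      using u path_measurable[OF x] by (simp add: Lp_loc_def)
  qed (use p b in auto)
qed

end

text \<open>Every level whose lower threshold is attained by \<open>U\<close> is thereby admissible,
  so the hypothesis on boundary points is available at every branching root.\<close>

lemma (in hardy_tree) admissible_powr:
  assumes x: "x \<in> X" "U x = lev k"
  shows "ennreal (2 powr of_int k) \<le> enn_powr (Lp_norm M (conj_exp p) u) p"
proof -
  have c: "0 < conj_exp p" "0 < p" using conj_gt1 p_gt1 by auto
  have "ennreal (lev k) = W (P x)" using W_P[OF x(1)] x(2) by simp
  also have "\<dots> \<le> (\<integral>\<^sup>+x. ennreal (\<bar>u x\<bar> powr conj_exp p) \<partial>M)"
    unfolding W_def by (intro nn_integral_mono) (auto split: split_indicator)
  finally have "enn_powr (enn_powr (ennreal (lev k)) (1 / conj_exp p)) p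
      \<le> enn_powr (Lp_norm M (conj_exp p) u) p"
    unfolding Lp_norm_def using c by (intro enn_powr_mono) auto
  moreover have "enn_powr (enn_powr (ennreal (lev k)) (1 / conj_exp p)) p = ennreal (2 powr of_int k)"
    using c by (simp add: enn_powr_ennreal lev_def powr_powr)
  ultimately show ?thesis by simp
qed

text \<open>The source of the factor \<open>2^k\<close> in \<open>\<sigma>\<close>: a height of
  order \<open>lev k\<close> enters with its \<open>p\<close>-th power and is divided by a norm
  bound of order \<open>lev k\<close>.\<close>

lemma (in hardy_tree) lev_powr: "lev k powr p = lev k * 2 powr of_int k"
proof -
  have "of_int k * conj_exp p / p * p = of_int k * conj_exp p / p + of_int k * (conj_exp p / p * (p - 1))"
    using p_gt1 by (simp add: field_simps)
  then show ?thesis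
    unfolding conj_facts(2) by (simp add: lev_def powr_powr powr_add[symmetric])
qed

theorem theorem6p11:
  fixes G :: "'v graph"
    and p B :: real
    and u v :: "'v tpoint \<Rightarrow> real"
    and a :: "'v tpoint"
    and n :: "int \<Rightarrow> enat"
    and Z :: "int \<Rightarrow> nat \<Rightarrow> 'v tpoint set"
  assumes "is_tree G"
    and "1 < p"
    and "u \<in> Lp_loc G (conj_exp p)"
    and "v \<in> Lp_space (tree_measure G) p"
    and "a \<in> points G"
    and "enumerates_components G p u a n Z"
    and "\<And>k i. admissible G p u k \<Longrightarrow> i \<in> upto_enat (n k) \<Longrightarrow> boundary_count G (Z k i) < ereal B"
  shows "\<forall>q>0. \<exists>c>0. lq_norm q (UNIV \<times> {1..}) (sigma_seq G p u v n Z)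
           \<le> ennreal c * lq_norm q {1..} (approx_number (tree_measure G) p (hardy_op G u v a))"
proof -
  note p = assms(2) and v = assms(4) and a = assms(5)
  \<comment> \<open>\<open>boundary_count\<close> subtracts 1, so the number of boundary points is
    below \<open>B + 1\<close>; the last summand ensures \<open>1 \<le> b\<close> for every
    \<open>B\<close>.\<close>
  define b where "b = nat \<lceil>B + 1\<rceil> + 1"
  interpret tree_graph G by unfold_locales (rule assms(1))
  interpret hardy_tree "points G" "tree_dist G" a "tree_path G a" "tree_measure G" u p b
    by (rule hardy_tree_points[OF a p assms(3)]) (simp add: b_def)
  have top: "tree_topology G = mtopology" by (simp add: tree_topology_def)
  have Z_eq: "Z_set G p u a k = closed_level (lev k) (lev (k + 1))" for k
  proof -
    have U: "U_fun G p u a x = ennreal (U x)" if "x \<in> points G" for x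
      using W_P[OF that] by (simp add: U_fun_def W_def)
    have "{x \<in> points G. ennreal (lev k) \<le> U_fun G p u a x \<and> U_fun G p u a x < ennreal (lev (k + 1))}
        = level_set (lev k) (lev (k + 1))"
      unfolding level_set_def using U lev_pos[of k] lev_pos[of "k + 1"] U_nonneg
      by (auto simp: ennreal_less_iff)
    then show ?thesis
      unfolding Z_set_def closed_level_def top by (simp add: lev_def)
  qed
  have comps: "Z_components G p u a k
      = connected_components_of (subtopology mtopology (closed_level (lev k) (lev (k + 1))))" for k
    unfolding Z_components_def Z_eq top ..
  have bij: "bij_betw (Z k) (upto_enat (n k)) (Z_components G p u a k)" if "admissible G p u k" for k
    using assms(6) that by (simp add: enumerates_components_def)
  interpret branching_hardy_tree "points G" "tree_dist G" a "tree_path G a" "tree_measure G" u p b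
  proof
    fix k r assume r: "r \<in> branch_roots k"
    let ?S = "branch_roots (k + 1) \<inter> D r"
    show "finite ?S \<and> card ?S \<le> b"
    proof (cases "?S = {}")
      case False
      have adm: "admissible G p u k"
        unfolding admissible_def using admissible_powr branch_rootsD[OF r] by blast
      have lt: "lev k < lev (k + 1)" by (rule lev_less) simp
      let ?K = "closed_level (lev k) (lev (k + 1)) \<inter> D r"
      have "?K \<in> Z_components G p u a k"
        unfolding comps by (rule component_at_root[OF branch_rootsD(1)[OF r] lt])
      then have "?K \<in> Z k ` upto_enat (n k)"
        using bij[OF adm] unfolding bij_betw_def by blast
      then obtain i where "i \<in> upto_enat (n k)" "?K = Z k i" by (rule imageE)
      then have bc: "boundary_count G ?K < ereal B" using assms(7)[OF adm] by simp
      have "?S \<subseteq> mtopology frontier_of ?K"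
      proof
        fix s assume s: "s \<in> ?S"
        then obtain x where "x \<in> points G" "s \<in> tree_path G a x" "x \<noteq> s"
          by (auto simp: branch_roots_def)
        then show "s \<in> mtopology frontier_of ?K"
          using exit_in_frontier[OF branch_rootsD(1)[OF r] _ lt] s branch_rootsD(1) by blast
      qed
      moreover have "finite (mtopology frontier_of ?K) \<and> real (card (mtopology frontier_of ?K)) < B + 1"
        using bc unfolding boundary_count_def top by (auto simp: Let_def split: if_splits)
      ultimately have "finite ?S" "real (card ?S) < B + 1"
        using finite_subset card_mono by (blast, meson le_less_trans of_nat_le_iff)
      then show ?thesis unfolding b_def by linarith
    qed simp
  qed
  have T: "hardy_op G u v a = (\<lambda>f x. v x * integral_to f x)"
    by (simp add: fun_eq_iff hardy_op_def integral_to_def)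
  define \<nu> where "\<nu> \<kappa> = (\<integral>\<^sup>+x\<in>target \<kappa>. ennreal (\<bar>v x\<bar> powr p) \<partial>tree_measure G)" for \<kappa>
  define \<tau> where "\<tau> \<kappa> = (gap \<kappa> powr p * enn2real (\<nu> \<kappa>) / norm_bound \<kappa>) powr (1 / p)" for \<kappa>
  \<comment> \<open>For a parent at level \<open>k - 1\<close>,
    \<open>gap powr p / norm_bound\<close> is \<open>Q * 2 powr k\<close>: there \<open>gap\<close>
    is \<open>lev k\<close> times \<open>1 - lev (k - 1) / lev k\<close>, and one factor
    \<open>lev k\<close> cancels against \<open>norm_bound\<close>.\<close>
  define Q where "Q = (1 - 2 powr (- (conj_exp p / p))) powr p / bump_const"
  have Q: "0 < Q"
    unfolding Q_def using bump_const_pos p conj_gt1 by (simp add: zero_less_divide_iff)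
  define C where "C = (1 / Q) powr (1 / p)"
  have C: "0 < C" using Q by (simp add: C_def)
  have C\<tau>: "enn_powr (ennreal (2 powr of_int k) * \<nu> (k - 1, r)) (1 / p) = ennreal (C * \<tau> (k - 1, r))" for k r
  proof -
    have "\<nu> (k - 1, r) \<le> (\<integral>\<^sup>+x. ennreal (\<bar>v x\<bar> powr p) \<partial>tree_measure G)"
      unfolding \<nu>_def by (intro nn_integral_mono) (auto split: split_indicator)
    then have fin: "\<nu> (k - 1, r) < top" using v by (auto simp: Lp_space_iff)
    define w where "w = enn2real (\<nu> (k - 1, r))"
    have w: "\<nu> (k - 1, r) = ennreal w" "0 \<le> w" using fin by (auto simp: w_def)
    have l: "lev (k - 1) = 2 powr (- (conj_exp p / p)) * lev k"
      using lev_add[of k "-1"] by simp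
    have "gap (k - 1, r) = (1 - 2 powr (- (conj_exp p / p))) * lev k"
      unfolding gap_def using l by (simp add: algebra_simps)
    moreover have "0 \<le> 1 - 2 powr (- (conj_exp p / p))"
      using powr_mono[of "- (conj_exp p / p)" 0 2] p conj_gt1 by simp
    ultimately have "gap (k - 1, r) powr p = (1 - 2 powr (- (conj_exp p / p))) powr p * (lev k * 2 powr of_int k)"
      using lev_pos[of k] by (simp add: powr_mult lev_powr)
    then have "gap (k - 1, r) powr p * w / norm_bound (k - 1, r) = Q * (2 powr of_int k * w)"
      using lev_pos[of k] by (simp add: norm_bound_def Q_def)
    then have "C * \<tau> (k - 1, r) = (1 / Q) powr (1 / p) * (Q * (2 powr of_int k * w)) powr (1 / p)"
      by (simp add: \<tau>_def C_def w_def)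
    also have "\<dots> = (2 powr of_int k * w) powr (1 / p)"
      using Q w(2) by (simp add: powr_mult powr_divide)
    finally show ?thesis
      using w by (simp add: ennreal_mult[symmetric] enn_powr_ennreal)
  qed
  let ?\<sigma> = "sigma_seq G p u v n Z"
  \<comment> \<open>Only a non-zero entry forces the root of its component to be branching; the
    other entries contribute nothing to the sum.\<close>
  define I where "I = {x. ?\<sigma> x \<noteq> 0}"
  have I: "\<exists>r s. admissible G p u k \<and> i \<in> upto_enat (n k)
      \<and> Z k i = closed_level (lev k) (lev (k + 1)) \<inter> D s
      \<and> r \<in> branch_roots (k - 1) \<and> s \<in> branch_roots k \<inter> D r
      \<and> ?\<sigma> (k, i) \<le> ennreal (C * \<tau> (k - 1, r))" if "(k, i) \<in> I" for k i
  proof -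
    have ki: "admissible G p u k" "i \<in> upto_enat (n k)"
      and \<sigma>: "?\<sigma> (k, i) = enn_powr (ennreal (2 powr of_int k) * mu G p v (Z k i)) (1 / p)"
      using that by (auto simp: I_def sigma_seq_def split: if_splits)
    have "Z k i \<in> Z_components G p u a k" using bij[OF ki(1)] ki(2) by (auto simp: bij_betw_def)
    then obtain s where s: "is_root (lev k) s" "Z k i = closed_level (lev k) (lev (k + 1)) \<inter> D s"
      using components_closed_level[OF lev_pos] unfolding comps by blast
    have sX: "s \<in> points G" "U s = lev k" using s(1) by (auto simp: is_root_def)
    have "\<exists>x\<in>points G. s \<in> tree_path G a x \<and> x \<noteq> s"
    proof (rule ccontr)
      assume "\<not> ?thesis"
      \<comment> \<open>If the tree ends at the root \<open>s\<close>, the component is a single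
        point and its entry is 0.\<close>
      then have "Z k i \<subseteq> {s}" unfolding s(2) by (auto simp: D_def)
      then have "mu G p v (Z k i) \<le> mu G p v {s}"
        unfolding mu_def by (intro nn_integral_mono) (auto split: split_indicator)
      also have "\<dots> = 0" unfolding mu_def by (rule nn_integral_null_set[OF point_null[OF sX(1)]])
      finally have "?\<sigma> (k, i) = 0" using \<sigma> p by (simp add: enn_powr_def)
      then show False using that by (simp add: I_def)
    qed
    then have sb: "s \<in> branch_roots k" using s(1) by (simp add: branch_roots_def)
    have "lev (k - 1) < U s" using sX lev_less[of "k - 1" k] by simp
    then obtain r where r: "r \<in> branch_roots (k - 1)" "r \<in> tree_path G a s"
      using branch_root_exists[OF sX(1)] by blast
    \<comment> \<open>The level drops by one here: the component is measured by the bump of the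
      branching root \<open>r\<close> that precedes it.\<close>
    have "Z k i \<subseteq> target (k - 1, r)"
    proof
      fix x assume x: "x \<in> Z k i"
      then have "x \<in> points G" "s \<in> tree_path G a x" "x \<in> closed_level (lev k) (lev (k + 1))"
        using s(2) by (auto simp: D_def)
      then show "x \<in> target (k - 1, r)"
        using closed_level_bounds[of x "lev k" "lev (k + 1)"] P_trans[of x s r] r(2) sb by (auto simp: target_def D_def add.commute)
    qed
    then have "mu G p v (Z k i) \<le> \<nu> (k - 1, r)"
      unfolding mu_def \<nu>_def by (intro nn_integral_mono) (auto split: split_indicator)
    then have "?\<sigma> (k, i) \<le> ennreal (C * \<tau> (k - 1, r))"
      unfolding \<sigma> C\<tau>[symmetric] using p by (intro enn_powr_mono mult_left_mono) auto
    then show ?thesis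
      using ki s(2) r sb sX(1) by (auto simp: D_def)
  qed
  define sel where "sel x r s \<longleftrightarrow> admissible G p u (fst x) \<and> snd x \<in> upto_enat (n (fst x))
      \<and> Z (fst x) (snd x) = closed_level (lev (fst x)) (lev (fst x + 1)) \<inter> D s
      \<and> r \<in> branch_roots (fst x - 1) \<and> s \<in> branch_roots (fst x) \<inter> D r
      \<and> ?\<sigma> x \<le> ennreal (C * \<tau> (fst x - 1, r))" for x r s
  have "\<exists>r s. sel x r s" if "x \<in> I" for x
    using I[of "fst x" "snd x"] that unfolding sel_def by simp
  then obtain r s where "\<And>x. x \<in> I \<Longrightarrow> sel x (r x) (s x)" by metis
  note rs = this[unfolded sel_def]
  define g where "g x = (fst x - 1, r x)" for x
  \<comment> \<open>Components with the same parent have different roots, because the enumeration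
    has no repetitions, and these roots are among the at most \<open>b\<close> branching roots that
    follow the parent.\<close>
  have fibre: "card {x \<in> F. g x = \<kappa>} \<le> b" if F: "finite F" "F \<subseteq> I" and \<kappa>: "\<kappa> \<in> g ` F" for F \<kappa>
  proof -
    obtain k t where kt: "\<kappa> = (k, t)" by (cases \<kappa>)
    let ?F = "{x \<in> F. g x = \<kappa>}"
    have fk: "x \<in> I" "fst x = k + 1" "r x = t" if "x \<in> ?F" for x
      using that F(2) by (auto simp: g_def kt)
    have "inj_on s ?F"
    proof (rule inj_onI)
      fix x y assume x: "x \<in> ?F" and y: "y \<in> ?F" and eq: "s x = s y"
      have eqZ: "Z (k + 1) (snd x) = Z (k + 1) (snd y)"
        using rs[OF fk(1)[OF x]] rs[OF fk(1)[OF y]] fk[OF x] fk[OF y] eq by simp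
      have adm: "admissible G p u (k + 1)" "snd x \<in> upto_enat (n (k + 1))" "snd y \<in> upto_enat (n (k + 1))"
        using rs[OF fk(1)[OF x]] rs[OF fk(1)[OF y]] fk(2)[OF x] fk(2)[OF y] by simp_all
      have "snd x = snd y"
        by (rule inj_onD[OF bij_betw_imp_inj_on[OF bij[OF adm(1)]] eqZ adm(2,3)])
      then show "x = y" using fk[OF x] fk[OF y] by (simp add: prod_eq_iff)
    qed
    moreover have "s ` ?F \<subseteq> branch_roots (k + 1) \<inter> D t"
    proof
      fix y assume "y \<in> s ` ?F"
      then obtain x where "x \<in> ?F" "y = s x" by blast
      then show "y \<in> branch_roots (k + 1) \<inter> D t"
        using rs[OF fk(1)[of x]] fk(2,3)[of x] by simp
    qed
    moreover have "t \<in> branch_roots k"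
    proof -
      obtain x where "x \<in> ?F" using \<kappa> by blast
      then show ?thesis using rs[OF fk(1)[of x]] fk(2,3)[of x] by simp
    qed
    ultimately show ?thesis
      using branching[of t k] card_inj_on_le[of s ?F "branch_roots (k + 1) \<inter> D t"] by linarith
  qed
  show ?thesis
  proof (intro allI impI)
    fix q :: real assume q: "0 < q"
    let ?a = "approx_number (tree_measure G) p (hardy_op G u v a)"
    let ?A = "\<Sum>\<^sub>\<infinity>m\<in>{1..}. enn_powr (?a m) q"
    \<comment> \<open>\<open>b\<close> bounds the number of components per parent, 3 is the number
      of residue classes, and \<open>C\<close> comes from the comparison with
      \<open>\<tau>\<close>.\<close>
    define C' where "C' = real b * (C powr q * 3)"
    have C': "0 < C'" using b_pos C by (simp add: C'_def)
    have fin: "(\<Sum>x\<in>F. enn_powr (?\<sigma> x) q) \<le> ennreal C' * ?A" if F: "finite F" for F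
    proof -
      let ?F = "F \<inter> I"
      have "(\<Sum>x\<in>F. enn_powr (?\<sigma> x) q) = (\<Sum>x\<in>?F. enn_powr (?\<sigma> x) q)"
        using F by (intro sum.mono_neutral_right) (auto simp: I_def enn_powr_def)
      also have "\<dots> \<le> (\<Sum>x\<in>?F. ennreal (C powr q) * enn_powr (ennreal (\<tau> (g x))) q)"
      proof (rule sum_mono)
        fix x assume "x \<in> ?F"
        then have "?\<sigma> x \<le> ennreal C * ennreal (\<tau> (g x))"
          using rs[of x] C by (simp add: g_def ennreal_mult[symmetric] \<tau>_def)
        from enn_powr_mono[OF q this]
        show "enn_powr (?\<sigma> x) q \<le> ennreal (C powr q) * enn_powr (ennreal (\<tau> (g x))) q"
          by (simp add: enn_powr_mult[OF C])
      qed
      also have "\<dots> = ennreal (C powr q) * (\<Sum>x\<in>?F. enn_powr (ennreal (\<tau> (g x))) q)"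
        by (simp add: sum_distrib_left)
      also have "\<dots> \<le> ennreal (C powr q) * (of_nat b * (\<Sum>\<kappa>\<in>g ` ?F. enn_powr (ennreal (\<tau> \<kappa>)) q))"
        using F fibre[of ?F] by (intro mult_left_mono sum_comp_le[where t = "\<lambda>\<kappa>. enn_powr (ennreal (\<tau> \<kappa>)) q"]) auto
      also have "\<dots> \<le> ennreal (C powr q) * (of_nat b * (3 * ?A))"
      proof -
        have "g ` ?F \<subseteq> clusters" using rs by (auto simp: clusters_def g_def)
        then show ?thesis
          using sum_clusters_le[OF v, of "g ` ?F" q] F q
          unfolding T \<tau>_def \<nu>_def by (intro mult_left_mono) auto
      qed
      also have "\<dots> = ennreal C' * ?A"
        by (simp add: C'_def ennreal_mult ennreal_of_nat_eq_real_of_nat mult_ac)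
      finally show ?thesis .
    qed
    have "lq_norm q (UNIV \<times> {1..}) ?\<sigma> \<le> enn_powr (ennreal C' * ?A) (1 / q)"
      unfolding lq_norm_def using q fin
      by (intro enn_powr_mono infsum_le_finite_sums_ennreal) auto
    also have "\<dots> = ennreal (C' powr (1 / q)) * lq_norm q {1..} ?a"
      by (simp add: lq_norm_def enn_powr_mult[OF C'])
    finally show "\<exists>c>0. lq_norm q (UNIV \<times> {1..}) ?\<sigma> \<le> ennreal c * lq_norm q {1..} ?a"
      using C' by (intro exI[of _ "C' powr (1 / q)"]) simp
  qed
qed

end
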